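(* Let $\mathcal{F}'=\{F_1,F_2,F_3,F_4,F_5\}$ be the family of $3$-graphs with edge sets (writing $abc$ for $\{a,b,c\}$) \[F_1=\{123,124,134\},\] \[F_2=\{123,124,125,345\},\] \[F_3=\{123,124,235,145,345\},\] \[F_4=\{123,135,145,245,126,246,346,356,237,147,347,257,167\},\] \[F_5=\{123,124,135,145,236,346,256,456,247,347,257,357,167\},\] on vertex sets $[4],[5],[5],[7],[7]$ respectively. Then the Turán density of $\mathcal{F}'$ satisfies $\pi(\mathcal{F}')\leq 0.2299$.
   Context: A $3$-graph is a pair $F=(V(F),E(F))$ where $V(F)$ is a finite set of vertices and $E(F)$ is a family of $3$-element subsets of $V(F)$ called edges. Here $[n]=\{1,\ldots,n\}$. Given a family $\mathcal{F}$ of $3$-graphs, a $3$-graph $H$ is $\mathcal{F}$-free if $H$ does not contain a (not necessarily induced) subgraph isomorphic to any member of $\mathcal{F}$. The Turán number is $\mathrm{ex}(n,\mathcal{F})=\max\{|E(H)|: H \text{ is } \mathcal{F}\text{-free},\ |V(H)|=n\}$, and the Turán density is $\pi(\mathcal{F})=\lim_{n\to\infty}\mathrm{ex}(n,\mathcal{F})/\binom{n}{3}$ (this limit always exists). *)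

theory Defs
  imports Complex_Main
begin

type_synonym 'a hypergraph = "'a set \<times> 'a set set"

abbreviation verts :: "'a hypergraph \<Rightarrow> 'a set" where "verts \<equiv> fst"
abbreviation edges :: "'a hypergraph \<Rightarrow> 'a set set" where "edges \<equiv> snd"

definition three_graph :: "'a hypergraph \<Rightarrow> bool" where
  "three_graph G \<longleftrightarrow> finite (verts G) \<and> (\<forall>e\<in>edges G. e \<subseteq> verts G \<and> card e = 3)"

definition subgraph :: "'a hypergraph \<Rightarrow> 'a hypergraph \<Rightarrow> bool" where
  "subgraph G H \<longleftrightarrow> three_graph G \<and> verts G \<subseteq> verts H \<and> edges G \<subseteq> edges H"

definition isomorphic :: "'a hypergraph \<Rightarrow> 'b hypergraph \<Rightarrow> bool" where
  "isomorphic F G \<longleftrightarrow>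
     (\<exists>f. bij_betw f (verts F) (verts G) \<and> edges G = (\<lambda>e. f ` e) ` edges F)"

definition free :: "'b hypergraph set \<Rightarrow> 'a hypergraph \<Rightarrow> bool" where
  "free \<F> H \<longleftrightarrow> \<not> (\<exists>F\<in>\<F>. \<exists>G. subgraph G H \<and> isomorphic F G)"

text \<open>Every 3-graph has an isomorphic copy with vertices in \<open>nat\<close>, so it suffices to let
  the host graph range over such graphs. The set below is finite; it is non-empty whenever
  every member of the family has an edge. Otherwise it may be empty, and \<open>Max\<close> unspecified.\<close>

definition turan_number :: "nat \<Rightarrow> 'b hypergraph set \<Rightarrow> nat" where
  "turan_number n \<F> =
     Max {card (edges H) | H :: nat hypergraph. three_graph H \<and> card (verts H) = n \<and> free \<F> H}"

definition turan_density :: "'b hypergraph set \<Rightarrow> real" where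
  "turan_density \<F> = lim (\<lambda>n. real (turan_number n \<F>) / real (n choose 3))"

definition F1 :: "nat hypergraph" where
  "F1 = ({1..4}, {{1,2,3}, {1,2,4}, {1,3,4}})"

definition F2 :: "nat hypergraph" where
  "F2 = ({1..5}, {{1,2,3}, {1,2,4}, {1,2,5}, {3,4,5}})"

definition F3 :: "nat hypergraph" where
  "F3 = ({1..5}, {{1,2,3}, {1,2,4}, {2,3,5}, {1,4,5}, {3,4,5}})"

definition F4 :: "nat hypergraph" where
  "F4 = ({1..7}, {{1,2,3}, {1,3,5}, {1,4,5}, {2,4,5}, {1,2,6}, {2,4,6}, {3,4,6}, {3,5,6},
                  {2,3,7}, {1,4,7}, {3,4,7}, {2,5,7}, {1,6,7}})"

definition F5 :: "nat hypergraph" where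
  "F5 = ({1..7}, {{1,2,3}, {1,2,4}, {1,3,5}, {1,4,5}, {2,3,6}, {3,4,6}, {2,5,6}, {4,5,6},
                  {2,4,7}, {3,4,7}, {2,5,7}, {3,5,7}, {1,6,7}})"

definition F_family :: "nat hypergraph set" where
  "F_family = {F1, F2, F3, F4, F5}"

lemma three_graph_F_family: "F \<in> F_family \<Longrightarrow> three_graph F"
  by (auto simp: F_family_def F1_def F2_def F3_def F4_def F5_def three_graph_def)

end

theory Submission
  imports Defs
begin

text \<open>The proof is a flag algebra computation on seven vertices, carried out with independent random
  vertices instead of limits.

  Every two vertices of a member of the family lie in a common edge. Hence a homomorphism from a member
  to a hypergraph is injective, and a free hypergraph does not contain homomorphic images either
  (\<open>free_no_homomorphism\<close>). If seven vertices of a free hypergraph are drawn independently, with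
  repetition, the incidences between them form a pattern on seven indices that is symmetric and admits
  no homomorphism from a member of the family. It suffices to bound the density of ordered edges by
  0.2299 (\<open>turan_density_le\<close>).

  The weight of a pattern is a multiple of the indicator that the first three vertices form an edge,
  plus two forms. In each form some of the vertices are labelled, the remaining ones are divided into
  two groups of equal size, and the form is the inner product of two vectors that depend on the labelled
  vertices together with one group. As the two groups are independent, the mean of the form is a sum of
  squares (\<open>sum_dot_nonneg\<close>, \<open>sum_symmetrised_ge\<close>). So the mean weight is at least a
  multiple of the edge density. On the other hand, the average weight over all orders of the seven
  indices is bounded for every pattern without homomorphic images, and the vectors are chosen such that
  this bound is 0.2299 times the multiple (\<open>symmetrised_le\<close>).

  The pointwise bound is a finite check. By symmetry only patterns have to be considered that are
  lexicographically maximal among their relabellings. They are enumerated triple by triple, a prefix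
  being dropped when it contains a copy of one of the three small members or when an involution shows
  that it is not maximal (\<open>search_sound\<close>). About five thousand patterns are left, and for each
  of them the average weight is computed. The average over the 5040 orders is first reduced along
  cosets to 21 and 105 terms (\<open>symmetrised_eq_total\<close>), and all tables are turned into rewrite
  rules for literal lists of truth values, so that the enumeration is one evaluation by rewriting.\<close>

section \<open>Edge counts and the density\<close>

lemma three_graph_edges_bound:
  assumes "three_graph H"
  shows "finite (edges H)" "card (edges H) \<le> card (verts H) choose 3"
proof -
  have sub: "edges H \<subseteq> {e. e \<subseteq> verts H \<and> card e = 3}" and fin: "finite (verts H)"
    using assms by (auto simp: three_graph_def)
  have fs: "finite {e. e \<subseteq> verts H \<and> card e = 3}"
    using fin by simp
  show "finite (edges H)" using sub fs by (rule finite_subset)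
  show "card (edges H) \<le> card (verts H) choose 3"
    using card_mono[OF fs sub] n_subsets[OF fin] by simp
qed

definition turan_sizes :: "nat \<Rightarrow> 'b hypergraph set \<Rightarrow> nat set" where
  "turan_sizes n \<F> =
     {card (edges H) | H :: nat hypergraph. three_graph H \<and> card (verts H) = n \<and> free \<F> H}"

lemma turan_number_eq_Max: "turan_number n \<F> = Max (turan_sizes n \<F>)"
  by (simp add: turan_number_def turan_sizes_def)

lemma finite_turan_sizes: "finite (turan_sizes n \<F>)"
  by (rule finite_subset[of _ "{..n choose 3}"])
    (auto simp: turan_sizes_def dest: three_graph_edges_bound(2))

lemma turan_sizes_nonempty:
  assumes "\<And>F. F \<in> \<F> \<Longrightarrow> edges F \<noteq> {}"
  shows "turan_sizes n \<F> \<noteq> {}"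
proof -
  define E where "E = ({..<n} :: nat set, {} :: nat set set)"
  have "edges F = {}" if "isomorphic F G" "subgraph G E" for F :: "'b hypergraph" and G
    using that by (auto simp: isomorphic_def subgraph_def E_def)
  then have "free \<F> E" using assms unfolding free_def by blast
  moreover have "three_graph E" "card (verts E) = n" by (simp_all add: three_graph_def E_def)
  ultimately have "card (edges E) \<in> turan_sizes n \<F>" unfolding turan_sizes_def by blast
  then show ?thesis by blast
qed

lemma turan_number_le:
  assumes "\<And>F. F \<in> \<F> \<Longrightarrow> edges F \<noteq> {}"
    and "\<And>H :: nat hypergraph. three_graph H \<Longrightarrow> card (verts H) = n \<Longrightarrow> free \<F> H \<Longrightarrow> real (card (edges H)) \<le> c"
  shows "real (turan_number n \<F>) \<le> c"
proof -
  have "turan_number n \<F> \<in> turan_sizes n \<F>"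
    unfolding turan_number_eq_Max
    using Max_in[OF finite_turan_sizes turan_sizes_nonempty[OF assms(1)]] .
  then obtain H :: "nat hypergraph" where "three_graph H" "card (verts H) = n" "free \<F> H"
      "turan_number n \<F> = card (edges H)"
    unfolding turan_sizes_def by blast
  then show ?thesis using assms(2) by simp
qed

lemma le_turan_number:
  assumes "three_graph (H :: nat hypergraph)" "free \<F> H"
  shows "card (edges H) \<le> turan_number (card (verts H)) \<F>"
  unfolding turan_number_eq_Max
  by (rule Max_ge[OF finite_turan_sizes]) (use assms in \<open>unfold turan_sizes_def, blast\<close>)

definition delete_vertex :: "'a \<Rightarrow> 'a hypergraph \<Rightarrow> 'a hypergraph" where
  "delete_vertex v H = (verts H - {v}, {e \<in> edges H. v \<notin> e})"

text \<open>Deleting each vertex in turn, an edge survives in all but three of the resulting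
  hypergraphs.\<close>

lemma sum_delete_vertex:
  assumes "three_graph H"
  shows "(\<Sum>v\<in>verts H. card (edges (delete_vertex v H))) + 3 * card (edges H)
           = card (verts H) * card (edges H)"
proof -
  have fin: "finite (verts H)" "finite (edges H)"
    using assms three_graph_edges_bound(1)[OF assms] by (simp_all add: three_graph_def)
  have "(\<Sum>v\<in>verts H. card {e \<in> edges H. v \<in> e}) = (\<Sum>e\<in>edges H. card {v \<in> verts H. v \<in> e})"
    using sum.swap_restrict[OF fin, of "\<lambda>_ _. 1::nat" "\<lambda>v e. v \<in> e"] by simp
  also have "\<dots> = (\<Sum>e\<in>edges H. 3)"
  proof (rule sum.cong)
    fix e assume "e \<in> edges H"
    then have "{v \<in> verts H. v \<in> e} = e" "card e = 3"
      using assms by (auto simp: three_graph_def)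
    then show "card {v \<in> verts H. v \<in> e} = 3" by simp
  qed simp
  finally have deg: "(\<Sum>v\<in>verts H. card {e \<in> edges H. v \<in> e}) = 3 * card (edges H)"
    by simp
  have "card (edges (delete_vertex v H)) + card {e \<in> edges H. v \<in> e} = card (edges H)" for v
  proof -
    have "edges H = {e \<in> edges H. v \<notin> e} \<union> {e \<in> edges H. v \<in> e}" by auto
    then have "card (edges H) = card {e \<in> edges H. v \<notin> e} + card {e \<in> edges H. v \<in> e}"
      using fin(2) by (metis (no_types, lifting) card_Un_disjoint disjoint_iff finite_Un mem_Collect_eq)
    then show ?thesis by (simp add: delete_vertex_def)
  qed
  then have "(\<Sum>v\<in>verts H. card (edges (delete_vertex v H)) + card {e \<in> edges H. v \<in> e})
      = card (verts H) * card (edges H)"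
    by simp
  then show ?thesis using deg by (simp add: sum.distrib)
qed

lemma free_delete_vertex:
  assumes "free \<F> H"
  shows "free \<F> (delete_vertex v H)"
proof -
  have "subgraph G H" if "subgraph G (delete_vertex v H)" for G
    using that by (auto simp: subgraph_def delete_vertex_def)
  then show ?thesis using assms unfolding free_def by blast
qed

lemma three_graph_delete_vertex: "three_graph H \<Longrightarrow> three_graph (delete_vertex v H)"
  by (auto simp: three_graph_def delete_vertex_def)

lemma turan_number_step:
  assumes ne: "\<And>F. F \<in> \<F> \<Longrightarrow> edges F \<noteq> {}" and n: "n \<ge> 3"
  shows "(real n - 2) * real (turan_number (Suc n) \<F>) \<le> (real n + 1) * real (turan_number n \<F>)"
proof -
  have "real (turan_number (Suc n) \<F>) \<le> (real n + 1) * real (turan_number n \<F>) / (real n - 2)"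
  proof (rule turan_number_le[OF ne])
    fix H :: "nat hypergraph"
    assume H: "three_graph H" "card (verts H) = Suc n" "free \<F> H"
    have "card (edges (delete_vertex v H)) \<le> turan_number n \<F>" if "v \<in> verts H" for v
    proof -
      have "card (verts (delete_vertex v H)) = n"
        using that H by (simp add: delete_vertex_def three_graph_def)
      then show ?thesis
        using le_turan_number[OF three_graph_delete_vertex[OF H(1)] free_delete_vertex[OF H(3)]]
        by metis
    qed
    then have "(\<Sum>v\<in>verts H. card (edges (delete_vertex v H))) \<le> Suc n * turan_number n \<F>"
      using sum_bounded_above[of "verts H"] H(2) by (metis of_nat_id)
    then have "Suc n * card (edges H) \<le> Suc n * turan_number n \<F> + 3 * card (edges H)"
      using sum_delete_vertex[OF H(1)] unfolding H(2) by linarith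
    then have "real (Suc n * card (edges H)) \<le> real (Suc n * turan_number n \<F> + 3 * card (edges H))"
      using of_nat_le_iff by blast
    then have "(real n - 2) * real (card (edges H)) \<le> (real n + 1) * real (turan_number n \<F>)"
      by (simp add: algebra_simps)
    then show "real (card (edges H)) \<le> (real n + 1) * real (turan_number n \<F>) / (real n - 2)"
      using n by (simp add: field_simps)
  qed
  then show ?thesis using n by (simp add: field_simps)
qed

text \<open>By averaging over vertex deletions the densities decrease, so the limit in the definition of
  the Turan density exists; this makes a bound of order \<open>n ^ 3\<close> on the edge numbers
  a bound on the density.\<close>

theorem turan_density_le:
  assumes ne: "\<And>F. F \<in> \<F> \<Longrightarrow> edges F \<noteq> {}"
    and bd: "\<And>H :: nat hypergraph. three_graph H \<Longrightarrow> free \<F> H \<Longrightarrow>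
               6 * real (card (edges H)) \<le> c * real (card (verts H)) ^ 3"
  shows "turan_density \<F> \<le> c"
proof -
  define d where "d n = real (turan_number n \<F>) / real (n choose 3)" for n
  have ch: "6 * real (n choose 3) = real n * (real n - 1) * (real n - 2)" for n
  proof (induction n)
    case (Suc n)
    have "2 * real (n choose 2) = real n * (real n - 1)"
      by (induction n) (simp_all add: numeral_2_eq_2 algebra_simps)
    then show ?case using Suc by (simp add: numeral_3_eq_3 numeral_2_eq_2 algebra_simps)
  qed simp
  have dec: "d (Suc n) \<le> d n" if n: "n \<ge> 3" for n
  proof -
    have pos: "0 < real (n choose 3)" "0 < real (Suc n choose 3)"
      using n by (simp_all add: zero_less_binomial)
    have "(real n - 2) * (6 * real (Suc n choose 3)) = (real n + 1) * (6 * real (n choose 3))"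
      unfolding ch by simp
    then have eq: "real (Suc n choose 3) = (real n + 1) * real (n choose 3) / (real n - 2)"
      using n by (simp add: field_simps)
    have "d (Suc n) = ((real n - 2) * real (turan_number (Suc n) \<F>)) / ((real n + 1) * real (n choose 3))"
      using n pos unfolding d_def eq by (simp add: field_simps)
    also have "\<dots> \<le> ((real n + 1) * real (turan_number n \<F>)) / ((real n + 1) * real (n choose 3))"
      using turan_number_step[OF ne n] pos by (intro divide_right_mono) auto
    also have "\<dots> = d n" by (simp add: d_def)
    finally show ?thesis .
  qed
  have decs: "decseq (\<lambda>n. d (n + 3))"
    using dec by (intro decseq_SucI) (metis add_Suc le_add2)
  have "bdd_below (range (\<lambda>n. d (n + 3)))"
    by (rule bdd_belowI[of _ 0]) (auto simp: d_def)
  then have "convergent (\<lambda>n. d (n + 3))"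
    using LIMSEQ_decseq_INF[OF _ decs] convergentI by metis
  then have "convergent d" using convergent_ignore_initial_segment[of d 3] by simp
  moreover have "turan_density \<F> = lim d" by (simp add: turan_density_def d_def[abs_def])
  ultimately have lim: "d \<longlonglongrightarrow> turan_density \<F>" by (simp add: convergent_LIMSEQ_iff)
  have up: "d n \<le> c * (real n ^ 3 / (real n * (real n - 1) * (real n - 2)))" if n: "n \<ge> 3" for n
  proof -
    have "real (turan_number n \<F>) \<le> c * real n ^ 3 / 6"
      proof (rule turan_number_le[OF ne])
      fix H :: "nat hypergraph" assume "three_graph H" "card (verts H) = n" "free \<F> H"
      then show "real (card (edges H)) \<le> c * real n ^ 3 / 6" using bd[of H] by simp
    qed
    then have "d n \<le> (c * real n ^ 3 / 6) / real (n choose 3)"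
      unfolding d_def by (intro divide_right_mono) auto
    also have "\<dots> = c * real n ^ 3 / (6 * real (n choose 3))" by simp
    finally show ?thesis unfolding ch by simp
  qed
  have "(\<lambda>n. 1 / ((1 - 1 / real n) * (1 - 2 / real n))) \<longlonglongrightarrow> 1 / ((1 - 0) * (1 - 0))"
    by (intro tendsto_intros lim_const_over_n) auto
  moreover have "1 / ((1 - 1 / x) * (1 - 2 / x)) = x ^ 3 / (x * (x - 1) * (x - 2))"
    if "x > 2" for x :: real
  proof -
    have "1 - 1 / x = (x - 1) / x" "1 - 2 / x = (x - 2) / x" using that by (simp_all add: field_simps)
    then show ?thesis using that by (simp add: power3_eq_cube)
  qed
  then have "\<forall>\<^sub>F n in sequentially. 1 / ((1 - 1 / real n) * (1 - 2 / real n))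
      = real n ^ 3 / (real n * (real n - 1) * (real n - 2))"
    by (intro eventually_sequentiallyI[of 3]) auto
  ultimately have "(\<lambda>n. real n ^ 3 / (real n * (real n - 1) * (real n - 2))) \<longlonglongrightarrow> 1 / ((1 - 0) * (1 - 0))"
    by (rule Lim_transform_eventually)
  then have "(\<lambda>n. c * (real n ^ 3 / (real n * (real n - 1) * (real n - 2)))) \<longlonglongrightarrow> c * (1 / ((1 - 0) * (1 - 0)))"
    by (intro tendsto_mult tendsto_const)
  then have "turan_density \<F> \<le> c * (1 / ((1 - 0) * (1 - 0)))"
    by (rule LIMSEQ_le[OF lim]) (intro exI[of _ 3] allI impI up)
  then show ?thesis by simp
qed

definition covers_pairs :: "'b hypergraph \<Rightarrow> bool" where
  "covers_pairs F \<longleftrightarrow> (\<forall>x\<in>verts F. \<forall>y\<in>verts F. \<exists>e\<in>edges F. x \<in> e \<and> y \<in> e)"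

text \<open>A homomorphism keeps the vertices of an edge distinct, because the image of an edge has three
  elements. If every pair of vertices lies in an edge, a homomorphism is therefore injective, and a
  free hypergraph does not even have homomorphic images.\<close>

lemma free_no_homomorphism:
  assumes "free \<F> H" "three_graph H" "F \<in> \<F>" "three_graph F" "covers_pairs F"
  shows "\<exists>e\<in>edges F. \<phi> ` e \<notin> edges H"
proof (rule ccontr)
  assume "\<not> ?thesis"
  then have hom: "\<phi> ` e \<in> edges H" if "e \<in> edges F" for e using that by blast
  have inj: "inj_on \<phi> (verts F)"
  proof (rule inj_onI)
    fix x y assume xy: "x \<in> verts F" "y \<in> verts F" "\<phi> x = \<phi> y"
    then obtain e where e: "e \<in> edges F" "x \<in> e" "y \<in> e"
      using assms(5) by (auto simp: covers_pairs_def)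
    have "card e = 3" "card (\<phi> ` e) = 3"
      using e hom[of e] assms(2,4) by (auto simp: three_graph_def)
    then have "inj_on \<phi> e"
      by (metis card.infinite eq_card_imp_inj_on numeral_eq_Suc nat.distinct(1))
    then show "x = y" using e xy by (auto dest: inj_onD)
  qed
  let ?G = "(\<phi> ` verts F, (\<lambda>e. \<phi> ` e) ` edges F)"
  have "three_graph ?G"
    unfolding three_graph_def
  proof (intro conjI ballI)
    show "finite (verts ?G)" using assms(4) by (simp add: three_graph_def)
    fix e' assume "e' \<in> edges ?G"
    then obtain e where e: "e \<in> edges F" "e' = \<phi> ` e" by auto
    then have *: "e \<subseteq> verts F" "card e = 3" using assms(4) by (auto simp: three_graph_def)
    show "e' \<subseteq> verts ?G" using e * by (simp add: image_mono)
    show "card e' = 3" using e * card_image[OF inj_on_subset[OF inj *(1)]] by simp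
  qed
  moreover have "verts ?G \<subseteq> verts H"
  proof
    fix v assume "v \<in> verts ?G"
    then obtain x where x: "x \<in> verts F" "v = \<phi> x" by auto
    then obtain e where "e \<in> edges F" "x \<in> e" using assms(5) by (auto simp: covers_pairs_def)
    moreover from this have "\<phi> ` e \<subseteq> verts H" using hom[of e] assms(2) by (simp add: three_graph_def)
    ultimately show "v \<in> verts H" using x by blast
  qed
  ultimately have "subgraph ?G H" using hom by (auto simp: subgraph_def)
  moreover have "isomorphic F ?G"
    unfolding isomorphic_def using inj by (auto simp: bij_betw_def)
  ultimately show False using assms(1,3) by (auto simp: free_def)
qed

section \<open>The vectors of the certificate\<close>

text \<open>The vectors below are the data of the certificate. They come from a numerical semidefinite program
  for the flags on seven vertices, whose optimal matrices were factorised and rounded to integers.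
  Table 0 belongs to flags with five vertices of which three are labelled, the others to flags with six
  vertices of which five are labelled. Each entry pairs a vector with the class of flags that carries
  it; a flag is coded by the binary number of its incidences, and a negative code means that the flag
  carries the negative of the vector. The signs separate the symmetric from the antisymmetric parts
  with respect to the automorphisms of the labelled vertices.\<close>

definition V0 :: "(int list \<times> int list) list" where "V0 = [
  ([- 515, - 702, - 77, - 270],[0]),([108, - 2179, - 78,604],[18,36,72]),([- 66, - 612, - 92, - 396],[2,4,8,16,32,64]),
  ([- 1208,1361,416,373],[134,176,266,336,524,608]),([659,587,419, - 168],[6,10,12,48,80,96]),
  ([- 7, - 378, - 224, - 3],[130,132,144,160,258,264,272,320,516,520,544,576]),
  ([- 734, - 520, - 276,86],[128,256,512]),([1824,2278,179,901],[896]),([669, - 35, - 213,300],[384,640,768]),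
  ([- 226, - 550,693, - 205],[20,24,34,40,66,68]),([- 55,149, - 331,286],[136,192,260,288,514,528]),
  ([3909,0,0,0],[58,60,86,92,102,106]),
  ([- 1080, - 654, - 43, - 613],[156,170,212,226,284,312,326,354,554,568,582,596]),
  ([1027,3464,0,0],[424,452,664,706,788,802]),
  ([939,1080,108,506],[202,204,216,232,294,300,308,356,534,538,562,594]),
  ([3131,775, - 215,140],[54,90,108]),([193, - 571, - 258,87],[396,480,650,720,774,816]),
  ([- 348,173,50, - 24],[138,140,208,224,262,268,304,352,518,522,560,592]),
  ([963,93,843,510],[22,26,38,44,50,52,74,76,82,88,100,104]),
  ([804,1599, - 161,181],[388,392,416,448,642,648,656,704,770,772,784,800]),
  ([- 610,461, - 30, - 633],[148,162,280,322,552,580]),([300,250,1100,0],[28,42,56,70,84,98]),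
  ([- 495,975,16, - 307],[152,168,194,196,276,290,296,324,532,536,546,578]),
  ([1367,714, - 525,910],[200,292,530]),([- 748,2067,0],[19,37,73]),([164,884, - 271],[1]),
  ([- 550,139,310],[3,5,9,17,33,65]),([- 32,717, - 497],[129,257,513]),
  ([72, - 1459, - 529],[389,393,417,449,643,649,657,705,771,773,785,801]),
  ([1002, - 1337, - 301],[153,169,195,197,277,291,297,325,533,537,547,579]),
  ([2478,0,0],[21,25,35,41,67,69]),([415, - 622,74],[149,163,281,323,553,581]),
  ([- 878, - 147,1047],[131,133,145,161,259,265,273,321,517,521,545,577]),
  ([1458, - 123, - 753],[385,641,769]),([- 918, - 1628, - 577],[137,193,261,289,515,529])]"

definition V1 :: "(int list \<times> int list) list" where "V1 = [
  ([676,301, - 564, - 270,191, - 537, - 1],[32]),([602,253,116, - 448,84, - 555,0],[0]),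
  ([781,184, - 157,142, - 7, - 170, - 1],[3,5,9,17]),([450, - 269, - 453, - 283, - 162, - 398,1],[12,18]),
  ([87, - 187,92, - 121, - 126, - 7,1],[192]),([299,46, - 53,475,2, - 340,0],[64,128]),
  ([484, - 45, - 212, - 84, - 43, - 154,0],[6,24]),([353,130, - 449, - 462,55, - 610,1],[2,4,8,16]),
  ([3136,0,0,0,0,0,0],[257,513]),([2427,747,431,184, - 458,745, - 2],[1]),
  ([- 282, - 419,22, - 230,243,376,1],[320,384,576,640]),([1513,1005,1581,605,132,621, - 2],[65,129]),
  ([204,34, - 898, - 94, - 130, - 524,0],[68,80,130,136]),([- 1082, - 84,403,429, - 5,574,0],[774,792]),
  ([- 239,183, - 448,273,198,90, - 1],[288,544]),([- 216,233, - 438,89,567,118, - 2],[96,160]),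
  ([338, - 1149, - 826,445, - 137,778,1],[66,72,132,144]),([- 333,122,400, - 94,50, - 82,0],[280,518]),
  ([486, - 90,854,138,69,434,0],[67,73,133,145]),([- 843, - 1174, - 1162,356,37,628,0],[332,402,594,652]),
  ([- 902,29, - 14, - 533,4, - 96,1],[352,416,608,672]),([77,206, - 101, - 56,93, - 201, - 1],[256,512]),
  ([- 156, - 204, - 1004, - 472,44, - 315,1],[264,272,514,516]),([- 1536,2633,0,0,0,0,0],[769]),
  ([126,660,1463, - 360, - 112, - 299,1],[265,273,515,517]),
  ([- 738, - 956, - 955,589, - 103,792,0],[456,464,706,708]),([- 1114,1194,2148,0,0,0,0],[771,773,777,785]),
  ([- 216, - 439, - 1210,790, - 516,340, - 1],[194,196,200,208]),
  ([573,455,1111,11, - 779, - 173,1],[259,261,521,529]),([- 71, - 53,309,118, - 116,185,0],[262,536]),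
  ([- 638,189, - 379, - 90,248, - 481,0],[268,274,524,530]),([- 1749,31,260, - 108,1113,0,0],[770,772,776,784]),
  ([- 801,150,72,356,122,270, - 1],[768]),([1170,420,1590, - 42,69,566,1],[321,385,577,641]),
  ([- 582,269, - 278, - 589,293,23,0],[336,392,580,642]),([251, - 320, - 570,428, - 152,102, - 1],[70,88,134,152]),
  ([- 378,1,531,959, - 442,250,1],[324,386,592,648]),([- 761, - 476, - 503,2051,0,0,0],[204,210]),
  ([- 1113, - 519, - 76, - 39, - 44,422,1],[328,400,578,644]),
  ([1124,268,826, - 467, - 960, - 528,2],[69,81,131,137]),([99, - 519, - 861, - 127,101, - 66,0],[76,82,140,146]),
  ([214,131, - 228,42,139, - 312,486],[258,260,520,528]),([- 319, - 36,704,87, - 191,335,1],[337,393,581,643]),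
  ([- 945, - 334,606,333, - 202,676,1],[472,710]),([- 78, - 162,342,362, - 1007,260,1],[325,387,593,649]),
  ([- 797, - 187, - 165,472, - 158,216,0],[344,408,582,646]),([- 510,7,901,273, - 240,449,1],[329,401,579,645]),
  ([- 182, - 156,53, - 154, - 23,8,1],[224]),([- 543, - 301,224,231, - 141,479,1],[448,704]),
  ([- 104, - 316,308,174, - 261,383,1],[198,216]),([- 1352, - 188, - 82,430,695,669, - 1],[780,786]),
  ([- 1030, - 274,90,401, - 9,651,0],[480,736])]"

definition V2 :: "(int list \<times> int list) list" where "V2 = [
  ([19, - 749, - 62,352,40,219],[- 3,5, - 9,17]),([1132,41,878,316,369, - 172],[64, - 128]),
  ([435,404, - 201, - 483,882,0],[2, - 4,8, - 16]),([743,195,575,423,60,116],[320, - 384,576, - 640]),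
  ([- 712, - 57, - 231, - 327,28, - 224],[- 65,129]),([- 408,475, - 778, - 92, - 246,48],[- 68, - 80,130,136]),
  ([540,202,1265,777, - 219,83],[96, - 160]),([1214,2061,41,489,487, - 103],[66,72, - 132, - 144]),
  ([1145,577,231,905,491,227],[67,73, - 133, - 145]),([730,720, - 1316,176, - 534,699],[332, - 402,594, - 652]),
  ([856,542,246,607,287,158],[352, - 416,608, - 672]),([- 118,726,247,148,273, - 254],[264, - 272,514, - 516]),
  ([- 288, - 684,715, - 370, - 3, - 320],[- 265,273, - 515,517]),
  ([675,1166, - 1540,458, - 202,650],[456, - 464,706, - 708]),
  ([146,179,1300, - 14,483, - 575],[771, - 773,777, - 785]),([928,382,124,933,398,96],[194, - 196,200, - 208]),
  ([608,881, - 1319, - 160,167,233],[259, - 261,521, - 529]),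
  ([- 1100, - 120, - 79, - 412,185, - 102],[268, - 274, - 524,530]),([- 266,155, - 221,1228,0,0],[770, - 772,776, - 784]),
  ([991,520, - 435,680,528,418],[321, - 385,577, - 641]),([1879, - 241,1760,0,0,0],[336, - 392,580, - 642]),
  ([- 1143, - 449, - 409, - 61, - 276,173],[- 70, - 88,134,152]),
  ([- 517,806, - 908,888,615,157],[- 324,386, - 592,648]),([1351,2446,0,0,0,0],[328, - 400,578, - 644]),
  ([55,209, - 19,137,156, - 37],[- 69, - 81,131,137]),([- 1421, - 1233,663, - 413,271, - 556],[- 76, - 82,140,146]),
  ([871, - 701, - 725,290, - 131, - 51],[258, - 260,520, - 528]),([3048,0,0,0,0,0],[337, - 393,581, - 643]),
  ([- 222, - 47,281,274, - 469, - 92],[325, - 387,593, - 649]),([1244,824, - 3,905,328,384],[344, - 408,582, - 646]),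
  ([1364,1462, - 802,417, - 166,532],[329, - 401,579, - 645])]"

definition V3 :: "(int list \<times> int list) list" where "V3 = [
  ([- 22, - 45,22, - 11, - 41, - 10],[0]),([- 29, - 68,76, - 7, - 34, - 30],[4,16,256,512]),
  ([- 376,587, - 191, - 83, - 441, - 95],[160]),([- 36, - 6,374, - 87, - 11,38],[272,516]),
  ([- 304, - 6,662, - 31,98, - 223],[32,128]),([487, - 139, - 41,214,711,54],[20,260,528,768]),
  ([- 153, - 442, - 109,45, - 194, - 94],[12,18,68,80,257,264,513,514]),
  ([- 900, - 434, - 89, - 114, - 258, - 30],[33,96,130,136]),
  ([- 339,176,227, - 29, - 125,22],[36,48,132,144,288,384,544,640]),
  ([768, - 1409, - 743,140,157,124],[275,344,525,582]),([- 320, - 495,247, - 90, - 396, - 76],[1,2,8,64]),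
  ([757, - 481, - 79, - 118,161, - 267],[5,6,17,24,258,320,520,576]),
  ([311, - 218,304, - 39, - 309,79],[84,268,530,769]),
  ([246,471,71, - 47,44,88],[22,28,261,324,529,592,770,776]),
  ([544,84, - 286,112,581,95],[86,92,269,332,531,594,771,777]),
  ([- 845,1740,1296,0,0,0],[164,176,416,672]),
  ([124, - 291, - 672, - 24,89,324],[13,19,70,88,259,328,521,578]),
  ([310,286, - 10,230,462, - 58],[284,340,534,596,773,780,785,786]),
  ([- 1, - 83,190,45, - 43, - 171],[100,112,140,146,289,392,545,642]),
  ([191, - 169,97, - 97,202,162],[37,49,134,152,352,386,608,648]),
  ([- 324, - 500, - 246, - 542, - 531,194],[3,9,66,72]),([- 483,585, - 76,168, - 29, - 7],[148,292,560,896]),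
  ([114,945,712, - 96,310,572],[304,400,548,644]),
  ([304,1236, - 525,83,284,132],[150,156,293,356,561,624,898,904]),([2772,0,0,0,0,0],[788]),
  ([532, - 696,145,212,803,0],[348,598,781,787]),([133, - 1952,434, - 47, - 204, - 101],[76,82,265,515]),
  ([109,2189,0,0,0,0],[432,676]),([100, - 856, - 442,418, - 153, - 467],[273,274,280,336,517,518,524,580]),
  ([629,645,918,890,0,0],[276,532,772,784]),
  ([726,985, - 93,1,728,280],[305,368,402,408,549,612,646,652])]"

definition V4 :: "(int list \<times> int list) list" where "V4 = [
  ([- 334, - 382,178,779, - 5],[0]),([1029,2480, - 1930,295,107],[770,784]),
  ([- 1153, - 1193,670, - 1679,32],[10,20]),([1244, - 1611, - 2780,472,145],[274,530]),
  ([- 2283, - 273, - 543,1432,38],[65,129]),([- 471, - 655,247,1024,85],[320,640]),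
  ([- 1637, - 242, - 146, - 752, - 407],[4,8]),([488, - 2773, - 2821, - 770,469],[18]),
  ([- 3457,2812, - 405,797, - 229],[264,516]),([1991,155,1886, - 63,42],[32]),
  ([2362, - 2662,537, - 607,209],[34,48]),([- 2707, - 939, - 346,585, - 12],[80,130]),
  ([- 247, - 1445, - 819,319,234],[2,16]),([716,1009,3341,0,0],[96,160]),
  ([- 1171, - 285,612,27, - 219],[64,128]),([- 113,5222,0,0,0],[768]),([- 93,828, - 102,917,0],[256,512]),
  ([2541, - 1363,500, - 1046,14],[66,144]),([2420,3014,1114,1164, - 92],[288,544]),
  ([177,613,230, - 773, - 23],[266,532]),([1379,1536,994, - 682, - 110],[296,548]),
  ([- 889,3522, - 1704,2271,0],[769]),([362,549, - 886,590,86],[258,528]),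
  ([- 1621,1135, - 1425,1365, - 8],[257,513]),([- 1447, - 770,2496, - 1873, - 90],[36,40]),
  ([1965, - 2881, - 1501, - 159,126],[82,146]),([2506, - 1236,611, - 353,38],[98,176]),
  ([6207,0,0,0,0],[368,674]),([- 1091, - 906, - 1147,822,284],[1]),([- 1813, - 1279,1045,1192, - 57],[192]),
  ([2398,2694,557,1298, - 103],[352,672]),([2642,1769, - 19, - 454, - 125],[304,546]),
  ([1154, - 200, - 1697,1261,79],[336,642]),([1426, - 707, - 1150,1060,174],[272,514]),
  ([4021,516, - 2089,1066,73],[786]),([- 2589, - 598,741, - 1881, - 18],[12]),
  ([3150, - 2308,1241, - 706,2],[112,162]),([2244, - 957,2175,1084, - 91],[224])]"

definition V5 :: "(int list \<times> int list) list" where "V5 = [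
  ([- 2562,1352, - 1344,925],[770, - 784]),([- 2443, - 1270,1120,1274],[10, - 20]),
  ([1347,2882, - 1116,627],[274, - 530]),([- 24, - 34, - 891,225],[65, - 129]),
  ([432, - 1256,2272, - 805],[- 320,640]),([- 80, - 1116,1427,1728],[- 4,8]),
  ([- 1121, - 3019, - 1060, - 1226],[- 264,516]),([3656, - 216, - 265, - 369],[- 34,48]),
  ([2230, - 1992, - 1356,786],[80, - 130]),([- 1842,79, - 345,545],[2, - 16]),([785,54,2580,0],[- 96,160]),
  ([- 741, - 1214, - 1628,914],[64, - 128]),([- 1495, - 3115, - 23, - 308],[- 256,512]),
  ([- 1450,405, - 2232,1240],[66, - 144]),([1004,4765,0,0],[288, - 544]),
  ([1292, - 2846, - 226, - 1771],[- 266,532]),([- 438,2535,1553,1231],[296, - 548]),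
  ([- 2322,3773, - 515, - 50],[258, - 528]),([- 1475, - 945,56,482],[- 257,513]),([72, - 1182,561,1977],[- 36,40]),
  ([- 415,351,2064, - 643],[- 82,146]),([- 2021,1353, - 1401,1773],[98, - 176]),
  ([- 1921, - 402,1194, - 105],[- 368,674]),([725,1542, - 2013,1289],[352, - 672]),([5884,0,0,0],[304, - 546]),
  ([4724, - 1365, - 1552,1484],[336, - 642]),([5400,522,285,365],[272, - 514]),
  ([3107,112, - 1642,62],[112, - 162])]"

definition V6 :: "(int list \<times> int list) list" where "V6 = [
  ([- 2577, - 797,1859, - 1097,223, - 1851,1368,524,93],[30]),
  ([17, - 626, - 1072,1039, - 360, - 170, - 50,175,403],[0]),
  ([1738,151,3848, - 1253, - 113,1802, - 576,709,128],[297,549]),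
  ([- 1478, - 3081,1858, - 145, - 26, - 1062, - 79,169, - 24],[11,21]),
  ([1100,1943,1357, - 1437,32,1477, - 845,441, - 147],[352,672]),
  ([- 2877,396,2934, - 2063, - 351, - 451, - 1530,376, - 2],[51]),
  ([- 49, - 83,249, - 546,477,2410,1336,186, - 24],[32]),([1061, - 198, - 261,526, - 205,745, - 1723, - 291, - 266],[1]),
  ([- 788, - 2504,3158, - 789,204,70,333,1668,0],[45]),([881, - 829, - 2168,467, - 125,272, - 486,74,22],[64,128]),
  ([- 88, - 656, - 662,1062, - 277, - 905, - 790, - 498, - 16],[4,8]),
  ([167, - 1058, - 2551,53, - 32, - 293,460, - 32,144],[68,136]),
  ([- 1106,1687, - 1516, - 1248,108, - 741,456, - 41, - 24],[266,532]),
  ([- 1113,183,1779,2625, - 686, - 294, - 1112, - 55,424],[19]),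
  ([133,57, - 1055,1429, - 570,13, - 556, - 324,416],[2,16]),
  ([- 993, - 1545,2393, - 1556,79,503,316,108,41],[100,168]),
  ([- 2397,77,1243, - 2033,225,209,929,247,60],[38,56]),
  ([234,443,1487,630, - 127, - 939, - 386,30, - 11],[273,515]),
  ([- 772, - 529, - 1755, - 2189, - 169, - 694, - 390, - 952, - 31],[12]),
  ([- 1317, - 1071,599, - 2264,216, - 257,1052,82,58],[36,40]),
  ([772, - 115, - 1716,828,18,280,72, - 233, - 17],[320,640]),
  ([240, - 1139,959,1697, - 210,461, - 473,950,207],[3,17]),
  ([1347, - 1728,606,1505, - 134,93, - 610, - 633, - 80],[257,513]),
  ([- 1094,4016, - 1607,519,175, - 1138,646, - 397, - 110],[274,530]),
  ([293,1298, - 1522,181, - 101, - 409,101, - 1296, - 14],[258,528]),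
  ([- 1805,1049,2396,841,239,1272,585,628,0],[34,48]),
  ([- 2001, - 183, - 1018,880, - 400, - 1811, - 632, - 387,203],[14,28]),
  ([228, - 1816,721,1455,6, - 649, - 513,802, - 101],[5,9]),
  ([- 1975, - 445, - 1956,361,255, - 1146,846,293, - 57],[10,20]),
  ([- 168,851,1623, - 2737,419, - 654,1636, - 636, - 86],[296,548]),
  ([2168,1160, - 298, - 536,145,118,1150,365,218],[264,516]),
  ([1815,957,2358, - 231,149,709, - 51, - 572, - 212],[288,544]),
  ([- 1035, - 499, - 349,1152, - 83, - 1707,616, - 261,149],[6,24]),
  ([1054,116, - 704,402,297,92, - 811, - 1139,167],[256,512]),
  ([- 87, - 428, - 635, - 1629,146,3098,0,0,0],[96,160]),([6536,0,0,0,0,0,0,0,0],[769]),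
  ([820,1346,307, - 1567,536, - 2098,1531, - 966, - 358],[770,784]),
  ([440,1094,2799, - 384,627,931,2040,231, - 61],[304,546]),
  ([376,2266, - 730,648, - 171, - 1455, - 497,192, - 3],[280,518]),
  ([1197, - 2383,2700,1506,76,1963, - 307,267, - 61],[33]),
  ([782, - 390,537, - 459, - 326, - 1578, - 757, - 162,68],[265,517]),
  ([- 1698,260,3977, - 1283,354, - 1289,1623, - 344, - 32],[312,550]),
  ([139,2688,648, - 136, - 104,1845, - 837,485,23],[98,176]),([2301,278,499,405,3561,0,0,0,0],[768]),
  ([867,6170,0,0,0,0,0,0,0],[786]),([- 597, - 487, - 1335, - 152,264, - 988,328, - 647, - 296],[272,514]),
  ([- 227, - 2602,3269, - 291, - 357,782, - 1350,650,129],[37,41]),([- 451,561, - 642,3645,0,0,0,0,0],[18]),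
  ([- 828, - 166, - 1837,846,28,75, - 593, - 344, - 241],[66,144]),
  ([- 925, - 2799,12, - 165, - 33, - 65, - 218,113, - 14],[13]),([- 1996, - 3341,2841, - 1793,741, - 533,3023,0,0],[44]),
  ([- 3993,1122,2950, - 573,379, - 591,1565, - 72, - 11],[50]),([687,710,5912,0,0,0,0,0,0],[305,547]),
  ([- 1055,4148,249, - 789, - 317, - 989, - 713,30,116],[282,534]),
  ([- 269, - 1315,4641,2008, - 4,2238, - 725,1339,36],[35,49]),
  ([- 4201,2275, - 1960, - 756, - 128, - 16, - 498,706,84],[22,26]),
  ([1822, - 1577,3702,757,281,1199,224, - 20, - 205],[289,545])]"

definition V7 :: "(int list \<times> int list) list" where "V7 = [
  ([1483,768,37, - 1795,188,187,0],[297, - 549]),([- 459,1243,929, - 417,61, - 485, - 1],[11, - 21]),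
  ([- 1790, - 2220,1256,805, - 532, - 1091,0],[- 352,672]),([871,215,348,840,701,727,1],[64, - 128]),
  ([- 2238,286,948, - 691, - 55,423,0],[- 4,8]),([1470,782, - 657, - 5,167,1011,1],[68, - 136]),
  ([1773,1911,142, - 1581,1480,1117,0],[266, - 532]),([659,2362,394, - 28,532, - 696,1],[2, - 16]),
  ([720, - 644, - 1755,718,55,1141,1],[100, - 168]),([505,743, - 337,1693,387, - 632,0],[38, - 56]),
  ([3031, - 266,502, - 129,146,514,1],[273, - 515]),([334,1407,1803, - 1803, - 162, - 90, - 1],[- 36,40]),
  ([1259,806, - 879, - 8,586,990,1],[320, - 640]),([- 682,1458, - 1009,641, - 211,184,0],[3, - 17]),
  ([- 450, - 1021,1144,6, - 259, - 316,0],[- 257,513]),([1329, - 10, - 414, - 948,248,877,0],[274, - 530]),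
  ([1293,2527, - 512, - 359,1861, - 469,1],[258, - 528]),([- 950,1810,694, - 998, - 199,615, - 10],[34, - 48]),
  ([1093,1843,1455,25,2282,0,0],[14, - 28]),([- 345, - 420,440, - 1233, - 1288,746, - 1],[- 5,9]),
  ([- 26,1201,3124,0,0,0,0],[10, - 20]),([604,644,349,1506, - 66,675,0],[- 296,548]),
  ([- 1080, - 701,767,1142, - 1229,1097, - 2],[- 264,516]),([122, - 741,1891,1233, - 155,1350,2],[- 288,544]),
  ([- 128, - 516,712, - 519, - 712, - 696, - 1],[- 6,24]),([277, - 199, - 992, - 57,380, - 257,754],[256, - 512]),
  ([416, - 132,79,1532, - 634,1023,1],[96, - 160]),([1431,3912,0,0,0,0,0],[770, - 784]),
  ([4499,0,0,0,0,0,0],[304, - 546]),([- 708,171,557,2963,0,0,0],[- 280,518]),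
  ([806,754, - 706, - 1823, - 150, - 641,1],[265, - 517]),([1293,157, - 138, - 1086, - 45,191,0],[312, - 550]),
  ([957,2002, - 286, - 462,238,407,0],[98, - 176]),([- 434, - 3211, - 447,377,310,1578,0],[272, - 514]),
  ([728, - 214, - 868,1118, - 301, - 559, - 1],[37, - 41]),([483,1872,274,546,139,1622,0],[66, - 144]),
  ([606, - 820, - 351, - 1713, - 18,812,1],[305, - 547]),([4009,1553,621, - 951,99,203,0],[282, - 534]),
  ([159, - 1961, - 873,13, - 412,679,1],[- 35,49]),([- 398, - 136, - 2411,755, - 341,386,1],[22, - 26]),
  ([- 3265, - 1265,117,585,370,651,0],[- 289,545])]"

definition V8 :: "(int list \<times> int list) list" where "V8 = [
  ([205,275,690,267,34],[32,256]),([- 441, - 93, - 87, - 4,0],[0]),([- 1137, - 521,880,582,143],[2,4]),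
  ([475,1138,1283, - 610,17],[226,228,282,284]),([- 805,498, - 1891,912, - 58],[512]),
  ([- 401, - 1071, - 442, - 1312, - 2],[24,192]),([- 500, - 785, - 826, - 111,39],[8,16,64,128]),
  ([722,125, - 1389,501,193],[33,257]),([1187,2571,51,472,92],[288]),
  ([- 401, - 1722, - 461, - 1121, - 35],[80,136]),([647,1812,141,1122,47],[546,548,770,772]),
  ([478,935, - 173, - 1247,0],[41,49,321,385]),([384, - 714, - 1336, - 642, - 82],[9,17,65,129]),
  ([577,861, - 1089, - 419, - 67],[97,161,265,273]),([1804,1844,866, - 279, - 20],[296,304,352,416]),
  ([161,503,793, - 1055,35],[112,168,336,392]),([- 774, - 120, - 2167, - 518,30],[1]),
  ([- 1138, - 1378,255,166,41],[12,18,68,130]),([- 894,157,1049,1346,75],[34,36,258,260]),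
  ([- 752, - 1883,178,887, - 55],[10,20,66,132]),([1756,863, - 1450,835,3],[544,768]),
  ([145, - 679,1800, - 308, - 25],[44,50,324,386]),([- 223, - 1455,1753, - 872, - 15],[82,84,138,140]),
  ([- 338, - 1255, - 180, - 613, - 58],[26,28,194,196]),([538,533, - 121, - 442, - 151],[224,280]),
  ([284,1089,905, - 120,33],[40,48,320,384]),([- 618, - 834, - 624,1773,0],[514,516]),
  ([245,257,99,338, - 16],[96,160,264,272]),([- 608, - 433,1082,237,7],[100,162,268,274]),
  ([868,733,2614,0,0],[114,172,340,394]),([192, - 126,1401,36, - 17],[98,164,266,276]),
  ([1339,2817,0,0,0],[297,305,353,417]),([876,1299,1364,1003, - 38],[368,424]),([4843,0,0,0,0],[289])]"

definition V9 :: "(int list \<times> int list) list" where "V9 = [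
  ([- 296,147],[- 226,228,282, - 284]),([- 323,845],[- 8,16,64, - 128]),([2540,0],[- 80,136]),
  ([1105, - 709],[546, - 548, - 770,772]),([931, - 963],[41, - 49, - 321,385]),([- 646, - 61],[- 9,17,65, - 129]),
  ([- 1703,1763],[97, - 161, - 265,273]),([- 1414,1613],[- 296,304,352, - 416]),
  ([1269, - 1272],[- 112,168, - 336,392]),([- 648,203],[- 12,18,68, - 130]),([- 127,683],[- 34,36,258, - 260]),
  ([- 176, - 37],[- 10,20,66, - 132]),([- 96,579],[- 44,50,324, - 386]),([458, - 853],[- 82, - 84,138,140]),
  ([81, - 233],[26, - 28, - 194,196]),([- 1029,1325],[- 40,48,320, - 384]),([- 46,96],[- 96,160,264, - 272]),
  ([- 1145,678],[100, - 162, - 268,274]),([- 1528,1402],[114, - 172,340, - 394]),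
  ([516, - 289],[- 98,164,266, - 276]),([- 123,661],[- 297,305,353, - 417]),([- 1902,1564],[368, - 424])]"

definition V10 :: "(int list \<times> int list) list" where "V10 = [
  ([823, - 886,166,123,65],[- 32,256]),([2966,0,0,0,0],[- 226, - 228,282,284]),
  ([- 1167, - 604,411,420,61],[- 24,192]),([204,373, - 114,18,119],[- 8, - 16,64,128]),
  ([- 1004,2152,0,0,0],[33, - 257]),([- 1060,732, - 467, - 144, - 69],[546,548, - 770, - 772]),
  ([- 824,657, - 231, - 142, - 55],[41,49, - 321, - 385]),([98,474, - 822, - 256, - 90],[9,17, - 65, - 129]),
  ([2448, - 395,333, - 417,33],[- 97, - 161,265,273]),([590,200,287, - 8, - 19],[296,304, - 352, - 416]),
  ([- 1577,290, - 204,704,2],[112,168, - 336, - 392]),([896, - 150,1461,0,0],[12,18, - 68, - 130]),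
  ([1238, - 671,413,545,81],[- 34, - 36,258,260]),([- 107, - 769,620,216,78],[- 10, - 20,66,132]),
  ([- 311, - 345,497, - 1076, - 7],[- 544,768]),([381, - 730,747, - 490,62],[- 44, - 50,324,386]),
  ([314, - 914,379,626,81],[82, - 84, - 138,140]),([1120,1045, - 460, - 509, - 113],[26,28, - 194, - 196]),
  ([- 2204,339,993, - 373,261],[224, - 280]),([- 782,534, - 95,8, - 47],[40,48, - 320, - 384]),
  ([691, - 872,297,383,40],[- 96, - 160,264,272]),([- 2219,335, - 643,1145,0],[100,162, - 268, - 274]),
  ([- 376,280, - 347,286, - 31],[114,172, - 340, - 394]),([- 1524,1020, - 924, - 111, - 64],[98,164, - 266, - 276]),
  ([- 999, - 444,106,503,46],[- 297, - 305,353,417])]"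

definition V11 :: "(int list \<times> int list) list" where "V11 = [
  ([- 1255, - 539, - 408,943],[- 2,4]),([2491,0,0,0],[226, - 228,282, - 284]),
  ([- 165,934, - 212,5],[8, - 16,64, - 128]),([1467,894,113, - 196],[546, - 548,770, - 772]),
  ([781,401,138,630],[41, - 49,321, - 385]),([370, - 260, - 42, - 248],[- 9,17, - 65,129]),
  ([- 44, - 632,48, - 864],[- 97,161, - 265,273]),([- 928, - 472,1702,0],[- 296,304, - 352,416]),
  ([727,260,261,375],[- 112,168,336, - 392]),([858, - 541,1046, - 676],[- 12,18, - 68,130]),
  ([1631,526, - 596, - 324],[34, - 36,258, - 260]),([777,1857,0,0],[10, - 20,66, - 132]),
  ([- 215,847, - 286, - 288],[44, - 50,324, - 386]),([- 1185, - 436, - 495, - 331],[- 82,84, - 138,140]),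
  ([539,561,939,247],[26, - 28,194, - 196]),([- 605, - 846,1018, - 891],[- 40,48, - 320,384]),
  ([1287,154, - 173, - 816],[514, - 516]),([230,1417, - 174,425],[96, - 160,264, - 272]),
  ([- 1839,1077, - 568, - 884],[100, - 162,268, - 274]),([161,295,99, - 644],[114, - 172, - 340,394]),
  ([- 1629, - 1510, - 195, - 766],[- 98,164, - 266,276]),([994,384, - 237, - 330],[297, - 305,353, - 417])]"

section \<open>Weights of patterns and random tuples\<close>

definition V :: "nat \<Rightarrow> (int list \<times> int list) list" where
  "V b = [V0, V1, V2, V3, V4, V5, V6, V7, V8, V9, V10, V11] ! b"

fun dot :: "int list \<Rightarrow> int list \<Rightarrow> int" where
  "dot (x # xs) (y # ys) = x * y + dot xs ys"
| "dot [] ys = 0"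
| "dot (x # xs) [] = 0"

fun code :: "bool list \<Rightarrow> int" where
  "code [] = 0"
| "code (b # bs) = (if b then 2 * code bs + 1 else 2 * code bs)"

fun key_in :: "int \<Rightarrow> (int list \<times> int list) list \<Rightarrow> int \<Rightarrow> int" where
  "key_in i [] m = 0"
| "key_in i ((r, ms) # cs) m = (if m \<in> set ms then i else if - m \<in> set ms then - i else key_in (i + 1) cs m)"

text \<open>A vector is named by its position in the table, counted from 2 so that the names and their negatives
  never are 0, 1 or -1; the name 0 stands for the zero vector, which belongs to all flags that are
  absent from the table.\<close>

definition key :: "nat \<Rightarrow> bool list \<Rightarrow> int" where
  "key b l = key_in 2 (V b) (code l)"

definition row :: "nat \<Rightarrow> nat \<Rightarrow> int list" where
  "row b i = (if i < length (V b) then fst (V b ! i) else [])"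

definition vec :: "nat \<Rightarrow> int \<Rightarrow> int list" where
  "vec b k = (if k \<ge> 2 then row b (nat (k - 2)) else if k \<le> - 2 then map uminus (row b (nat (- k - 2))) else [])"

definition gram :: "nat \<Rightarrow> int \<Rightarrow> int \<Rightarrow> int" where
  "gram b k m = dot (vec b k) (vec b m)"

type_synonym pattern = "nat \<Rightarrow> nat \<Rightarrow> nat \<Rightarrow> bool"

definition relab :: "pattern \<Rightarrow> nat list \<Rightarrow> pattern" where
  "relab p xs = (\<lambda>i j k. p (xs ! i) (xs ! j) (xs ! k))"

text \<open>The ten triples of a five-element set in colexicographic order, and likewise the ten pairs that
  form the link of a further vertex. All encodings of patterns as lists follow this order.\<close>

definition root5 :: "pattern \<Rightarrow> bool list" where
  "root5 p = [p 0 1 2, p 0 1 3, p 0 2 3, p 1 2 3, p 0 1 4, p 0 2 4, p 1 2 4, p 0 3 4, p 1 3 4, p 2 3 4]"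

definition link5 :: "pattern \<Rightarrow> nat \<Rightarrow> bool list" where
  "link5 p y = [p 0 1 y, p 0 2 y, p 1 2 y, p 0 3 y, p 1 3 y, p 2 3 y, p 0 4 y, p 1 4 y, p 2 4 y, p 3 4 y]"

definition flag3 :: "pattern \<Rightarrow> nat \<Rightarrow> nat \<Rightarrow> bool list" where
  "flag3 p y z = [p 0 1 2, p 0 1 y, p 0 2 y, p 1 2 y, p 0 1 z, p 0 2 z, p 1 2 z, p 0 y z, p 1 y z, p 2 y z]"

text \<open>The codes of the hypergraphs on five labelled vertices that serve as types. A code repeats when
  its flags are split into several blocks according to the characters of its automorphism group.\<close>

definition types5 :: "(int \<times> nat) list" where
  "types5 = [(12, 1), (12, 2), (20, 3), (195, 4), (195, 5), (208, 6), (208, 7), (385, 8), (385, 9), (385, 10), (385, 11)]"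

definition form5 :: "bool list \<Rightarrow> bool list \<Rightarrow> bool list \<Rightarrow> int" where
  "form5 r l m = (\<Sum>(c, b)\<leftarrow>types5. if code r = c then gram b (key b l) (key b m) else 0)"

definition form3 :: "bool list \<Rightarrow> bool list \<Rightarrow> int" where
  "form3 l m = gram 0 (key 0 l) (key 0 m)"

text \<open>The number 3645000 clears the denominators of the certificate; the factor 24 keeps the entries of
  the vectors of the types with five labelled vertices small.\<close>

definition weight :: "pattern \<Rightarrow> int" where
  "weight p = 24 * form5 (root5 p) (link5 p 5) (link5 p 6)
     + (3645000 * of_bool (p 0 1 2) + form3 (flag3 p 3 4) (flag3 p 5 6))"

lemma dot_Nil2 [simp]: "dot u [] = 0"
  by (cases u) simp_all

lemma dot_commute: "dot u v = dot v u"
  by (induction u v rule: dot.induct) (simp_all add: mult.commute)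

lemma gram_commute: "gram b k m = gram b m k"
  by (simp add: gram_def dot_commute)

text \<open>A Gram matrix is positive semidefinite: the double sum is a sum of squares, one for each
  coordinate.\<close>

lemma sum_dot_nonneg:
  assumes "\<And>y. y \<in> Y \<Longrightarrow> length (f y) \<le> n"
  shows "0 \<le> (\<Sum>y\<in>Y. \<Sum>z\<in>Y. dot (f y) (f z))"
  using assms
proof (induction n arbitrary: f)
  case 0
  then have "(\<Sum>y\<in>Y. \<Sum>z\<in>Y. dot (f y) (f z)) = 0"
    by (intro sum.neutral ballI) simp
  then show ?case by simp
next
  case (Suc n)
  define h where "h u = (case u of [] \<Rightarrow> 0 | x # _ \<Rightarrow> x)" for u :: "int list"
  have step: "dot u v = h u * h v + dot (tl u) (tl v)" for u v
    by (cases u; cases v) (simp_all add: h_def)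
  have "(\<Sum>y\<in>Y. \<Sum>z\<in>Y. dot (f y) (f z))
      = (\<Sum>y\<in>Y. h (f y)) * (\<Sum>z\<in>Y. h (f z)) + (\<Sum>y\<in>Y. \<Sum>z\<in>Y. dot (tl (f y)) (tl (f z)))"
    by (subst step) (simp add: sum.distrib sum_product)
  moreover have "0 \<le> (\<Sum>y\<in>Y. \<Sum>z\<in>Y. dot (tl (f y)) (tl (f z)))"
    using Suc.prems by (intro Suc.IH) fastforce
  ultimately show ?case by simp
qed

definition tuples :: "nat \<Rightarrow> 'a set \<Rightarrow> 'a list set" where
  "tuples n A = {x. set x \<subseteq> A \<and> length x = n}"

lemma finite_tuples: "finite A \<Longrightarrow> finite (tuples n A)"
  by (simp add: tuples_def finite_lists_length_eq)

lemma card_tuples: "finite A \<Longrightarrow> card (tuples n A) = card A ^ n"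
  by (simp add: tuples_def card_lists_length_eq)

lemma sum_tuples_append:
  "(\<Sum>x\<in>tuples (m + n) A. f x) = (\<Sum>x\<in>tuples m A. \<Sum>y\<in>tuples n A. f (x @ y))"
proof -
  have "(\<Sum>x\<in>tuples m A. \<Sum>y\<in>tuples n A. f (x @ y)) = (\<Sum>(x, y)\<in>tuples m A \<times> tuples n A. f (x @ y))"
    by (simp add: sum.cartesian_product)
  also have "\<dots> = (\<Sum>x\<in>tuples (m + n) A. f x)"
    by (rule sum.reindex_bij_witness[where i = "\<lambda>x. (take m x, drop m x)" and j = "\<lambda>(x, y). x @ y"])
      (auto simp: tuples_def dest: in_set_takeD in_set_dropD)
  finally show ?thesis by simp
qed

lemma sum_tuples_square:
  assumes "\<And>x y z. x \<in> tuples k A \<Longrightarrow> y \<in> tuples m A \<Longrightarrow> z \<in> tuples m A \<Longrightarrow>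
             f (x @ y @ z) = (if P x then dot (u x y) (u x z) else 0)"
    and len: "\<And>x y. length (u x y) \<le> n"
  shows "0 \<le> (\<Sum>x\<in>tuples (k + (m + m)) A. f x)"
proof -
  have "(\<Sum>x\<in>tuples (k + (m + m)) A. f x)
      = (\<Sum>x\<in>tuples k A. \<Sum>y\<in>tuples m A. \<Sum>z\<in>tuples m A. if P x then dot (u x y) (u x z) else 0)"
    unfolding sum_tuples_append by (intro sum.cong refl assms(1))
  also have "\<dots> = (\<Sum>x\<in>tuples k A. if P x then \<Sum>y\<in>tuples m A. \<Sum>z\<in>tuples m A. dot (u x y) (u x z) else 0)"
    by (intro sum.cong) auto
  also have "\<dots> \<ge> 0"
    by (intro sum_nonneg) (simp add: sum_dot_nonneg[where n = n] len)
  finally show ?thesis .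
qed

lemma length_vec_le: "\<exists>n. \<forall>k. length (vec b k) \<le> n"
proof -
  have "length (row b i) \<le> (\<Sum>r\<leftarrow>V b. length (fst r))" for i
    using member_le_sum_list[of "length (fst (V b ! i))" "map (\<lambda>r. length (fst r)) (V b)"]
    by (auto simp: row_def)
  then show ?thesis by (intro exI[of _ "\<Sum>r\<leftarrow>V b. length (fst r)"]) (simp add: vec_def)
qed

definition perms7 :: "nat list set" where
  "perms7 = {xs. distinct xs \<and> set xs = {..<7}}"

lemma perms7_length:
  assumes "xs \<in> perms7"
  shows "length xs = 7"
proof -
  have "distinct xs" "card (set xs) = 7" using assms by (simp_all add: perms7_def)
  then show ?thesis by (simp add: distinct_card)
qed

lemma perms7_nth_less:
  assumes "xs \<in> perms7" "i < 7"
  shows "xs ! i < 7"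
proof -
  have "xs ! i \<in> set xs" using assms(2) perms7_length[OF assms(1)] by simp
  then show ?thesis using assms(1) by (simp add: perms7_def)
qed

lemma orderings_eq:
  assumes "finite A" "card A = n"
  shows "{x. distinct x \<and> set x = A} = {x. length x = n \<and> distinct x \<and> set x \<subseteq> A}"
proof (intro subset_antisym subsetI CollectI; elim CollectE conjE)
  fix x assume "distinct x" "set x = A"
  then show "length x = n \<and> distinct x \<and> set x \<subseteq> A" using assms(2) distinct_card[of x] by simp
next
  fix x assume "length x = n" "distinct x" "set x \<subseteq> A"
  then show "distinct x \<and> set x = A"
    using card_subset_eq[OF assms(1), of "set x"] assms(2) distinct_card[of x] by simp
qed

lemma card_orderings:
  assumes "finite A"
  shows "card {x. distinct x \<and> set x = A} = fact (card A)"
  unfolding orderings_eq[OF assms refl]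
  using card_lists_distinct_length_eq[OF assms order_refl] by (simp add: fact_prod)

lemma perms7_eq: "perms7 = {xs. length xs = 7 \<and> distinct xs \<and> set xs \<subseteq> {..<7}}"
  unfolding perms7_def by (rule orderings_eq) simp_all

lemma card_perms7: "card perms7 = 5040"
  unfolding perms7_def by (subst card_orderings) (simp_all add: fact_numeral)

lemma finite_perms7: "finite perms7"
  using card_perms7 card.infinite by fastforce

lemma perms7_inj: "xs \<in> perms7 \<Longrightarrow> inj_on ((!) xs) {..<7}"
  by (simp add: inj_on_nth perms7_length perms7_def)

lemma perms7_comp:
  assumes xs: "xs \<in> perms7" and ys: "ys \<in> perms7"
  shows "map ((!) xs) ys \<in> perms7"
proof -
  have "set (map ((!) xs) ys) \<subseteq> {..<7}"
    using ys perms7_nth_less[OF xs] by (auto simp: perms7_def)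
  moreover have "distinct (map ((!) xs) ys)"
    using ys perms7_inj[OF xs] by (simp add: perms7_def distinct_map)
  ultimately show ?thesis using perms7_length[OF ys] by (simp add: perms7_eq)
qed

lemma relab_relab:
  "ys \<in> perms7 \<Longrightarrow> i < 7 \<Longrightarrow> j < 7 \<Longrightarrow> k < 7 \<Longrightarrow> relab (relab p xs) ys i j k = relab p (map ((!) xs) ys) i j k"
  by (simp add: relab_def perms7_length)

lemma sum_tuples_perm:
  assumes "finite A" "xs \<in> perms7"
  shows "(\<Sum>x\<in>tuples 7 A. f (map ((!) x) xs)) = (\<Sum>x\<in>tuples 7 A. f x)"
proof -
  let ?h = "\<lambda>x. map ((!) x) xs"
  have sub: "?h ` tuples 7 A \<subseteq> tuples 7 A"
    using assms(2) perms7_length[OF assms(2)] by (force simp: tuples_def perms7_def)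
  moreover have inj: "inj_on ?h (tuples 7 A)"
    using assms(2) by (auto simp: inj_on_def tuples_def perms7_def intro!: nth_equalityI)
  ultimately have "?h ` tuples 7 A = tuples 7 A"
    using endo_inj_surj[OF finite_tuples[OF assms(1)]] by blast
  then show ?thesis using sum.reindex[OF inj, of f] by simp
qed

lemma weight_cong:
  assumes "\<And>i j k. i < 7 \<Longrightarrow> j < 7 \<Longrightarrow> k < 7 \<Longrightarrow> p i j k = q i j k"
  shows "weight p = weight q"
  by (simp add: weight_def root5_def link5_def flag3_def assms)

text \<open>The weight of a random tuple has the same mean as the weight of any rearrangement of the tuple.
  Only the average over all rearrangements is bounded pointwise.\<close>

definition symmetrised :: "pattern \<Rightarrow> int" where
  "symmetrised p = (\<Sum>xs\<in>perms7. weight (relab p xs))"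

lemma symmetrised_relab:
  assumes "xs \<in> perms7"
  shows "symmetrised (relab p xs) = symmetrised p"
proof -
  let ?h = "map ((!) xs)"
  have inj: "inj_on ?h perms7"
  proof (rule inj_onI)
    fix ys zs assume "ys \<in> perms7" "zs \<in> perms7" "?h ys = ?h zs"
    then show "ys = zs"
      using perms7_inj[OF assms] by (simp add: perms7_def inj_on_map_eq_map)
  qed
  have "?h ` perms7 = perms7"
    using endo_inj_surj[OF finite_perms7 _ inj] perms7_comp[OF assms] by blast
  then have "symmetrised p = (\<Sum>ys\<in>perms7. weight (relab p (?h ys)))"
    using sum.reindex[OF inj, of "\<lambda>ys. weight (relab p ys)"] by (simp add: symmetrised_def)
  also have "\<dots> = symmetrised (relab p xs)"
    unfolding symmetrised_def by (intro sum.cong refl weight_cong) (simp add: relab_relab)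
  finally show ?thesis by simp
qed

definition pattern_of :: "'a set set \<Rightarrow> 'a list \<Rightarrow> pattern" where
  "pattern_of E x = (\<lambda>i j k. {x ! i, x ! j, x ! k} \<in> E)"

lemma sum_form3_nonneg:
  "0 \<le> (\<Sum>x\<in>tuples 7 A. form3 (flag3 (pattern_of E x) 3 4) (flag3 (pattern_of E x) 5 6))"
proof -
  obtain n where n: "\<And>k. length (vec 0 k) \<le> n" using length_vec_le by blast
  let ?u = "\<lambda>x y. vec 0 (key 0 (flag3 (pattern_of E (x @ y)) 3 4))"
  have "0 \<le> (\<Sum>x\<in>tuples (3 + (2 + 2)) A. form3 (flag3 (pattern_of E x) 3 4) (flag3 (pattern_of E x) 5 6))"
  proof (rule sum_tuples_square[where P = "\<lambda>_. True" and u = ?u and n = n])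
    fix x y z assume "x \<in> tuples 3 A" "y \<in> tuples 2 A" "z \<in> tuples 2 A"
    then obtain a b c d e f g where "x = [a, b, c]" "y = [d, e]" "z = [f, g]"
      by (auto simp: tuples_def length_Suc_conv eval_nat_numeral)
    then show "form3 (flag3 (pattern_of E (x @ y @ z)) 3 4) (flag3 (pattern_of E (x @ y @ z)) 5 6)
        = (if True then dot (?u x y) (?u x z) else 0)"
      by (simp add: form3_def gram_def flag3_def pattern_of_def)
  qed (rule n)
  then show ?thesis by simp
qed

lemma sum_form5_nonneg:
  "0 \<le> (\<Sum>x\<in>tuples 7 A. form5 (root5 (pattern_of E x)) (link5 (pattern_of E x) 5) (link5 (pattern_of E x) 6))"
proof -
  have one: "0 \<le> (\<Sum>x\<in>tuples (5 + (1 + 1)) A. if code (root5 (pattern_of E x)) = c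
      then gram b (key b (link5 (pattern_of E x) 5)) (key b (link5 (pattern_of E x) 6)) else 0)" for b c
  proof -
    obtain n where n: "\<And>k. length (vec b k) \<le> n" using length_vec_le by blast
    let ?u = "\<lambda>x y. vec b (key b (link5 (pattern_of E (x @ y)) 5))"
    show ?thesis
    proof (rule sum_tuples_square[where P = "\<lambda>x. code (root5 (pattern_of E x)) = c" and u = ?u and n = n])
      fix x y z assume "x \<in> tuples 5 A" "y \<in> tuples 1 A" "z \<in> tuples 1 A"
      then obtain x0 x1 x2 x3 x4 y0 z0 where "x = [x0, x1, x2, x3, x4]" "y = [y0]" "z = [z0]"
        by (auto simp: tuples_def length_Suc_conv eval_nat_numeral)
      then show "(if code (root5 (pattern_of E (x @ y @ z))) = c
          then gram b (key b (link5 (pattern_of E (x @ y @ z)) 5)) (key b (link5 (pattern_of E (x @ y @ z)) 6)) else 0)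
        = (if code (root5 (pattern_of E x)) = c then dot (?u x y) (?u x z) else 0)"
        by (simp add: gram_def link5_def root5_def pattern_of_def)
    qed (rule n)
  qed
  have "(\<Sum>x\<in>tuples 7 A. \<Sum>(c, b)\<leftarrow>ts. if code (root5 (pattern_of E x)) = c
      then gram b (key b (link5 (pattern_of E x) 5)) (key b (link5 (pattern_of E x) 6)) else 0) \<ge> 0" for ts
    using one by (induction ts) (auto simp: sum.distrib case_prod_beta)
  then show ?thesis by (simp add: form5_def)
qed

lemma sum_edge_indicator:
  assumes "finite A" "\<And>e. e \<in> E \<Longrightarrow> e \<subseteq> A \<and> card e = 3"
  shows "(\<Sum>x\<in>tuples 7 A. of_bool (pattern_of E x 0 1 2)) = (6 * card E * card A ^ 4 :: int)"
proof -
  have six: "card {x. distinct x \<and> set x = e} = 6" if "e \<in> E" for e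
  proof -
    have "card e = 3" using assms(2) that by blast
    moreover from this have "finite e" by (intro card_ge_0_finite) simp
    ultimately show ?thesis by (simp add: card_orderings fact_numeral)
  qed
  have "(\<Sum>x\<in>tuples (3 + 4) A. of_bool (pattern_of E x 0 1 2) :: int)
      = (\<Sum>x\<in>tuples 3 A. \<Sum>y\<in>tuples 4 A. of_bool (set x \<in> E))"
    unfolding sum_tuples_append
  proof (intro sum.cong refl)
    fix x y assume "x \<in> tuples 3 A"
    then obtain a b c where "x = [a, b, c]"
      by (auto simp: tuples_def length_Suc_conv eval_nat_numeral)
    then show "of_bool (pattern_of E (x @ y) 0 1 2) = (of_bool (set x \<in> E) :: int)"
      by (simp add: pattern_of_def)
  qed
  also have "\<dots> = int (card A) ^ 4 * (\<Sum>x\<in>tuples 3 A. of_bool (set x \<in> E))"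
    by (simp add: card_tuples[OF assms(1)] sum_distrib_left)
  also have "(\<Sum>x\<in>tuples 3 A. of_bool (set x \<in> E) :: int) = int (card (tuples 3 A \<inter> {x. set x \<in> E}))"
    by (rule sum_of_bool_eq; rule finite_tuples[OF assms(1)])
  also have "tuples 3 A \<inter> {x. set x \<in> E} = (\<Union>e\<in>E. {x. distinct x \<and> set x = e})"
  proof (intro subset_antisym subsetI)
    fix x assume "x \<in> tuples 3 A \<inter> {x. set x \<in> E}"
    then show "x \<in> (\<Union>e\<in>E. {x. distinct x \<and> set x = e})"
      using assms(2)[of "set x"] card_distinct[of x] by (simp add: tuples_def)
  next
    fix x assume "x \<in> (\<Union>e\<in>E. {x. distinct x \<and> set x = e})"
    then have "set x \<in> E" "distinct x" by blast+
    then show "x \<in> tuples 3 A \<inter> {x. set x \<in> E}"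
      using assms(2)[of "set x"] distinct_card[of x] by (simp add: tuples_def)
  qed
  also have "card \<dots> = (\<Sum>e\<in>E. card {x. distinct x \<and> set x = e})"
  proof (rule card_UN_disjoint)
    show "finite E" using assms by (intro finite_subset[of E "Pow A"]) auto
    show "\<forall>e\<in>E. finite {x. distinct x \<and> set x = e}"
    proof
      fix e assume "e \<in> E"
      then show "finite {x. distinct x \<and> set x = e}" using six by (intro card_ge_0_finite) simp
    qed
  qed auto
  also have "\<dots> = 6 * card E" using six by simp
  finally show ?thesis by simp
qed

text \<open>The two forms contribute nonnegatively: given the labelled vertices, the remaining ones split into
  two independent halves, so that the sum of a form is a sum of squares. What is left is the number of
  edges, each of which is hit by six ordered triples.\<close>

lemma sum_symmetrised_ge:
  assumes "finite A" "\<And>e. e \<in> E \<Longrightarrow> e \<subseteq> A \<and> card e = 3"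
  shows "5040 * (3645000 * (6 * card E * card A ^ 4)) \<le> (\<Sum>x\<in>tuples 7 A. symmetrised (pattern_of E x))"
proof -
  let ?W = "\<Sum>x\<in>tuples 7 A. weight (pattern_of E x)"
  have "(\<Sum>x\<in>tuples 7 A. symmetrised (pattern_of E x)) = (\<Sum>xs\<in>perms7. \<Sum>x\<in>tuples 7 A. weight (relab (pattern_of E x) xs))"
    unfolding symmetrised_def by (rule sum.swap)
  also have "\<dots> = (\<Sum>xs\<in>perms7. ?W)"
  proof (rule sum.cong[OF refl])
    fix xs assume xs: "xs \<in> perms7"
    have "weight (relab (pattern_of E x) xs) = weight (pattern_of E (map ((!) x) xs))" for x
      by (rule weight_cong) (simp add: relab_def pattern_of_def perms7_length[OF xs])
    then show "(\<Sum>x\<in>tuples 7 A. weight (relab (pattern_of E x) xs)) = ?W"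
      using sum_tuples_perm[OF assms(1) xs, of "\<lambda>x. weight (pattern_of E x)"] by simp
  qed
  also have "\<dots> = 5040 * ?W" by (simp add: card_perms7)
  also have "?W = 24 * (\<Sum>x\<in>tuples 7 A. form5 (root5 (pattern_of E x)) (link5 (pattern_of E x) 5) (link5 (pattern_of E x) 6))
      + (3645000 * (\<Sum>x\<in>tuples 7 A. of_bool (pattern_of E x 0 1 2))
      + (\<Sum>x\<in>tuples 7 A. form3 (flag3 (pattern_of E x) 3 4) (flag3 (pattern_of E x) 5 6)))"
    by (simp add: weight_def sum.distrib sum_distrib_left)
  finally show ?thesis
    using sum_form5_nonneg[where A = A and E = E] sum_form3_nonneg[where A = A and E = E]
      sum_edge_indicator[OF assms] by simp
qed

section \<open>Averages along cosets\<close>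

definition orders5 :: "nat list list" where
  "orders5 = [[a, b, c, d, e]. a \<leftarrow> [0..<5], b \<leftarrow> [0..<5], b \<noteq> a, c \<leftarrow> [0..<5], c \<noteq> a, c \<noteq> b,
     d \<leftarrow> [0..<5], d \<noteq> a, d \<noteq> b, d \<noteq> c, e \<leftarrow> [0..<5], e \<noteq> a, e \<noteq> b, e \<noteq> c, e \<noteq> d]"

text \<open>The sum over the symmetric group splits along cosets: a representative fixes which vertices are
  labelled, a turn permutes the labels. For five labels there are 21 times 240 and for three labels,
  with two unordered pairs of further vertices, 105 times 48 permutations.\<close>

definition splits5 :: "nat list list" where
  "splits5 = concat (map (\<lambda>z. map (\<lambda>y. filter (\<lambda>i. i \<noteq> y \<and> i \<noteq> z) [0..<7] @ [y, z]) [0..<z]) [0..<7])"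

definition turns5 :: "nat list list" where
  "turns5 = concat (map (\<lambda>s. [s @ [5, 6], s @ [6, 5]]) orders5)"

definition triples :: "(nat \<times> nat \<times> nat) list" where
  "triples = concat (map (\<lambda>k. concat (map (\<lambda>j. map (\<lambda>i. (i, j, k)) [0..<j]) [1..<k])) [2..<7])"

fun pairings :: "nat list \<Rightarrow> nat list list" where
  "pairings [a, b, c, d] = [[a, b, c, d], [a, c, b, d], [a, d, b, c]]"
| "pairings _ = []"

definition splits3 :: "nat list list" where
  "splits3 = concat (map (\<lambda>(i, j, k). map ((@) [i, j, k])
     (pairings (filter (\<lambda>x. x \<noteq> i \<and> x \<noteq> j \<and> x \<noteq> k) [0..<7]))) triples)"

definition turns3 :: "nat list list" where
  "turns3 = concat (map (\<lambda>s. map ((@) s) [[3, 4, 5, 6], [4, 3, 5, 6], [3, 4, 6, 5], [4, 3, 6, 5],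
     [5, 6, 3, 4], [6, 5, 3, 4], [5, 6, 4, 3], [6, 5, 4, 3]]) [[0, 1, 2], [0, 2, 1], [1, 0, 2], [1, 2, 0], [2, 0, 1], [2, 1, 0]])"

definition perm_test :: "nat list \<Rightarrow> bool" where
  "perm_test xs \<longleftrightarrow> length xs = 7 \<and> distinct xs \<and> list_all (\<lambda>i. i < 7) xs"

lemma perm_test: "list_all perm_test xss \<Longrightarrow> set xss \<subseteq> perms7"
  by (auto simp: list_all_iff perm_test_def perms7_eq)

text \<open>The products of representatives and turns are pairwise different because an invariant of the turns
  recovers the representative; there are as many products as permutations.\<close>

lemma coset_sum:
  assumes S: "set S \<subseteq> perms7" and T: "set T \<subseteq> perms7" and dist: "distinct S" "distinct T"
    and len: "length S * length T = 5040"
    and inv: "\<And>r t. r \<in> set S \<Longrightarrow> t \<in> set T \<Longrightarrow> I (map ((!) r) t) = I r"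
    and inj: "inj_on I (set S)"
  shows "(\<Sum>xs\<in>perms7. f xs) = (\<Sum>r\<leftarrow>S. \<Sum>t\<leftarrow>T. (f (map ((!) r) t) :: int))"
proof -
  let ?h = "\<lambda>(r, t). map ((!) r) t"
  have hinj: "inj_on ?h (set S \<times> set T)"
  proof (rule inj_onI, clarify)
    fix r t r' t' assume a: "r \<in> set S" "t \<in> set T" "r' \<in> set S" "t' \<in> set T"
      and eq: "map ((!) r) t = map ((!) r') t'"
    have "I r = I r'" using inv[OF a(1,2)] inv[OF a(3,4)] eq by simp
    then have r: "r = r'" by (rule inj_onD[OF inj _ a(1,3)])
    have "t \<in> perms7" "t' \<in> perms7" using a T by blast+
    then have st: "set t = {..<7}" "set t' = {..<7}" by (simp_all add: perms7_def)
    have "r \<in> perms7" using a(1) S by blast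
    then have "inj_on ((!) r) (set t \<union> set t')" unfolding st Un_absorb by (rule perms7_inj)
    moreover have "map ((!) r) t = map ((!) r) t'" using eq unfolding r .
    ultimately have "t = t'" by (simp only: inj_on_map_eq_map)
    with r show "r = r' \<and> t = t'" by simp
  qed
  have "card (?h ` (set S \<times> set T)) = 5040"
    using card_image[OF hinj] len dist by (simp add: card_cartesian_product distinct_card)
  moreover have "?h ` (set S \<times> set T) \<subseteq> perms7"
    using subsetD[OF S] subsetD[OF T] by (auto intro: perms7_comp)
  ultimately have "?h ` (set S \<times> set T) = perms7"
    using card_subset_eq[OF finite_perms7] card_perms7 by simp
  then have "(\<Sum>xs\<in>perms7. f xs) = (\<Sum>z\<in>set S \<times> set T. f (?h z))"
    using sum.reindex[OF hinj, of f] by simp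
  also have "\<dots> = (\<Sum>r\<in>set S. \<Sum>t\<in>set T. f (map ((!) r) t))"
    by (simp add: sum.cartesian_product case_prod_beta)
  finally show ?thesis
    using dist by (simp add: sum_list_distinct_conv_sum_set)
qed

lemma splits_turns_perms:
  "set splits5 \<subseteq> perms7" "set turns5 \<subseteq> perms7" "set splits3 \<subseteq> perms7" "set turns3 \<subseteq> perms7"
proof -
  have "list_all perm_test splits5" by code_simp
  then show "set splits5 \<subseteq> perms7" by (rule perm_test)
  have "list_all perm_test turns5" by code_simp
  then show "set turns5 \<subseteq> perms7" by (rule perm_test)
  have "list_all perm_test splits3" by code_simp
  then show "set splits3 \<subseteq> perms7" by (rule perm_test)
  have "list_all perm_test turns3" by code_simp
  then show "set turns3 \<subseteq> perms7" by (rule perm_test)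
qed

fun increasing :: "int list \<Rightarrow> bool" where
  "increasing (x # y # zs) \<longleftrightarrow> x < y \<and> increasing (y # zs)"
| "increasing _ \<longleftrightarrow> True"

lemma increasing_distinct: "increasing xs \<Longrightarrow> distinct xs"
proof -
  have "sorted_wrt (<) xs" if "increasing xs"
    using that by (induction xs rule: increasing.induct) auto
  then show "increasing xs \<Longrightarrow> distinct xs" by (simp add: strict_sorted_iff)
qed

lemma splits_turns_distinct:
  "distinct splits5" "distinct turns5" "distinct splits3" "distinct turns3"
proof -
  show "distinct splits5" by code_simp
  have "increasing (map (foldl (\<lambda>n x. 7 * n + int x) 0) turns5)" by code_simp
  from increasing_distinct[OF this] show "distinct turns5" by (simp add: distinct_map)
  show "distinct splits3" by code_simp
  show "distinct turns3" by code_simp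
qed

lemma splits_turns_length:
  "length splits5 = 21" "length turns5 = 240" "length splits3 = 105" "length turns3 = 48"
  by code_simp+

lemma image_nth_take:
  assumes "r \<in> perms7" "n \<le> 7"
  shows "(!) r ` set [0..<n] = set (take n r)"
proof -
  have "map ((!) r) [0..<n] = take n r"
    using assms perms7_length[OF assms(1)] by (intro nth_equalityI) auto
  then show ?thesis by (metis list.set_map)
qed

lemma sum_perms7_splits5: "(\<Sum>xs\<in>perms7. f xs) = (\<Sum>r\<leftarrow>splits5. \<Sum>t\<leftarrow>turns5. (f (map ((!) r) t) :: int))"
proof (rule coset_sum[where I = "\<lambda>xs. set (take 5 xs)"])
  have *: "list_all (\<lambda>t. set (take 5 t) = set [0..<5]) turns5" by code_simp
  show "set (take 5 (map ((!) r) t)) = set (take 5 r)" if "r \<in> set splits5" "t \<in> set turns5" for r t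
  proof -
    have "set (take 5 t) = set [0..<5]" using * that(2) by (simp add: list_all_iff)
    then show ?thesis
      using image_nth_take[of r 5] that(1) splits_turns_perms(1) by (auto simp add: take_map)
  qed
  have "list_all (\<lambda>r. list_all (\<lambda>r'. if set (take 5 r) = set (take 5 r') then r = r' else True) splits5) splits5"
    by code_simp
  then show "inj_on (\<lambda>xs. set (take 5 xs)) (set splits5)"
    by (auto simp: list_all_iff inj_on_def split: if_splits)
qed (simp_all add: splits_turns_perms splits_turns_distinct splits_turns_length)

text \<open>A numerical name for the labelled set together with the unordered pair of unordered pairs. The three
  ways to pair four distinct powers of two give different products.\<close>

definition shape3 :: "nat list \<Rightarrow> int" where
  "shape3 xs = 2 ^ (xs ! 0) + 2 ^ (xs ! 1) + 2 ^ (xs ! 2)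
     + 128 * ((2 ^ (xs ! 3) + 2 ^ (xs ! 4)) * (2 ^ (xs ! 5) + 2 ^ (xs ! 6)))"

lemma shape3_distinct: "distinct (map shape3 splits3)"
  by code_simp

lemma sum_perms7_splits3: "(\<Sum>xs\<in>perms7. f xs) = (\<Sum>r\<leftarrow>splits3. \<Sum>t\<leftarrow>turns3. (f (map ((!) r) t) :: int))"
proof (rule coset_sum[where I = shape3])
  have *: "\<forall>t\<in>set turns3. shape3 (map ((!) r) t) = shape3 r" for r
    by (simp add: turns3_def shape3_def ac_simps)
  show "shape3 (map ((!) r) t) = shape3 r" if "r \<in> set splits3" "t \<in> set turns3" for r t
    using bspec[OF * that(2)] .
  show "inj_on shape3 (set splits3)"
    using shape3_distinct by (simp add: distinct_map)
qed (simp_all add: splits_turns_perms splits_turns_distinct splits_turns_length)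

definition symmetric :: "pattern \<Rightarrow> bool" where
  "symmetric p \<longleftrightarrow> (\<forall>i j k. p i j k = p j i k \<and> p i j k = p i k j)"

lemma symmetric_relab: "symmetric p \<Longrightarrow> symmetric (relab p xs)"
  by (simp add: symmetric_def relab_def)

definition pos2 :: "nat \<Rightarrow> nat \<Rightarrow> nat" where
  "pos2 i j = min i j + max i j * (max i j - 1) div 2"

definition pos3 :: "nat \<Rightarrow> nat \<Rightarrow> nat \<Rightarrow> nat" where
  "pos3 i j k = (let a = min i (min j k); c = max i (max j k); b = i + j + k - a - c
     in a + b * (b - 1) div 2 + c * (c - 1) * (c - 2) div 6)"

text \<open>A turn of the labels only rearranges the lists of triples and pairs.\<close>

definition turn_root :: "nat list \<Rightarrow> bool list \<Rightarrow> bool list" where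
  "turn_root s r = map (\<lambda>(i, j, k). r ! pos3 (s ! i) (s ! j) (s ! k))
     [(0,1,2), (0,1,3), (0,2,3), (1,2,3), (0,1,4), (0,2,4), (1,2,4), (0,3,4), (1,3,4), (2,3,4)]"

definition turn_link :: "nat list \<Rightarrow> bool list \<Rightarrow> bool list" where
  "turn_link s l = map (\<lambda>(i, j). l ! pos2 (s ! i) (s ! j))
     [(0,1), (0,2), (1,2), (0,3), (1,3), (2,3), (0,4), (1,4), (2,4), (3,4)]"

lemma less_5_cases: "i < (5::nat) \<Longrightarrow> i = 0 \<or> i = 1 \<or> i = 2 \<or> i = 3 \<or> i = 4"
  by auto

lemma root5_pos3:
  assumes "symmetric q" "i < 5" "j < 5" "k < 5" "i \<noteq> j" "i \<noteq> k" "j \<noteq> k"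
  shows "root5 q ! pos3 i j k = q i j k"
proof -
  have s: "q i j k = q j i k" "q i j k = q i k j" for i j k
    using assms(1) unfolding symmetric_def by blast+
  show ?thesis
    using less_5_cases[OF assms(2)] less_5_cases[OF assms(3)] less_5_cases[OF assms(4)] assms(5-7)
    by (elim disjE) (simp_all add: root5_def pos3_def Let_def s)
qed

lemma link5_pos2:
  assumes "symmetric q" "i < 5" "j < 5" "i \<noteq> j"
  shows "link5 q y ! pos2 i j = q i j y"
proof -
  have s: "q i j y = q j i y" for i j
    using assms(1) unfolding symmetric_def by blast
  show ?thesis
    using less_5_cases[OF assms(2)] less_5_cases[OF assms(3)] assms(4)
    by (elim disjE) (simp_all add: link5_def pos2_def s)
qed

definition total5 :: "bool list \<Rightarrow> bool list \<Rightarrow> bool list \<Rightarrow> int" where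
  "total5 r l m = (\<Sum>s\<leftarrow>orders5. form5 (turn_root s r) (turn_link s l) (turn_link s m))"

lemma form5_commute: "form5 r l m = form5 r m l"
  unfolding form5_def
  by (intro arg_cong[where f = sum_list] map_cong refl) (auto simp: gram_commute)

lemma sum_turns5:
  assumes "symmetric q"
  shows "(\<Sum>t\<leftarrow>turns5. form5 (root5 (relab q t)) (link5 (relab q t) 5) (link5 (relab q t) 6))
    = 2 * total5 (root5 q) (link5 q 5) (link5 q 6)"
proof -
  have ok: "list_all (\<lambda>s. length s = 5 \<and> distinct s \<and> list_all (\<lambda>i. i < 5) s) orders5"
    by code_simp
  have eq: "root5 (relab q (s @ [y, z])) = turn_root s (root5 q)"
      "link5 (relab q (s @ [y, z])) 5 = turn_link s (link5 q y)"
      "link5 (relab q (s @ [y, z])) 6 = turn_link s (link5 q z)"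
    if "s \<in> set orders5" for s y z
  proof -
    have "length s = 5 \<and> distinct s \<and> list_all (\<lambda>i. i < 5) s"
      using ok that unfolding list_all_iff by blast
    then obtain a b c d e where s: "s = [a, b, c, d, e]" "distinct [a, b, c, d, e]"
        "a < 5" "b < 5" "c < 5" "d < 5" "e < 5"
      by (auto simp: length_Suc_conv eval_nat_numeral)
    then show "root5 (relab q (s @ [y, z])) = turn_root s (root5 q)"
      "link5 (relab q (s @ [y, z])) 5 = turn_link s (link5 q y)"
      "link5 (relab q (s @ [y, z])) 6 = turn_link s (link5 q z)"
      by (simp_all add: turn_root_def turn_link_def root5_pos3[OF assms] link5_pos2[OF assms])
        (simp_all add: root5_def link5_def relab_def)
  qed
  have conc: "sum_list (map F (concat (map (\<lambda>s. [A s, B s]) xs))) = (\<Sum>s\<leftarrow>xs. F (A s) + F (B s))"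
    for F :: "nat list \<Rightarrow> int" and A B and xs :: "nat list list"
    by (induction xs) simp_all
  have "(\<Sum>t\<leftarrow>turns5. form5 (root5 (relab q t)) (link5 (relab q t) 5) (link5 (relab q t) 6))
    = (\<Sum>s\<leftarrow>orders5. 2 * form5 (turn_root s (root5 q)) (turn_link s (link5 q 5)) (turn_link s (link5 q 6)))"
    unfolding turns5_def conc
    by (intro arg_cong[where f = sum_list] map_cong refl)
      (simp only: eq, simp add: form5_commute[of _ "turn_link _ (link5 q 6)"])
  then show ?thesis by (simp add: total5_def sum_list_const_mult)
qed

text \<open>The classes of the flags on three labelled vertices do not depend on the order of these
  vertices, nor on the order of the other two.\<close>

fun bitlist :: "nat \<Rightarrow> int \<Rightarrow> bool list" where
  "bitlist 0 m = []"
| "bitlist (Suc n) m = odd m # bitlist n (m div 2)"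

lemma bitlist_code: "bitlist (length l) (code l) = l"
  by (induction l) (simp_all add: add.commute[of _ 1])

lemma code_nonneg: "0 \<le> code l"
  by (induction l) simp_all

definition closed_under :: "(bool list \<Rightarrow> bool list) \<Rightarrow> (int list \<times> int list) list \<Rightarrow> bool" where
  "closed_under f cs \<longleftrightarrow> list_all (\<lambda>(r, ms). list_all (\<lambda>m. 0 \<le> m \<and> code (f (bitlist 10 m)) \<in> set ms) ms) cs"

lemma key_in_closed:
  assumes "closed_under f cs" "length l = 10" "length (f l) = 10" "f (f l) = l"
  shows "key_in i cs (code (f l)) = key_in i cs (code l)"
  using assms(1)
proof (induction cs arbitrary: i)
  case (Cons c cs)
  obtain r ms where c: "c = (r, ms)" by (cases c)
  have ms: "0 \<le> m" "code (f (bitlist 10 m)) \<in> set ms" if "m \<in> set ms" for m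
    using Cons.prems that by (auto simp: closed_under_def c list_all_iff)
  have "code (f l) \<in> set ms" if "code l \<in> set ms"
    using ms(2)[OF that] bitlist_code[of l] assms(2) by simp
  moreover have "code l \<in> set ms" if "code (f l) \<in> set ms"
    using ms(2)[OF that] bitlist_code[of "f l"] assms(3,4) by simp
  moreover have "code x \<in> set ms" if "- code x \<in> set ms" for x
    using ms(1)[OF that] code_nonneg[of x] that by simp
  moreover have "key_in j cs (code (f l)) = key_in j cs (code l)" for j
    using Cons by (simp add: closed_under_def)
  ultimately show ?case by (auto simp: c)
qed simp

fun swap01 :: "bool list \<Rightarrow> bool list" where
  "swap01 [a, b, c, d, e, f, g, h, i, j] = [a, b, d, c, e, g, f, i, h, j]"
| "swap01 l = l"

fun swap12 :: "bool list \<Rightarrow> bool list" where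
  "swap12 [a, b, c, d, e, f, g, h, i, j] = [a, c, b, d, f, e, g, h, j, i]"
| "swap12 l = l"

fun swap34 :: "bool list \<Rightarrow> bool list" where
  "swap34 [a, b, c, d, e, f, g, h, i, j] = [a, e, f, g, b, c, d, h, i, j]"
| "swap34 l = l"

lemma closed_under_swaps: "closed_under swap01 V0" "closed_under swap12 V0" "closed_under swap34 V0"
  by code_simp+

lemma key_swaps:
  "key 0 [a, b, d, c, e, g, f, i, h, j] = key 0 [a, b, c, d, e, f, g, h, i, j]"
  "key 0 [a, c, b, d, f, e, g, h, j, i] = key 0 [a, b, c, d, e, f, g, h, i, j]"
  "key 0 [a, e, f, g, b, c, d, h, i, j] = key 0 [a, b, c, d, e, f, g, h, i, j]"
  using key_in_closed[OF closed_under_swaps(1), of "[a, b, c, d, e, f, g, h, i, j]" 2]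
    key_in_closed[OF closed_under_swaps(2), of "[a, b, c, d, e, f, g, h, i, j]" 2]
    key_in_closed[OF closed_under_swaps(3), of "[a, b, c, d, e, f, g, h, i, j]" 2]
  by (simp_all only: key_def V_def nth_Cons_0 swap01.simps(1) swap12.simps(1) swap34.simps(1)
      list.size simp_thms)

definition class3 :: "pattern \<Rightarrow> nat \<Rightarrow> nat \<Rightarrow> nat \<Rightarrow> nat \<Rightarrow> nat \<Rightarrow> int" where
  "class3 q i j k y z = key 0 [q i j k, q i j y, q i k y, q j k y, q i j z, q i k z, q j k z, q i y z, q j y z, q k y z]"

lemma class3_swap:
  assumes "symmetric q"
  shows "class3 q i j k y z = class3 q j i k y z" "class3 q i j k y z = class3 q i k j y z"
    "class3 q i j k y z = class3 q i j k z y"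
proof -
  have s: "q i j k = q j i k" "q i j k = q i k j" for i j k
    using assms unfolding symmetric_def by blast+
  show "class3 q i j k y z = class3 q j i k y z"
    unfolding class3_def s(1)[of j i] by (rule key_swaps(1)[symmetric])
  show "class3 q i j k y z = class3 q i k j y z"
    unfolding class3_def s(2)[of i k j] s(1)[of k j] by (rule key_swaps(2)[symmetric])
  show "class3 q i j k y z = class3 q i j k z y"
    unfolding class3_def s(2)[of _ z y] by (rule key_swaps(3)[symmetric])
qed

definition part3 :: "pattern \<Rightarrow> int" where
  "part3 q = 3645000 * of_bool (q 0 1 2) + form3 (flag3 q 3 4) (flag3 q 5 6)"

lemma part3_turn:
  assumes "symmetric q"
  shows "\<forall>t\<in>set turns3. part3 (relab q t) = part3 q"
proof -
  have s: "q i j k = q j i k" "q i j k = q i k j" for i j k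
    using assms unfolding symmetric_def by blast+
  have p: "part3 (relab q t) = 3645000 * of_bool (q (t ! 0) (t ! 1) (t ! 2))
      + gram 0 (class3 q (t ! 0) (t ! 1) (t ! 2) (t ! 3) (t ! 4)) (class3 q (t ! 0) (t ! 1) (t ! 2) (t ! 5) (t ! 6))" for t
    by (simp add: part3_def form3_def flag3_def class3_def relab_def)
  have "part3 q = 3645000 * of_bool (q 0 1 2) + gram 0 (class3 q 0 1 2 3 4) (class3 q 0 1 2 5 6)"
    by (simp add: part3_def form3_def flag3_def class3_def)
  then show ?thesis
    by (simp add: turns3_def p s class3_swap[OF assms] gram_commute)
qed

text \<open>What remains of the average over all 5040 rearrangements after the symmetries inside the cosets
  have been used; each summand stands for 48 equal contributions.\<close>

definition total :: "pattern \<Rightarrow> int" where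
  "total p = (\<Sum>r\<leftarrow>splits5. total5 (root5 (relab p r)) (link5 (relab p r) 5) (link5 (relab p r) 6))
     + (\<Sum>r\<leftarrow>splits3. part3 (relab p r))"

theorem symmetrised_eq_total:
  assumes "symmetric p"
  shows "symmetrised p = 48 * total p"
proof -
  define f5 where "f5 q = form5 (root5 q) (link5 q 5) (link5 q 6)" for q
  have cong5: "f5 (relab p (map ((!) r) t)) = f5 (relab (relab p r) t)" if "t \<in> perms7" for r t
    using that by (simp add: f5_def root5_def link5_def relab_relab[symmetric])
  have cong3: "part3 (relab p (map ((!) r) t)) = part3 (relab (relab p r) t)" if "t \<in> perms7" for r t
    using that by (simp add: part3_def flag3_def relab_relab[symmetric])
  have "symmetrised p = 24 * (\<Sum>xs\<in>perms7. f5 (relab p xs)) + (\<Sum>xs\<in>perms7. part3 (relab p xs))"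
    by (simp add: symmetrised_def weight_def f5_def part3_def sum.distrib sum_distrib_left add.assoc)
  also have "(\<Sum>xs\<in>perms7. f5 (relab p xs)) = (\<Sum>r\<leftarrow>splits5. \<Sum>t\<leftarrow>turns5. f5 (relab (relab p r) t))"
    unfolding sum_perms7_splits5
    by (intro arg_cong[where f = sum_list] map_cong refl cong5) (use splits_turns_perms in blast)
  also have "\<dots> = (\<Sum>r\<leftarrow>splits5. 2 * total5 (root5 (relab p r)) (link5 (relab p r) 5) (link5 (relab p r) 6))"
    unfolding f5_def by (simp add: sum_turns5 symmetric_relab[OF assms])
  also have "(\<Sum>xs\<in>perms7. part3 (relab p xs)) = (\<Sum>r\<leftarrow>splits3. \<Sum>t\<leftarrow>turns3. part3 (relab (relab p r) t))"
    unfolding sum_perms7_splits3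
    by (intro arg_cong[where f = sum_list] map_cong refl cong3) (use splits_turns_perms in blast)
  also have "\<dots> = (\<Sum>r\<leftarrow>splits3. 48 * part3 (relab p r))"
  proof (intro arg_cong[where f = sum_list] map_cong refl)
    fix r
    have "(\<Sum>t\<leftarrow>turns3. part3 (relab (relab p r) t)) = (\<Sum>t\<leftarrow>turns3. part3 (relab p r))"
      using part3_turn[OF symmetric_relab[OF assms, of r]]
      by (intro arg_cong[where f = sum_list] map_cong refl) blast
    then show "(\<Sum>t\<leftarrow>turns3. part3 (relab (relab p r) t)) = 48 * part3 (relab p r)"
      by (simp add: sum_list_triv splits_turns_length)
  qed
  finally show ?thesis by (simp add: total_def sum_list_const_mult)
qed

section \<open>Enumeration of leading patterns\<close>

definition F1_triples :: "(nat \<times> nat \<times> nat) list" where "F1_triples = [(0,1,2), (0,1,3), (0,2,3)]"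
definition F2_triples :: "(nat \<times> nat \<times> nat) list" where "F2_triples = [(0,1,2), (0,1,3), (0,1,4), (2,3,4)]"
definition F3_triples :: "(nat \<times> nat \<times> nat) list" where
  "F3_triples = [(0,1,2), (0,1,3), (1,2,4), (0,3,4), (2,3,4)]"
definition F4_triples :: "(nat \<times> nat \<times> nat) list" where
  "F4_triples = [(0,1,2), (0,2,4), (0,3,4), (1,3,4), (0,1,5), (1,3,5), (2,3,5), (2,4,5),
     (1,2,6), (0,3,6), (2,3,6), (1,4,6), (0,5,6)]"
definition F5_triples :: "(nat \<times> nat \<times> nat) list" where
  "F5_triples = [(0,1,2), (0,1,3), (0,2,4), (0,3,4), (1,2,5), (2,3,5), (1,4,5), (3,4,5),
     (1,3,6), (2,3,6), (1,4,6), (2,4,6), (0,5,6)]"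

text \<open>Maps need not be injective here: a free hypergraph contains no homomorphic image of a family member
  either, so patterns with repeated vertices need no separate treatment.\<close>

definition hom_free :: "pattern \<Rightarrow> bool" where
  "hom_free p \<longleftrightarrow> (\<forall>F\<in>{F1_triples, F2_triples, F3_triples, F4_triples, F5_triples}.
     \<forall>\<phi>. \<exists>(i, j, k)\<in>set F. \<not> p (\<phi> i) (\<phi> j) (\<phi> k))"

definition tbit :: "pattern \<Rightarrow> nat \<Rightarrow> bool" where
  "tbit p t = (case triples ! t of (i, j, k) \<Rightarrow> p i j k)"

text \<open>Prefixes are stored with the newest bit first, which makes extension of a prefix a single
  constructor.\<close>

definition rbits :: "pattern \<Rightarrow> nat \<Rightarrow> bool list" where
  "rbits p n = rev (map (tbit p) [0..<n])"

definition look :: "bool list \<Rightarrow> nat \<Rightarrow> bool" where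
  "look bs t = bs ! (length bs - Suc t)"

definition pattern_at :: "bool list \<Rightarrow> pattern" where
  "pattern_at bs i j k = look bs (pos3 i j k)"

lemma look_rbits: "t < n \<Longrightarrow> look (rbits p n) t = tbit p t"
  by (simp add: look_def rbits_def rev_nth)

lemma length_rbits [simp]: "length (rbits p n) = n"
  by (simp add: rbits_def)

lemma rbits_Suc: "rbits p (Suc n) = tbit p n # rbits p n"
  by (simp add: rbits_def)

lemma triples_pos3_check:
  "list_all (\<lambda>a. list_all (\<lambda>b. list_all (\<lambda>c. if a = b \<or> a = c \<or> b = c then True else
     pos3 a b c < 35 \<and> triples ! pos3 a b c \<in> set [(a,b,c), (a,c,b), (b,a,c), (b,c,a), (c,a,b), (c,b,a)])
     [0..<7]) [0..<7]) [0..<7]"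
  by code_simp

lemma tbit_pos3:
  assumes "symmetric p" "a < 7" "b < 7" "c < 7" "a \<noteq> b" "a \<noteq> c" "b \<noteq> c"
  shows "tbit p (pos3 a b c) = p a b c" "pos3 a b c < 35"
proof -
  have s: "p i j k = p j i k" "p i j k = p i k j" for i j k
    using assms(1) unfolding symmetric_def by blast+
  have "pos3 a b c < 35 \<and> triples ! pos3 a b c \<in> set [(a,b,c), (a,c,b), (b,a,c), (b,c,a), (c,a,b), (c,b,a)]"
    using triples_pos3_check assms(2-7) unfolding list_all_iff by (simp del: list.set)
  then show "tbit p (pos3 a b c) = p a b c" "pos3 a b c < 35"
    using s(1)[of b a] s(1)[of c a] s(2)[of a c b] s(2)[of b c a] s(1)[of c b] s(2)[of c b a]
    by (auto simp: tbit_def)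
qed

text \<open>Lazy connectives for the evaluation by rewriting: with weak congruence rules the second
  argument is not evaluated when the first one decides.\<close>

definition sor :: "bool \<Rightarrow> bool \<Rightarrow> bool" where "sor a b = (a \<or> b)"
definition sand :: "bool \<Rightarrow> bool \<Rightarrow> bool" where "sand a b = (a \<and> b)"

lemma sor_rules: "sor True b = True" "sor False b = b" "sand True b = b" "sand False b = False"
  by (simp_all add: sor_def sand_def)

lemma sor_cong: "a = a' \<Longrightarrow> sor a b = sor a' b" by simp
lemma sand_cong: "a = a' \<Longrightarrow> sand a b = sand a' b" by simp

fun ors :: "bool list \<Rightarrow> bool" where "ors [] = False" | "ors (b # bs) = sor b (ors bs)"
fun ands :: "bool list \<Rightarrow> bool" where "ands [] = True" | "ands (b # bs) = sand b (ands bs)"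

lemma ors_iff: "ors bs \<longleftrightarrow> (\<exists>b\<in>set bs. b)" by (induction bs) (auto simp: sor_def)
lemma ands_iff: "ands bs \<longleftrightarrow> (\<forall>b\<in>set bs. b)" by (induction bs) (auto simp: sand_def)

text \<open>The images of the three small forbidden hypergraphs in seven vertices. Each one is listed once up to
  its automorphisms.\<close>

definition embeddings1 :: "nat list list" where
  "embeddings1 = [[d, a, b, c]. a \<leftarrow> [0..<7], b \<leftarrow> [Suc a..<7], c \<leftarrow> [Suc b..<7],
     d \<leftarrow> [0..<7], d \<notin> set [a, b, c]]"

definition embeddings2 :: "nat list list" where
  "embeddings2 = [[a, b, c, d, e]. a \<leftarrow> [0..<7], b \<leftarrow> [Suc a..<7], c \<leftarrow> [0..<7], c \<notin> set [a, b],
     d \<leftarrow> [Suc c..<7], d \<notin> set [a, b], e \<leftarrow> [Suc d..<7], e \<notin> set [a, b]]"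

definition embeddings3 :: "nat list list" where
  "embeddings3 = [[a, b, c, d, e]. a \<leftarrow> [0..<7], b \<leftarrow> [Suc a..<7], d \<leftarrow> [Suc b..<7],
     c \<leftarrow> [Suc a..<7], c \<notin> set [b, d], e \<leftarrow> [Suc a..<7], e \<notin> set [b, c, d]]"

definition placements :: "((nat \<times> nat \<times> nat) list \<times> nat list) list" where
  "placements = map (Pair F1_triples) embeddings1 @ map (Pair F2_triples) embeddings2 @ map (Pair F3_triples) embeddings3"

definition copies :: "nat list list" where
  "copies = map (\<lambda>(F, \<phi>). map (\<lambda>(i, j, k). pos3 (\<phi> ! i) (\<phi> ! j) (\<phi> ! k)) F) placements"

lemma placements_ok:
  assumes "(F, \<phi>) \<in> set placements"
  shows "distinct \<phi> \<and> (\<forall>x\<in>set \<phi>. x < 7) \<and>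
    (F = F1_triples \<and> length \<phi> = 4 \<or> F = F2_triples \<and> length \<phi> = 5 \<or> F = F3_triples \<and> length \<phi> = 5)"
proof -
  from assms consider "F = F1_triples" "\<phi> \<in> set embeddings1" | "F = F2_triples" "\<phi> \<in> set embeddings2"
    | "F = F3_triples" "\<phi> \<in> set embeddings3"
    unfolding placements_def set_append set_map by blast
  then show ?thesis
  proof cases
    case 1
    then show ?thesis unfolding embeddings1_def by auto
  next
    case 2
    then show ?thesis unfolding embeddings2_def by auto
  next
    case 3
    then show ?thesis unfolding embeddings3_def by auto
  qed
qed

definition tops :: "(nat \<times> nat list) list" where
  "tops = map (\<lambda>cp. (fold max cp 0, cp)) copies"

text \<open>A copy is detected as soon as its last triple is added.\<close>

definition closing :: "nat \<Rightarrow> nat list list" where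
  "closing n = map (\<lambda>(x, cp). filter (\<lambda>t. t \<noteq> n) cp) (filter (\<lambda>(x, cp). x = n) tops)"

definition closes :: "nat \<Rightarrow> bool list \<Rightarrow> bool" where
  "closes n bs = ors (map (\<lambda>cp. ands (map (look bs) cp)) (closing n))"

lemma copies_sound:
  assumes "symmetric p" "hom_free p" "cp \<in> set copies"
  shows "\<exists>t\<in>set cp. \<not> tbit p t"
proof -
  obtain F \<phi> where F: "(F, \<phi>) \<in> set placements"
      and cp: "cp = map (\<lambda>(i, j, k). pos3 (\<phi> ! i) (\<phi> ! j) (\<phi> ! k)) F"
    using assms(3) unfolding copies_def by auto
  note ok = placements_ok[OF F]
  have idx: "i < length \<phi> \<and> j < length \<phi> \<and> k < length \<phi> \<and> i \<noteq> j \<and> i \<noteq> k \<and> j \<noteq> k"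
    if "(i, j, k) \<in> set F" for i j k
    using ok that by (auto simp: F1_triples_def F2_triples_def F3_triples_def)
  have "F \<in> {F1_triples, F2_triples, F3_triples, F4_triples, F5_triples}" using ok by blast
  then have "\<exists>(i, j, k)\<in>set F. \<not> p (\<phi> ! i) (\<phi> ! j) (\<phi> ! k)"
    using assms(2) unfolding hom_free_def by blast
  then obtain i j k where t: "(i, j, k) \<in> set F" "\<not> p (\<phi> ! i) (\<phi> ! j) (\<phi> ! k)" by blast
  note ijk = idx[OF t(1)]
  then have "\<phi> ! i < 7" "\<phi> ! j < 7" "\<phi> ! k < 7" using ok by simp_all
  moreover have "\<phi> ! i \<noteq> \<phi> ! j" "\<phi> ! i \<noteq> \<phi> ! k" "\<phi> ! j \<noteq> \<phi> ! k"
    using ijk ok by (simp_all add: nth_eq_iff_index_eq)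
  ultimately have "tbit p (pos3 (\<phi> ! i) (\<phi> ! j) (\<phi> ! k)) = p (\<phi> ! i) (\<phi> ! j) (\<phi> ! k)"
    by (rule tbit_pos3(1)[OF assms(1)])
  then have "\<not> tbit p (pos3 (\<phi> ! i) (\<phi> ! j) (\<phi> ! k))" using t(2) by simp
  moreover have "pos3 (\<phi> ! i) (\<phi> ! j) (\<phi> ! k) \<in> set cp"
    unfolding cp set_map by (rule image_eqI[OF _ t(1)]) simp
  ultimately show ?thesis by blast
qed

lemma fold_max_ge: "x \<in> set xs \<or> x = a \<Longrightarrow> x \<le> fold max xs (a :: nat)"
proof (induction xs arbitrary: a x)
  case (Cons y ys)
  have "max y a \<le> fold max ys (max y a)" by (rule Cons.IH) simp
  moreover have "x \<le> fold max ys (max y a)" if "x \<in> set ys" by (rule Cons.IH) (simp add: that)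
  ultimately show ?case using Cons.prems by auto
qed simp

lemma closes_sound:
  assumes "symmetric p" "hom_free p" "tbit p n" "closes n (rbits p n)"
  shows False
proof -
  obtain cp where cp: "cp \<in> set copies" "fold max cp 0 = n"
      "\<forall>t\<in>set cp. t \<noteq> n \<longrightarrow> look (rbits p n) t"
    using assms(4) by (auto simp: closes_def closing_def tops_def ors_iff ands_iff)
  have "tbit p t" if "t \<in> set cp" for t
  proof (cases "t = n")
    case False
    then have "t < n" using fold_max_ge[of t cp 0] cp(2) that by simp
    then show ?thesis using cp(3) that False look_rbits[of t n p] by auto
  qed (use assms(3) in simp)
  then show False using copies_sound[OF assms(1,2) cp(1)] by blast
qed

fun gtl :: "bool list \<Rightarrow> bool list \<Rightarrow> bool" where
  "gtl [] v = False"
| "gtl (a # u) [] = False"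
| "gtl (a # u) (b # v) = (if a then if b then gtl u v else True else if b then False else gtl u v)"

lemma gtl_rules:
  "gtl (True # u) (True # v) = gtl u v" "gtl (False # u) (False # v) = gtl u v"
  "gtl (True # u) (False # v) = True" "gtl (False # u) (True # v) = False" "gtl [] [] = False"
  by simp_all

text \<open>The binary value turns the lexicographic comparison into a comparison of numbers, so that a maximum
  exists.\<close>

fun lexval :: "bool list \<Rightarrow> nat" where
  "lexval [] = 0"
| "lexval (b # bs) = (if b then 2 ^ length bs else 0) + lexval bs"

lemma lexval_less: "lexval u < 2 ^ length u"
  by (induction u) auto

lemma gtl_lexval: "gtl u v \<Longrightarrow> length u = length v \<Longrightarrow> lexval v < lexval u"
proof (induction u v rule: gtl.induct)
  case (3 a u b v)
  then show ?case using lexval_less[of v] by (cases a; cases b) auto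
qed auto

lemma gtl_append: "gtl u v \<Longrightarrow> length u = length v \<Longrightarrow> gtl (u @ x) (v @ y)"
  by (induction u v rule: gtl.induct) (auto split: if_splits)

text \<open>Every pattern has a relabelling that is lexicographically maximal, and only those have to be
  searched. Maximality is tested against involutions only; this does not find every pattern that
  fails to be maximal, but it keeps the number of surviving patterns small.\<close>

definition leading :: "pattern \<Rightarrow> bool" where
  "leading p \<longleftrightarrow> (\<forall>t\<in>perms7. \<not> gtl (map (tbit (relab p t)) [0..<35]) (map (tbit p) [0..<35]))"

lemma length_triples: "length triples = 35"
  by code_simp

lemma triple_less: "t < 35 \<Longrightarrow> triples ! t = (i, j, k) \<Longrightarrow> i < 7 \<and> j < 7 \<and> k < 7 \<and> i \<noteq> j \<and> i \<noteq> k \<and> j \<noteq> k"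
proof -
  have *: "list_all (\<lambda>(i, j, k). i < 7 \<and> j < 7 \<and> k < 7 \<and> i \<noteq> j \<and> i \<noteq> k \<and> j \<noteq> k) triples" "length triples = 35"
    by code_simp+
  assume "t < 35" "triples ! t = (i, j, k)"
  then show ?thesis using * nth_mem[of t triples] by (auto simp: list_all_iff)
qed

lemma tbit_relab_relab:
  assumes "s \<in> perms7" "t < 35"
  shows "tbit (relab (relab p xs) s) t = tbit (relab p (map ((!) xs) s)) t"
proof -
  obtain i j k where ijk: "triples ! t = (i, j, k)" by (cases "triples ! t")
  then show ?thesis using triple_less[OF assms(2) ijk] relab_relab[OF assms(1)] by (simp add: tbit_def)
qed

lemma ex_leading: "\<exists>xs\<in>perms7. leading (relab p xs)"
proof -
  let ?v = "\<lambda>xs. lexval (map (tbit (relab p xs)) [0..<35])"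
  have ne: "[0..<7] \<in> perms7" by (auto simp: perms7_def)
  have fin: "finite (?v ` perms7)" using finite_perms7 by (rule finite_imageI)
  have "Max (?v ` perms7) \<in> ?v ` perms7" by (rule Max_in[OF fin]) (use ne in blast)
  then obtain xs where x: "xs \<in> perms7" "Max (?v ` perms7) = ?v xs" by blast
  have xs: "xs \<in> perms7" "\<And>ys. ys \<in> perms7 \<Longrightarrow> ?v ys \<le> ?v xs"
    using x Max_ge[OF fin] by auto
  have "leading (relab p xs)"
    unfolding leading_def
  proof (intro ballI notI)
    fix t assume t: "t \<in> perms7"
      and g: "gtl (map (tbit (relab (relab p xs) t)) [0..<35]) (map (tbit (relab p xs)) [0..<35])"
    have eq: "map (tbit (relab (relab p xs) t)) [0..<35] = map (tbit (relab p (map ((!) xs) t))) [0..<35]"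
      using tbit_relab_relab[OF t] by (intro map_cong) auto
    have "?v xs < ?v (map ((!) xs) t)" using gtl_lexval[OF g] unfolding eq by simp
    then show False using xs(2)[OF perms7_comp[OF xs(1) t]] by simp
  qed
  with xs(1) show ?thesis by blast
qed

text \<open>Involutions are listed as products of disjoint transpositions, that is, as matchings.\<close>

function matchings :: "nat list \<Rightarrow> (nat \<times> nat) list list" where
  "matchings [] = [[]]"
| "matchings (x # xs) = matchings xs @ concat (map (\<lambda>y. map ((#) (x, y)) (matchings (removeAll y xs))) xs)"
  by pat_completeness auto
termination by (relation "measure length") (auto simp: le_imp_less_Suc length_removeAll_less_eq)

definition involution :: "(nat \<times> nat) list \<Rightarrow> nat list" where
  "involution m = map (foldr (\<lambda>(x, y) j. if j = x then y else if j = y then x else j) m) [0..<7]"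

definition involutions :: "nat \<Rightarrow> nat list list" where
  "involutions n = map involution (matchings [0..<n])"

text \<open>The tests after 4, 10 and 20 triples use the involutions of the first four, five and six vertices.
  Those after 21, 23, 26 and 30 triples compare a prefix whose image under one transposition of the
  last vertex is already known.\<close>

definition tests :: "nat \<Rightarrow> (nat \<times> nat list) list" where
  "tests c = (if c = 4 then map (Pair 4) (involutions 4)
     else if c = 10 then map (Pair 10) (involutions 5)
     else if c = 20 then map (Pair 20) (involutions 6)
     else if c = 21 then [(1, [0,1,6,3,4,5,2])]
     else if c = 23 then [(4, [0,1,2,6,4,5,3])]
     else if c = 26 then [(10, [0,1,2,3,6,5,4])]
     else if c = 30 then [(20, [0,1,2,3,4,6,5])]
     else map (Pair 35) (involutions 7))"

definition moved :: "nat list \<Rightarrow> nat \<Rightarrow> nat" where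
  "moved s t = (case triples ! t of (i, j, k) \<Rightarrow> pos3 (s ! i) (s ! j) (s ! k))"

definition improves :: "nat \<Rightarrow> nat \<Rightarrow> bool list \<Rightarrow> bool" where
  "improves c i bs = (case tests c ! i of (m, s) \<Rightarrow>
     gtl (map (\<lambda>t. look bs (moved s t)) [0..<m]) (map (look bs) [0..<m]))"

definition tests_ok :: "nat \<Rightarrow> bool" where
  "tests_ok c \<longleftrightarrow> list_all (\<lambda>(m, s). perm_test s \<and> m \<le> 35 \<and> m \<le> c \<and>
     (if c = 35 then True else if c = 20 then s ! 6 = 6 else list_all (\<lambda>(i, j, k). pos3 (s ! i) (s ! j) (s ! k) < c) (take m triples))) (tests c)"

definition test_count :: "nat \<Rightarrow> nat" where
  "test_count c = (if c = 4 then 10 else if c = 10 then 26 else if c = 20 then 76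
     else if c = 21 then 1 else if c = 23 then 1 else if c = 26 then 1 else if c = 30 then 1
     else if c = 35 then 232 else 0)"

lemma tests_simps:
  "tests 4 = map (Pair 4) (involutions 4)" "tests 10 = map (Pair 10) (involutions 5)"
  "tests 20 = map (Pair 20) (involutions 6)" "tests 35 = map (Pair 35) (involutions 7)"
  "tests 21 = [(1, [0,1,6,3,4,5,2])]" "tests 23 = [(4, [0,1,2,6,4,5,3])]"
  "tests 26 = [(10, [0,1,2,3,6,5,4])]" "tests 30 = [(20, [0,1,2,3,4,6,5])]"
  by (simp_all add: tests_def)

lemma length_tests:
  "length (tests 4) = 10" "length (tests 10) = 26" "length (tests 20) = 76" "length (tests 35) = 232"
  "length (tests 21) = 1" "length (tests 23) = 1" "length (tests 26) = 1" "length (tests 30) = 1"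
  unfolding tests_simps length_map by code_simp+

lemma tests_ok_small:
  "tests_ok 4" "tests_ok 10" "tests_ok 21" "tests_ok 23" "tests_ok 26" "tests_ok 30"
  unfolding tests_ok_def tests_simps by code_simp+

lemma tests_ok_20: "tests_ok 20"
  proof -
  have "list_all (\<lambda>(m, s). perm_test s \<and> m \<le> 20 \<and> s ! 6 = 6) (tests 20)"
    unfolding tests_simps by code_simp
  then show ?thesis by (auto simp: tests_ok_def list_all_iff)
qed

lemma tests_ok_35: "tests_ok 35"
proof -
  have "list_all (\<lambda>(m, s). perm_test s \<and> m \<le> 35) (tests 35)"
    unfolding tests_simps by code_simp
  then show ?thesis by (auto simp: tests_ok_def list_all_iff)
qed

lemma test_count_ok: "i < test_count c \<Longrightarrow> tests_ok c \<and> i < length (tests c)"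
  by (auto simp: test_count_def length_tests tests_ok_small tests_ok_20 tests_ok_35 split: if_splits)

lemma triples_list: "triples =
    [(0, 1, 2), (0, 1, 3), (0, 2, 3), (1, 2, 3), (0, 1, 4), (0, 2, 4), (1, 2, 4), (0, 3, 4), (1, 3, 4),
     (2, 3, 4), (0, 1, 5), (0, 2, 5), (1, 2, 5), (0, 3, 5), (1, 3, 5), (2, 3, 5), (0, 4, 5), (1, 4, 5),
     (2, 4, 5), (3, 4, 5), (0, 1, 6), (0, 2, 6), (1, 2, 6), (0, 3, 6), (1, 3, 6), (2, 3, 6), (0, 4, 6),
     (1, 4, 6), (2, 4, 6), (3, 4, 6), (0, 5, 6), (1, 5, 6), (2, 5, 6), (3, 5, 6), (4, 5, 6)]"
  by code_simp

lemma six_vertices: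
  "list_all (\<lambda>(i, j, k). i < 6 \<and> j < 6 \<and> k < 6) (take 20 triples)"
  "list_all (\<lambda>a. list_all (\<lambda>b. list_all (\<lambda>c. if a = b \<or> a = c \<or> b = c then True else pos3 a b c < 20)
     [0..<6]) [0..<6]) [0..<6]"
  by code_simp+

text \<open>If a permutation improves a known prefix, then it improves the whole pattern, whatever the unknown
  triples are. For this the images of the compared positions must be known.\<close>

lemma improves_sound:
  assumes "symmetric p" "leading p" "tests_ok c" "i < length (tests c)" "improves c i (rbits p c)"
  shows False
proof -
  obtain m s where ms: "tests c ! i = (m, s)" by (cases "tests c ! i")
  have "(m, s) \<in> set (tests c)" using nth_mem[OF assms(4)] ms by simp
  then have ok: "perm_test s" "m \<le> 35" "m \<le> c"
      "c = 20 \<Longrightarrow> s ! 6 = 6"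
      "\<And>i j k. c \<noteq> 35 \<Longrightarrow> c \<noteq> 20 \<Longrightarrow> (i, j, k) \<in> set (take m triples) \<Longrightarrow> pos3 (s ! i) (s ! j) (s ! k) < c"
    using assms(3) by (auto simp: tests_ok_def list_all_iff split: if_splits)
  have s: "s \<in> perms7" using perm_test[of "[s]"] ok(1) by simp
  have 1: "look (rbits p c) (moved s t) = tbit (relab p s) t" if "t < m" for t
  proof -
    obtain i j k where ijk: "triples ! t = (i, j, k)" by (cases "triples ! t")
    have "t < 35" using that ok(2) by simp
    note less = triple_less[OF this ijk]
    have "inj_on ((!) s) {..<7}" by (rule perms7_inj[OF s])
    then have ne: "s ! i \<noteq> s ! j" "s ! i \<noteq> s ! k" "s ! j \<noteq> s ! k"
      using less by (auto dest: inj_onD)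
    have lt: "s ! i < 7" "s ! j < 7" "s ! k < 7" using less perms7_nth_less[OF s] by simp_all
    note pos = tbit_pos3[OF assms(1) lt ne]
    have "moved s t < c"
    proof -
      have tm: "take m' triples ! t \<in> set (take m' triples)" if "t < m'" "m' \<le> 35" for m'
        using that by (intro nth_mem) (simp add: length_triples)
      consider "c = 35" | "c = 20" | "c \<noteq> 35" "c \<noteq> 20" by blast
      then show ?thesis
      proof cases
        case 1
        then show ?thesis using pos(2) ijk by (simp add: moved_def)
      next
        case 2
        then have "(i, j, k) \<in> set (take 20 triples)" using tm[of 20] that ok(3) ijk by simp
        then have six: "i < 6" "j < 6" "k < 6" using six_vertices(1) by (auto simp: list_all_iff)
        have "s ! x < 6" if "x < 6" for x
        proof -
          have "s ! x \<noteq> s ! 6" using \<open>inj_on ((!) s) {..<7}\<close> that by (auto dest: inj_onD)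
          then show ?thesis using perms7_nth_less[OF s, of x] ok(4)[OF 2] that by simp
        qed
        then have "s ! i < 6" "s ! j < 6" "s ! k < 6" using six by blast+
        then have "pos3 (s ! i) (s ! j) (s ! k) < 20"
          using six_vertices(2) ne unfolding list_all_iff by simp
        then show ?thesis using 2 ijk by (simp add: moved_def)
      next
        case 3
        then show ?thesis using ok(5)[OF 3, of i j k] tm[OF that ok(2)] ijk that by (simp add: moved_def)
      qed
    qed
    then have "look (rbits p c) (moved s t) = tbit p (moved s t)" by (rule look_rbits)
    also have "\<dots> = p (s ! i) (s ! j) (s ! k)" using pos(1) ijk by (simp add: moved_def)
    finally show ?thesis using ijk by (simp add: tbit_def relab_def)
  qed
  have "gtl (map (tbit (relab p s)) [0..<m]) (map (tbit p) [0..<m])"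
  proof -
    have e1: "map (\<lambda>t. look (rbits p c) (moved s t)) [0..<m] = map (tbit (relab p s)) [0..<m]"
      using 1 by (intro map_cong) auto
    have e2: "map (look (rbits p c)) [0..<m] = map (tbit p) [0..<m]"
      using ok(3) look_rbits[of _ c p] by (intro map_cong) auto
    show ?thesis using assms(5) unfolding improves_def ms prod.case e1 e2 .
  qed
  then have "gtl (map (tbit (relab p s)) [0..<m] @ map (tbit (relab p s)) [m..<35]) (map (tbit p) [0..<m] @ map (tbit p) [m..<35])"
    by (rule gtl_append) simp
  moreover have "[0..<35] = [0..<m] @ [m..<35]" using ok(2) upt_add_eq_append[of 0 m "35 - m"] by simp
  ultimately show False using assms(2) s unfolding leading_def by (metis map_append)
qed

text \<open>Only three placements of the two large forbidden hypergraphs have to be tried: among the maximal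
  patterns that are left, these suffice to recognise every pattern that exceeds the bound.\<close>

definition bad :: "bool list \<Rightarrow> bool" where
  "bad bs = ors (map (\<lambda>(F, \<phi>). ands (map (\<lambda>(i, j, k). pattern_at bs (\<phi> ! i) (\<phi> ! j) (\<phi> ! k)) F))
     [(F4_triples, [0, 4, 2, 3, 1, 5, 6]), (F4_triples, [0, 1, 3, 5, 6, 2, 4]), (F5_triples, [0, 1, 2, 3, 4, 5, 6])])"

lemma pattern_at_rbits:
  assumes "symmetric p" "a < 7" "b < 7" "c < 7" "a \<noteq> b" "a \<noteq> c" "b \<noteq> c"
  shows "pattern_at (rbits p 35) a b c = p a b c"
  using tbit_pos3[OF assms] by (simp add: pattern_at_def look_rbits)

lemma bad_sound:
  assumes "symmetric p" "hom_free p"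
  shows "\<not> bad (rbits p 35)"
proof
  assume "bad (rbits p 35)"
  then consider "\<forall>(i, j, k)\<in>set F4_triples. p ([0, 4, 2, 3, 1, 5, 6] ! i) ([0, 4, 2, 3, 1, 5, 6] ! j) ([0, 4, 2, 3, 1, 5, 6] ! k)"
    | "\<forall>(i, j, k)\<in>set F4_triples. p ([0, 1, 3, 5, 6, 2, 4] ! i) ([0, 1, 3, 5, 6, 2, 4] ! j) ([0, 1, 3, 5, 6, 2, 4] ! k)"
    | "\<forall>(i, j, k)\<in>set F5_triples. p ([0, 1, 2, 3, 4, 5, 6] ! i) ([0, 1, 2, 3, 4, 5, 6] ! j) ([0, 1, 2, 3, 4, 5, 6] ! k)"
    by (simp add: bad_def ors_iff ands_iff F4_triples_def F5_triples_def pattern_at_rbits[OF assms(1)]) blast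
  then show False
    using assms(2) unfolding hom_free_def by cases (fastforce)+
qed

text \<open>A search is a list of steps: the choice of one triple or one test. The step without effect marks
  the place where the search is cut into separate evaluations.\<close>

datatype step = Bit nat | Test nat nat | Skip

fun search :: "step list \<Rightarrow> bool list \<Rightarrow> bool" where
  "search [] bs = sor (bad bs) (total (pattern_at bs) \<le> 87988477)"
| "search (Bit n # ss) bs = sand (search ss (False # bs)) (sor (closes n bs) (search ss (True # bs)))"
| "search (Test c i # ss) bs = sor (improves c i bs) (search ss bs)"
| "search (Skip # ss) bs = search ss bs"

fun wf_steps :: "nat \<Rightarrow> step list \<Rightarrow> bool" where
  "wf_steps n [] \<longleftrightarrow> n = 35"
| "wf_steps n (Bit m # ss) \<longleftrightarrow> m = n \<and> wf_steps (Suc n) ss"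
| "wf_steps n (Test c i # ss) \<longleftrightarrow> c = n \<and> i < test_count c \<and> wf_steps n ss"
| "wf_steps n (Skip # ss) \<longleftrightarrow> wf_steps n ss"

lemma total_pattern_at:
  assumes "symmetric p"
  shows "total (pattern_at (rbits p 35)) = total p"
proof -
  let ?q = "pattern_at (rbits p 35)"
  have eq: "relab ?q r i j k = relab p r i j k" if "r \<in> perms7" "i < 7" "j < 7" "k < 7" "i \<noteq> j" "i \<noteq> k" "j \<noteq> k" for r i j k
    using that perms7_inj[OF that(1)] perms7_nth_less[OF that(1)] unfolding relab_def
    by (intro pattern_at_rbits[OF assms]) (auto dest: inj_onD)
  have "total5 (root5 (relab ?q r)) (link5 (relab ?q r) 5) (link5 (relab ?q r) 6)
      = total5 (root5 (relab p r)) (link5 (relab p r) 5) (link5 (relab p r) 6)" if "r \<in> set splits5" for r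
  proof -
    have "r \<in> perms7" using that splits_turns_perms(1) by blast
    then show ?thesis by (simp add: root5_def link5_def eq)
  qed
  moreover have "part3 (relab ?q r) = part3 (relab p r)" if "r \<in> set splits3" for r
  proof -
    have "r \<in> perms7" using that splits_turns_perms(3) by blast
    then show ?thesis by (simp add: part3_def flag3_def eq)
  qed
  ultimately show ?thesis unfolding total_def by (simp cong: map_cong)
qed

text \<open>The search visits both values of each triple, except that it omits values which close a copy and
  prefixes which are improved by a test. Neither can occur in a leading pattern without homomorphic
  copies.\<close>

theorem search_sound:
  assumes "search ss (rbits p n)" "wf_steps n ss" "symmetric p" "hom_free p" "leading p"
  shows "total p \<le> 87988477"
  using assms(1,2)
proof (induction ss arbitrary: n)
  case Nil
  then show ?case
    using bad_sound[OF assms(3,4)] total_pattern_at[OF assms(3)] by (simp add: sor_def)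
next
  case (Cons s ss)
  show ?case
  proof (cases s)
    case (Bit m)
    then have s: "search ss (False # rbits p n)" "closes n (rbits p n) \<or> search ss (True # rbits p n)"
        "wf_steps (Suc n) ss"
      using Cons.prems by (simp_all add: sand_def sor_def)
    have "search ss (rbits p (Suc n))"
    proof (cases "tbit p n")
      case True
      then show ?thesis using s(2) closes_sound[OF assms(3,4) True] by (auto simp: rbits_Suc)
    next
      case False
      then show ?thesis using s(1) by (simp add: rbits_Suc)
    qed
    then show ?thesis using Cons.IH s(3) by blast
  next
    case (Test c i)
    then have "\<not> improves c i (rbits p n)"
      using Cons.prems improves_sound[OF assms(3,5)] test_count_ok by auto
    then show ?thesis using Cons Test by (simp add: sor_def)
  next
    case Skip
    then show ?thesis using Cons by simp
  qed
qed

section \<open>Tables as rewrite rules\<close>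

declare [[show_results = false]]

lemma upt_literal: "i < j \<Longrightarrow> [i..<j] = i # [Suc i..<j]"
  by (rule upt_conv_Cons)

lemma Suc_literal: "Suc 0 = 1" "Suc 1 = 2" "Suc (numeral n) = numeral (n + Num.One)"
  by (simp_all only: One_nat_def[symmetric] Suc_1 Suc_numeral)

declare One_nat_def [simp del]

text \<open>A list of numbers is checked to be free of repetitions by splitting it along the binary digits, in
  time proportional to its length.\<close>

fun radix :: "nat \<Rightarrow> int list \<Rightarrow> bool" where
  "radix 0 xs = (case xs of [] \<Rightarrow> True | x # ys \<Rightarrow> (case ys of [] \<Rightarrow> x = 0 | _ \<Rightarrow> False))"
| "radix (Suc n) xs = (case xs of [] \<Rightarrow> True
     | _ \<Rightarrow> radix n (map (\<lambda>x. x div 2) (filter even xs)) \<and> radix n (map (\<lambda>x. x div 2) (filter odd xs)))"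

lemma distinct_filters: "distinct (filter P xs) \<Longrightarrow> distinct (filter (\<lambda>x. \<not> P x) xs) \<Longrightarrow> distinct xs"
  by (induction xs) (auto split: if_splits)

lemma radix_sound: "radix n xs \<Longrightarrow> distinct xs \<and> (\<forall>x\<in>set xs. 0 \<le> x \<and> x < 2 ^ n)"
proof (induction n arbitrary: xs)
  case 0
  then show ?case by (auto split: list.splits)
next
  case (Suc n)
  show ?case
  proof (cases "xs = []")
    case False
    then have "radix n (map (\<lambda>x. x div 2) (filter even xs))" "radix n (map (\<lambda>x. x div 2) (filter odd xs))"
      using Suc.prems by (auto split: list.splits)
    note ih = this[THEN Suc.IH]
    have d: "distinct (filter even xs)" "distinct (filter odd xs)"
      using ih unfolding distinct_map by blast+
    have r: "0 \<le> x div 2 \<and> x div 2 < 2 ^ n" if "x \<in> set xs" for x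
    proof -
      have "x div 2 \<in> set (map (\<lambda>x. x div 2) (filter even xs)) \<union> set (map (\<lambda>x. x div 2) (filter odd xs))"
        using that by (cases "even x") auto
      then show ?thesis using ih by blast
    qed
    have half: "0 \<le> x \<and> x < 2 * y" if "0 \<le> x div 2 \<and> x div 2 < y" for x y :: int
      using that by presburger
    have "0 \<le> x \<and> x < 2 ^ Suc n" if "x \<in> set xs" for x
      using half[OF r[OF that]] by simp
    then show ?thesis using distinct_filters[OF d] by blast
  qed simp
qed

lemma code_bitlist: "0 \<le> x \<Longrightarrow> x < 2 ^ n \<Longrightarrow> code (bitlist n x) = x"
proof (induction n arbitrary: x)
  case (Suc n)
  then have "code (bitlist n (x div 2)) = x div 2" by (intro Suc.IH) simp_all
  then show ?case by simp
qed simp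

lemma bitlist10: "bitlist 10 m = [odd m, odd (m div 2), odd (m div 2 div 2), odd (m div 2 div 2 div 2),
    odd (m div 2 div 2 div 2 div 2), odd (m div 2 div 2 div 2 div 2 div 2),
    odd (m div 2 div 2 div 2 div 2 div 2 div 2), odd (m div 2 div 2 div 2 div 2 div 2 div 2 div 2),
    odd (m div 2 div 2 div 2 div 2 div 2 div 2 div 2 div 2),
    odd (m div 2 div 2 div 2 div 2 div 2 div 2 div 2 div 2 div 2)]"
  by (simp only: eval_nat_numeral BitM.simps bitlist.simps)

text \<open>Long conjunctions are rearranged into balanced ones: splitting a conjunction of many conjuncts into
  rewrite rules takes time proportional to its size multiplied by its depth.\<close>

definition conj_list :: "bool list \<Rightarrow> bool" where
  "conj_list xs \<longleftrightarrow> list_all (\<lambda>x. x) xs"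

lemma conj_list_Nil: "conj_list [] = True"
  by (simp add: conj_list_def)

lemma conj_list_Cons: "(P \<and> conj_list xs) = conj_list (P # xs)"
  by (simp add: conj_list_def)

fun pair_up :: "bool list \<Rightarrow> bool list" where
  "pair_up [] = []"
| "pair_up [x] = [x]"
| "pair_up (x # y # zs) = (x \<and> y) # pair_up zs"

lemma conj_list_pair_up: "conj_list (pair_up xs) = conj_list xs"
  by (induction xs rule: pair_up.induct) (auto simp: conj_list_def)

lemma conj_list_balanced: "conj_list [x] = x" "conj_list (x # y # zs) = conj_list (pair_up (x # y # zs))"
  by (simp_all only: conj_list_pair_up) (simp add: conj_list_def)

lemmas balance = conj_list_Nil conj_list_balanced pair_up.simps

fun class_keys :: "nat \<Rightarrow> int \<Rightarrow> int list \<Rightarrow> bool" where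
  "class_keys b i [] = True"
| "class_keys b i (m # ms) = ((if 0 \<le> m then key b (bitlist 10 m) = i else key b (bitlist 10 (- m)) = - i)
     \<and> class_keys b i ms)"

fun table_keys :: "nat \<Rightarrow> int \<Rightarrow> (int list \<times> int list) list \<Rightarrow> bool" where
  "table_keys b i [] = True"
| "table_keys b i ((r, ms) # cs) = (class_keys b i ms \<and> table_keys b (i + 1) cs)"

fun zero_keys :: "nat \<Rightarrow> int list \<Rightarrow> bool" where
  "zero_keys b [] = True"
| "zero_keys b (m # ms) = (key b (bitlist 10 m) = 0 \<and> zero_keys b ms)"

lemma class_keysI:
  assumes "\<And>m. m \<in> set ms \<Longrightarrow> 0 \<le> m \<Longrightarrow> key b (bitlist 10 m) = i"
    "\<And>m. m \<in> set ms \<Longrightarrow> m < 0 \<Longrightarrow> key b (bitlist 10 (- m)) = - i"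
  shows "class_keys b i ms"
  using assms by (induction ms) auto

lemma table_keysI:
  assumes "distinct (map abs (concat (map snd cs)))"
    and "\<And>x. x \<in> set (map abs (concat (map snd cs))) \<Longrightarrow> key b (bitlist 10 x) = key_in i cs x"
  shows "table_keys b i cs"
  using assms
proof (induction cs arbitrary: i)
  case (Cons c cs)
  obtain r ms where c: "c = (r, ms)" by (cases c)
  have dist: "distinct (map abs ms)" "distinct (map abs (concat (map snd cs)))"
      "set (map abs ms) \<inter> set (map abs (concat (map snd cs))) = {}"
    using Cons.prems(1) unfolding c by (simp_all only: list.map snd_conv concat.simps map_append distinct_append)
  have mem: "x \<in> set (map abs (concat (map snd (c # cs))))" if "x \<in> set (map abs ms) \<or> x \<in> set (map abs (concat (map snd cs)))" for x
    using that unfolding c by auto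
  have "class_keys b i ms"
  proof (rule class_keysI)
    fix m assume m: "m \<in> set ms" "0 \<le> m"
    have "m \<in> set (map abs ms)" using m by force
    from Cons.prems(2)[OF mem] this show "key b (bitlist 10 m) = i" using m by (simp add: c)
  next
    fix m assume m: "m \<in> set ms" "m < 0"
    have "- m \<in> set (map abs ms)" using m by force
    moreover have "- m \<notin> set ms"
      using dist(1) m by (auto simp: distinct_map dest: inj_onD[where x = m and y = "- m"])
    ultimately show "key b (bitlist 10 (- m)) = - i"
      using Cons.prems(2)[OF mem, of "- m"] m by (simp add: c)
  qed
  moreover have "table_keys b (i + 1) cs"
  proof (rule Cons.IH[OF dist(2)])
    fix x assume x: "x \<in> set (map abs (concat (map snd cs)))"
    then have nx: "x \<notin> set (map abs ms)" and pos: "0 \<le> x" using dist(3) by auto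
    have "x \<notin> set ms" using nx pos by force
    moreover have "- x \<notin> set ms" using nx pos by force
    ultimately show "key b (bitlist 10 x) = key_in (i + 1) cs x"
      using Cons.prems(2)[OF mem, of x] x by (simp add: c)
  qed
  ultimately show ?case by (simp add: c)
qed simp

lemma key_in_zero: "0 \<le> x \<Longrightarrow> x \<notin> set (map abs (concat (map snd cs))) \<Longrightarrow> key_in i cs x = 0"
proof (induction cs arbitrary: i)
  case (Cons c cs)
  obtain r ms where c: "c = (r, ms)" by (cases c)
  have nx: "x \<notin> set (map abs ms)" using Cons.prems(2) by (simp add: c)
  have "x \<notin> set ms" using nx Cons.prems(1) by force
  moreover have "- x \<notin> set ms" using nx Cons.prems(1) by force
  ultimately show ?case using Cons by (simp add: c)
qed simp

text \<open>The tables list codes by class, while the evaluation needs the class of a given flag. The rules for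
  all flags of a table are extracted in one pass; the recursive predicates here and below only serve
  to produce long conjunctions of equations, which then act as rewrite rules.\<close>

lemma key_laws:
  assumes "radix 10 (map abs (concat (map snd cs)) @ zs)" "V b = cs"
  shows "table_keys b 2 cs \<and> zero_keys b zs"
proof -
  have r: "distinct (map abs (concat (map snd cs)))" "set (map abs (concat (map snd cs))) \<inter> set zs = {}"
      "\<And>x. x \<in> set (map abs (concat (map snd cs))) \<union> set zs \<Longrightarrow> 0 \<le> x \<and> x < 2 ^ 10"
    using radix_sound[OF assms(1)] by (simp_all only: distinct_append set_append)
  have k: "key b (bitlist 10 x) = key_in 2 cs x" if "x \<in> set (map abs (concat (map snd cs))) \<union> set zs" for x
    using code_bitlist[of x 10] r(3)[OF that] assms(2) by (simp add: key_def)
  have "key b (bitlist 10 x) = 0" if "x \<in> set zs" for x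
  proof -
    have "0 \<le> x" "x \<notin> set (map abs (concat (map snd cs)))" using r(2) r(3)[of x] that by blast+
    then show ?thesis using k[of x] that key_in_zero by (metis Un_iff)
  qed
  then have "zero_keys b zs" by (induction zs) auto
  moreover have "table_keys b 2 cs" by (rule table_keysI[OF r(1) k]) blast
  ultimately show ?thesis by blast
qed

lemma V_literal: "V 0 = V0" "V 1 = V1" "V 2 = V2" "V 3 = V3" "V 4 = V4" "V 5 = V5" "V 6 = V6"
  "V 7 = V7" "V 8 = V8" "V 9 = V9" "V 10 = V10" "V 11 = V11"
  by (simp_all add: V_def)

text \<open>The second list contains the codes of the flags of the type whose vector is zero.\<close>

lemma masks_check0: "radix 10 (map abs (concat (map snd V0)) @ [])"
  by code_simp

lemma masks_check1: "radix 10 (map abs (concat (map snd V1)) @ [])"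
  by code_simp

lemma masks_check2: "radix 10 (map abs (concat (map snd V2)) @ [0, 1, 6, 12, 18, 24, 32, 192, 198, 204, 210, 216, 224, 256, 257, 262, 280, 288, 448, 472, 480,
    512, 513, 518, 536, 544, 704, 710, 736, 768, 769, 774, 780, 786, 792])"
  by code_simp

lemma masks_check3: "radix 10 (map abs (concat (map snd V3)) @ [])"
  by code_simp

lemma masks_check4: "radix 10 (map abs (concat (map snd V4)) @ [])"
  by code_simp

lemma masks_check5: "radix 10 (map abs (concat (map snd V5)) @ [0, 1, 12, 18, 32, 192, 224, 768, 769, 786])"
  by code_simp

lemma masks_check6: "radix 10 (map abs (concat (map snd V6)) @ [])"
  by code_simp

lemma masks_check7: "radix 10 (map abs (concat (map snd V7)) @ [0, 1, 12, 13, 18, 19, 30, 32, 33, 44, 45, 50, 51, 768, 769, 786])"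
  by code_simp

lemma masks_check8: "radix 10 (map abs (concat (map snd V8)) @ [])"
  by code_simp

lemma masks_check9: "radix 10 (map abs (concat (map snd V9)) @ [0, 1, 2, 4, 24, 32, 33, 192, 224, 256, 257, 280, 288, 289, 512, 514, 516, 544, 768])"
  by code_simp

lemma masks_check10: "radix 10 (map abs (concat (map snd V10)) @ [0, 1, 2, 4, 80, 136, 288, 289, 368, 424, 512, 514, 516])"
  by code_simp

lemma masks_check11: "radix 10 (map abs (concat (map snd V11)) @ [0, 1, 24, 32, 33, 80, 136, 192, 224, 256, 257, 280, 288, 289, 368, 424, 512, 544, 768])"
  by code_simp

lemma bitlist_parity:
  "odd (numeral (Num.Bit0 k) :: int) = False" "odd (numeral (Num.Bit1 k) :: int) = True"
  "odd (1 :: int) = True" "odd (0 :: int) = False"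
  "(numeral (Num.Bit0 k) :: int) div 2 = numeral k" "(numeral (Num.Bit1 k) :: int) div 2 = numeral k"
  "(1 :: int) div 2 = 0" "(0 :: int) div 2 = 0" "(numeral Num.One :: int) = 1"
  by simp_all

lemma class_keys_literal:
  "class_keys b i (numeral n # ms) = (key b (bitlist 10 (numeral n)) = i \<and> class_keys b i ms)"
  "class_keys b i (- numeral n # ms) = (key b (bitlist 10 (numeral n)) = - i \<and> class_keys b i ms)"
  "class_keys b i (1 # ms) = (key b (bitlist 10 1) = i \<and> class_keys b i ms)"
  "class_keys b i (- 1 # ms) = (key b (bitlist 10 1) = - i \<and> class_keys b i ms)"
  "class_keys b i (0 # ms) = (key b (bitlist 10 0) = i \<and> class_keys b i ms)"
  by simp_all

lemmas keys0 = key_laws[OF masks_check0 V_literal(1), unfolded V0_def table_keys.simps zero_keys.simps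
  class_keys_literal class_keys.simps(1) bitlist10 bitlist_parity numeral_plus_one add_num_simps simp_thms]
lemmas keys1 = key_laws[OF masks_check1 V_literal(2), unfolded V1_def table_keys.simps zero_keys.simps
  class_keys_literal class_keys.simps(1) bitlist10 bitlist_parity numeral_plus_one add_num_simps simp_thms]
lemmas keys2 = key_laws[OF masks_check2 V_literal(3), unfolded V2_def table_keys.simps zero_keys.simps
  class_keys_literal class_keys.simps(1) bitlist10 bitlist_parity numeral_plus_one add_num_simps simp_thms]
lemmas keys3 = key_laws[OF masks_check3 V_literal(4), unfolded V3_def table_keys.simps zero_keys.simps
  class_keys_literal class_keys.simps(1) bitlist10 bitlist_parity numeral_plus_one add_num_simps simp_thms]
lemmas keys4 = key_laws[OF masks_check4 V_literal(5), unfolded V4_def table_keys.simps zero_keys.simps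
  class_keys_literal class_keys.simps(1) bitlist10 bitlist_parity numeral_plus_one add_num_simps simp_thms]
lemmas keys5 = key_laws[OF masks_check5 V_literal(6), unfolded V5_def table_keys.simps zero_keys.simps
  class_keys_literal class_keys.simps(1) bitlist10 bitlist_parity numeral_plus_one add_num_simps simp_thms]
lemmas keys6 = key_laws[OF masks_check6 V_literal(7), unfolded V6_def table_keys.simps zero_keys.simps
  class_keys_literal class_keys.simps(1) bitlist10 bitlist_parity numeral_plus_one add_num_simps simp_thms]
lemmas keys7 = key_laws[OF masks_check7 V_literal(8), unfolded V7_def table_keys.simps zero_keys.simps
  class_keys_literal class_keys.simps(1) bitlist10 bitlist_parity numeral_plus_one add_num_simps simp_thms]
lemmas keys8 = key_laws[OF masks_check8 V_literal(9), unfolded V8_def table_keys.simps zero_keys.simps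
  class_keys_literal class_keys.simps(1) bitlist10 bitlist_parity numeral_plus_one add_num_simps simp_thms]
lemmas keys9 = key_laws[OF masks_check9 V_literal(10), unfolded V9_def table_keys.simps zero_keys.simps
  class_keys_literal class_keys.simps(1) bitlist10 bitlist_parity numeral_plus_one add_num_simps simp_thms]
lemmas keys10 = key_laws[OF masks_check10 V_literal(11), unfolded V10_def table_keys.simps zero_keys.simps
  class_keys_literal class_keys.simps(1) bitlist10 bitlist_parity numeral_plus_one add_num_simps simp_thms]
lemmas keys11 = key_laws[OF masks_check11 V_literal(12), unfolded V11_def table_keys.simps zero_keys.simps
  class_keys_literal class_keys.simps(1) bitlist10 bitlist_parity numeral_plus_one add_num_simps simp_thms]

text \<open>Inner products are tabulated once for each unordered pair of classes.\<close>

definition both :: "nat \<Rightarrow> int \<Rightarrow> int \<Rightarrow> int \<Rightarrow> bool" where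
  "both b i j v \<longleftrightarrow> gram b i j = v \<and> gram b j i = v"

fun gram_row :: "nat \<Rightarrow> int \<Rightarrow> int \<Rightarrow> int list \<Rightarrow> (int list \<times> int list) list \<Rightarrow> bool" where
  "gram_row b i j r [] = conj_list []"
| "gram_row b i j r ((r', ms) # cs) = (both b i j (dot r r') \<and> gram_row b i (j + 1) r cs)"

fun gram_table :: "nat \<Rightarrow> int \<Rightarrow> (int list \<times> int list) list \<Rightarrow> bool" where
  "gram_table b i [] = conj_list []"
| "gram_table b i ((r, ms) # cs) = (gram_row b i i r ((r, ms) # cs) \<and> gram_table b (i + 1) cs)"

lemma gram_rowI:
  "vec b i = r \<Longrightarrow> (\<And>n. n < length cs \<Longrightarrow> vec b (j + int n) = fst (cs ! n)) \<Longrightarrow> gram_row b i j r cs"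
proof (induction cs arbitrary: j)
  case (Cons c cs)
  obtain r' ms where c: "c = (r', ms)" by (cases c)
  have "vec b j = r'" using Cons.prems(2)[of 0] by (simp add: c)
  moreover have "gram_row b i (j + 1) r cs"
    using Cons.prems(2)[of "Suc _"] by (intro Cons.IH Cons.prems(1)) (simp add: algebra_simps)
  ultimately show ?case using Cons.prems(1) by (simp add: c both_def gram_def dot_commute)
qed (simp add: conj_list_Nil)

lemma gram_tableI:
  "(\<And>n. n < length cs \<Longrightarrow> vec b (i + int n) = fst (cs ! n)) \<Longrightarrow> gram_table b i cs"
proof (induction cs arbitrary: i)
  case (Cons c cs)
  obtain r ms where c: "c = (r, ms)" by (cases c)
  have "vec b i = r" using Cons.prems[of 0] by (simp add: c)
  then have "gram_row b i i r ((r, ms) # cs)" using Cons.prems by (intro gram_rowI) (simp_all add: c)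
  moreover have "gram_table b (i + 1) cs"
    using Cons.prems[of "Suc _"] by (intro Cons.IH) (simp add: algebra_simps)
  ultimately show ?case by (simp add: c)
qed (simp add: conj_list_Nil)

lemma mult_literal: "0 * (x :: int) = 0" "x * 0 = 0" "1 * x = x" "x * 1 = x" "- 1 * x = - x" "x * - 1 = - x"
  "- x * y = - (x * y)" "x * - y = - (x * y)" "- (- x) = x" "- (0 :: int) = 0"
  by simp_all

lemma add_literal: "0 + (x :: int) = x" "x + 0 = x" "1 + - (1 :: int) = 0" "- 1 + (1 :: int) = 0" "- 1 + - (1 :: int) = - 2"
  by simp_all

lemma gram_laws: "gram_table b 2 (V b)"
  by (rule gram_tableI) (simp add: vec_def row_def)

lemma gram_minus: "gram b (- k) m = - gram b k m" "gram b k (- m) = - gram b k m"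
  "gram b 0 m = 0" "gram b k 0 = 0"
proof -
  have v: "vec b (- k) = map uminus (vec b k)" for k
    by (simp add: vec_def o_def)
  have d: "dot (map uminus u) w = - dot u w" for u w
    by (induction u w rule: dot.induct) simp_all
  show "gram b (- k) m = - gram b k m" by (simp add: gram_def v d)
  then show "gram b k (- m) = - gram b k m" by (simp add: gram_def v d dot_commute[of "vec b k"])
  show "gram b 0 m = 0" "gram b k 0 = 0" by (simp_all add: gram_def vec_def)
qed

lemmas grams0 = gram_laws[of 0, unfolded V_literal V0_def gram_table.simps gram_row.simps dot.simps
  arith_simps arith_special Num.inc.simps mult_literal add_literal numeral_plus_one one_plus_numeral one_add_one conj_list_Cons,
  unfolded balance both_def]
lemmas grams1 = gram_laws[of 1, unfolded V_literal V1_def gram_table.simps gram_row.simps dot.simps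
  arith_simps arith_special Num.inc.simps mult_literal add_literal numeral_plus_one one_plus_numeral one_add_one conj_list_Cons,
  unfolded balance both_def]
lemmas grams2 = gram_laws[of 2, unfolded V_literal V2_def gram_table.simps gram_row.simps dot.simps
  arith_simps arith_special Num.inc.simps mult_literal add_literal numeral_plus_one one_plus_numeral one_add_one conj_list_Cons,
  unfolded balance both_def]
lemmas grams3 = gram_laws[of 3, unfolded V_literal V3_def gram_table.simps gram_row.simps dot.simps
  arith_simps arith_special Num.inc.simps mult_literal add_literal numeral_plus_one one_plus_numeral one_add_one conj_list_Cons,
  unfolded balance both_def]
lemmas grams4 = gram_laws[of 4, unfolded V_literal V4_def gram_table.simps gram_row.simps dot.simps
  arith_simps arith_special Num.inc.simps mult_literal add_literal numeral_plus_one one_plus_numeral one_add_one conj_list_Cons,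
  unfolded balance both_def]
lemmas grams5 = gram_laws[of 5, unfolded V_literal V5_def gram_table.simps gram_row.simps dot.simps
  arith_simps arith_special Num.inc.simps mult_literal add_literal numeral_plus_one one_plus_numeral one_add_one conj_list_Cons,
  unfolded balance both_def]
lemmas grams6 = gram_laws[of 6, unfolded V_literal V6_def gram_table.simps gram_row.simps dot.simps
  arith_simps arith_special Num.inc.simps mult_literal add_literal numeral_plus_one one_plus_numeral one_add_one conj_list_Cons,
  unfolded balance both_def]
lemmas grams7 = gram_laws[of 7, unfolded V_literal V7_def gram_table.simps gram_row.simps dot.simps
  arith_simps arith_special Num.inc.simps mult_literal add_literal numeral_plus_one one_plus_numeral one_add_one conj_list_Cons,
  unfolded balance both_def]
lemmas grams8 = gram_laws[of 8, unfolded V_literal V8_def gram_table.simps gram_row.simps dot.simps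
  arith_simps arith_special Num.inc.simps mult_literal add_literal numeral_plus_one one_plus_numeral one_add_one conj_list_Cons,
  unfolded balance both_def]
lemmas grams9 = gram_laws[of 9, unfolded V_literal V9_def gram_table.simps gram_row.simps dot.simps
  arith_simps arith_special Num.inc.simps mult_literal add_literal numeral_plus_one one_plus_numeral one_add_one conj_list_Cons,
  unfolded balance both_def]
lemmas grams10 = gram_laws[of 10, unfolded V_literal V10_def gram_table.simps gram_row.simps dot.simps
  arith_simps arith_special Num.inc.simps mult_literal add_literal numeral_plus_one one_plus_numeral one_add_one conj_list_Cons,
  unfolded balance both_def]
lemmas grams11 = gram_laws[of 11, unfolded V_literal V11_def gram_table.simps gram_row.simps dot.simps
  arith_simps arith_special Num.inc.simps mult_literal add_literal numeral_plus_one one_plus_numeral one_add_one conj_list_Cons,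
  unfolded balance both_def]

lemma orders5_list: "orders5 = [[0,1,2,3,4], [0,1,2,4,3], [0,1,3,2,4], [0,1,3,4,2], [0,1,4,2,3], [0,1,4,3,2], [0,2,1,3,4],
    [0,2,1,4,3], [0,2,3,1,4], [0,2,3,4,1], [0,2,4,1,3], [0,2,4,3,1], [0,3,1,2,4], [0,3,1,4,2],
    [0,3,2,1,4], [0,3,2,4,1], [0,3,4,1,2], [0,3,4,2,1], [0,4,1,2,3], [0,4,1,3,2], [0,4,2,1,3],
    [0,4,2,3,1], [0,4,3,1,2], [0,4,3,2,1], [1,0,2,3,4], [1,0,2,4,3], [1,0,3,2,4], [1,0,3,4,2],
    [1,0,4,2,3], [1,0,4,3,2], [1,2,0,3,4], [1,2,0,4,3], [1,2,3,0,4], [1,2,3,4,0], [1,2,4,0,3],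
    [1,2,4,3,0], [1,3,0,2,4], [1,3,0,4,2], [1,3,2,0,4], [1,3,2,4,0], [1,3,4,0,2], [1,3,4,2,0],
    [1,4,0,2,3], [1,4,0,3,2], [1,4,2,0,3], [1,4,2,3,0], [1,4,3,0,2], [1,4,3,2,0], [2,0,1,3,4],
    [2,0,1,4,3], [2,0,3,1,4], [2,0,3,4,1], [2,0,4,1,3], [2,0,4,3,1], [2,1,0,3,4], [2,1,0,4,3],
    [2,1,3,0,4], [2,1,3,4,0], [2,1,4,0,3], [2,1,4,3,0], [2,3,0,1,4], [2,3,0,4,1], [2,3,1,0,4],
    [2,3,1,4,0], [2,3,4,0,1], [2,3,4,1,0], [2,4,0,1,3], [2,4,0,3,1], [2,4,1,0,3], [2,4,1,3,0],
    [2,4,3,0,1], [2,4,3,1,0], [3,0,1,2,4], [3,0,1,4,2], [3,0,2,1,4], [3,0,2,4,1], [3,0,4,1,2],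
    [3,0,4,2,1], [3,1,0,2,4], [3,1,0,4,2], [3,1,2,0,4], [3,1,2,4,0], [3,1,4,0,2], [3,1,4,2,0],
    [3,2,0,1,4], [3,2,0,4,1], [3,2,1,0,4], [3,2,1,4,0], [3,2,4,0,1], [3,2,4,1,0], [3,4,0,1,2],
    [3,4,0,2,1], [3,4,1,0,2], [3,4,1,2,0], [3,4,2,0,1], [3,4,2,1,0], [4,0,1,2,3], [4,0,1,3,2],
    [4,0,2,1,3], [4,0,2,3,1], [4,0,3,1,2], [4,0,3,2,1], [4,1,0,2,3], [4,1,0,3,2], [4,1,2,0,3],
    [4,1,2,3,0], [4,1,3,0,2], [4,1,3,2,0], [4,2,0,1,3], [4,2,0,3,1], [4,2,1,0,3], [4,2,1,3,0],
    [4,2,3,0,1], [4,2,3,1,0], [4,3,0,1,2], [4,3,0,2,1], [4,3,1,0,2], [4,3,1,2,0], [4,3,2,0,1],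
    [4,3,2,1,0]]"
  by code_simp

lemma nth_literal:
  "[x0, x1, x2, x3] ! 0 = x0" "[x0, x1, x2, x3] ! 1 = x1" "[x0, x1, x2, x3] ! 2 = x2" "[x0, x1, x2, x3] ! 3 = x3"
  "[x0, x1, x2, x3, x4] ! 0 = x0" "[x0, x1, x2, x3, x4] ! 1 = x1" "[x0, x1, x2, x3, x4] ! 2 = x2"
  "[x0, x1, x2, x3, x4] ! 3 = x3" "[x0, x1, x2, x3, x4] ! 4 = x4"
  "[x0, x1, x2, x3, x4, x5, x6] ! 0 = x0"
  "[x0, x1, x2, x3, x4, x5, x6] ! 1 = x1"
  "[x0, x1, x2, x3, x4, x5, x6] ! 2 = x2"
  "[x0, x1, x2, x3, x4, x5, x6] ! 3 = x3"
  "[x0, x1, x2, x3, x4, x5, x6] ! 4 = x4"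
  "[x0, x1, x2, x3, x4, x5, x6] ! 5 = x5"
  "[x0, x1, x2, x3, x4, x5, x6] ! 6 = x6"
  "[x0, x1, x2, x3, x4, x5, x6, x7, x8, x9] ! 0 = x0"
  "[x0, x1, x2, x3, x4, x5, x6, x7, x8, x9] ! 1 = x1"
  "[x0, x1, x2, x3, x4, x5, x6, x7, x8, x9] ! 2 = x2"
  "[x0, x1, x2, x3, x4, x5, x6, x7, x8, x9] ! 3 = x3"
  "[x0, x1, x2, x3, x4, x5, x6, x7, x8, x9] ! 4 = x4"
  "[x0, x1, x2, x3, x4, x5, x6, x7, x8, x9] ! 5 = x5"
  "[x0, x1, x2, x3, x4, x5, x6, x7, x8, x9] ! 6 = x6"
  "[x0, x1, x2, x3, x4, x5, x6, x7, x8, x9] ! 7 = x7"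
  "[x0, x1, x2, x3, x4, x5, x6, x7, x8, x9] ! 8 = x8"
  "[x0, x1, x2, x3, x4, x5, x6, x7, x8, x9] ! 9 = x9"
  by simp_all

fun pos2_laws :: "(nat \<times> nat) list \<Rightarrow> bool" where
  "pos2_laws [] = True"
| "pos2_laws ((i, j) # ts) = (pos2 i j = min i j + max i j * (max i j - 1) div 2 \<and> pos2_laws ts)"

lemma pos2_laws: "pos2_laws ts"
  by (induction ts) (auto simp: pos2_def)

fun pos3_laws :: "(nat \<times> nat \<times> nat) list \<Rightarrow> bool" where
  "pos3_laws [] = True"
| "pos3_laws ((i, j, k) # ts) = (pos3 i j k = (let a = min i (min j k); c = max i (max j k); b = i + j + k - a - c
     in a + b * (b - 1) div 2 + c * (c - 1) * (c - 2) div 6) \<and> pos3_laws ts)"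

lemma pos3_laws: "pos3_laws ts"
  by (induction ts) (auto simp: pos3_def)

lemmas pos2_literal = pos2_laws[of "List.product [0,1,2,3,4] [0,1,2,3,4]", simplified]
lemmas pos3_literal = pos3_laws[of "List.product [0,1,2,3,4,5,6] (List.product [0,1,2,3,4,5,6] [0,1,2,3,4,5,6])", simplified Let_def, simplified]

fun turn_laws :: "nat list list \<Rightarrow> bool list \<Rightarrow> bool" where
  "turn_laws [] r = True"
| "turn_laws (s # ss) r = (turn_root s r = map (\<lambda>(i, j, k). r ! pos3 (s ! i) (s ! j) (s ! k))
     [(0,1,2), (0,1,3), (0,2,3), (1,2,3), (0,1,4), (0,2,4), (1,2,4), (0,3,4), (1,3,4), (2,3,4)]
   \<and> turn_link s r = map (\<lambda>(i, j). r ! pos2 (s ! i) (s ! j))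
     [(0,1), (0,2), (1,2), (0,3), (1,3), (2,3), (0,4), (1,4), (2,4), (3,4)] \<and> turn_laws ss r)"

lemma turn_laws: "turn_laws ss r"
  by (induction ss) (simp_all add: turn_root_def turn_link_def)

lemmas turn_literal = turn_laws[of orders5 "[x0, x1, x2, x3, x4, x5, x6, x7, x8, x9]", simplified orders5_list turn_laws.simps
  list.map prod.case nth_literal pos2_literal pos3_literal simp_thms] for x0 x1 x2 x3 x4 x5 x6 x7 x8 x9

fun form5_laws :: "int list \<Rightarrow> bool list \<Rightarrow> bool list \<Rightarrow> bool" where
  "form5_laws [] l m = True"
| "form5_laws (k # ks) l m = (form5 (bitlist 10 k) l m = (\<Sum>(c, b)\<leftarrow>types5. if k = c then gram b (key b l) (key b m) else 0)
     \<and> form5_laws ks l m)"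

lemma form5_laws: "list_all (\<lambda>k. 0 \<le> k \<and> k < 2 ^ 10) ks \<Longrightarrow> form5_laws ks l m"
  by (induction ks) (simp_all add: form5_def code_bitlist)

definition ex5 :: "bool list \<Rightarrow> bool list \<Rightarrow> bool list \<Rightarrow> int" where
  "ex5 r l m = (\<Sum>s\<leftarrow>orders5. form5 (turn_root s r) (turn_link s l) (turn_link s m))"

fun total5_laws :: "int list \<Rightarrow> bool list \<Rightarrow> bool list \<Rightarrow> bool" where
  "total5_laws [] l m = conj_list []"
| "total5_laws (k # ks) l m = (total5 (bitlist 10 k) l m = ex5 (bitlist 10 k) l m \<and> total5_laws ks l m)"

lemma total5_laws: "total5_laws ks l m"
  by (induction ks) (simp_all add: total5_def ex5_def conj_list_Nil)

text \<open>The codes of the hypergraphs on five labelled vertices without copies of the three small forbidden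
  ones. Only these occur in a pattern that has survived the search.\<close>

definition roots5 :: "int list" where
  "roots5 = [0, 1, 2, 3, 4, 5, 6, 8, 9, 10, 12, 16, 17, 18, 19, 20, 21, 22, 24, 25, 26, 28, 32, 33, 34, 35,
    36, 37, 38, 40, 41, 42, 44, 48, 50, 52, 54, 56, 58, 60, 64, 65, 66, 67, 68, 69, 70, 72, 73,
    74, 76, 80, 82, 84, 86, 88, 90, 92, 96, 98, 100, 102, 104, 106, 108, 128, 129, 130, 131, 132,
    133, 134, 136, 137, 138, 140, 144, 145, 148, 149, 152, 153, 156, 160, 161, 162, 163, 168, 169,
    170, 176, 192, 193, 194, 195, 196, 197, 200, 202, 204, 208, 212, 216, 224, 226, 232, 256, 257,
    258, 259, 260, 261, 262, 264, 265, 266, 268, 272, 273, 276, 277, 280, 281, 284, 288, 289, 290,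
    291, 292, 294, 296, 297, 300, 304, 308, 312, 320, 321, 322, 323, 324, 325, 326, 336, 352, 354,
    356, 384, 385, 388, 389, 392, 393, 396, 416, 417, 424, 448, 449, 452, 480, 512, 513, 514, 515,
    516, 517, 518, 520, 521, 522, 524, 528, 529, 530, 532, 533, 534, 536, 537, 538, 544, 545, 546,
    547, 552, 553, 554, 560, 562, 568, 576, 577, 578, 579, 580, 581, 582, 592, 594, 596, 608, 640,
    641, 642, 643, 648, 649, 650, 656, 657, 664, 704, 705, 706, 720, 768, 769, 770, 771, 772, 773,
    774, 784, 785, 788, 800, 801, 802, 816, 896]"

lemma roots5_range: "list_all (\<lambda>k. 0 \<le> k \<and> k < 2 ^ 10) roots5"
  by code_simp

lemmas form5_literal = form5_laws[OF roots5_range, unfolded roots5_def types5_def form5_laws.simps bitlist10 bitlist_parity, simplified]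

text \<open>For a fixed labelled hypergraph only those of the 120 orders contribute that turn it into one of the
  types. The evaluation of a pattern then needs few inner products.\<close>

lemmas total5_literal = total5_laws[of roots5 "[l0, l1, l2, l3, l4, l5, l6, l7, l8, l9]" "[m0, m1, m2, m3, m4, m5, m6, m7, m8, m9]",
    unfolded roots5_def total5_laws.simps bitlist10 bitlist_parity conj_list_Cons, simplified ex5_def orders5_list list.map sum_list.Cons sum_list.Nil
    turn_literal form5_literal add_0_left add_0_right, unfolded balance]
  for l0 l1 l2 l3 l4 l5 l6 l7 l8 l9 m0 m1 m2 m3 m4 m5 m6 m7 m8 m9

fun look_suffix :: "bool list \<Rightarrow> nat \<Rightarrow> bool list \<Rightarrow> bool" where
  "look_suffix bs t [] = True"
| "look_suffix bs t (b # rs) = (look bs t = b \<and> look_suffix bs (t + 1) rs)"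

fun look_laws :: "bool list \<Rightarrow> bool" where
  "look_laws [] = True"
| "look_laws (b # bs) = (look_suffix (b # bs) 0 (rev bs @ [b]) \<and> look_laws bs)"

lemma look_suffixI: "rev bs = us @ rs \<Longrightarrow> look_suffix bs (length us) rs"
proof (induction rs arbitrary: us)
  case (Cons b rs)
  have "look bs (length us) = rev bs ! length us"
    using arg_cong[OF Cons.prems, of length] by (simp add: look_def rev_nth)
  then have "look bs (length us) = b" using Cons.prems by simp
  moreover have "look_suffix bs (length us + 1) rs" using Cons.IH[of "us @ [b]"] Cons.prems by (simp add: Suc_eq_plus1)
  ultimately show ?case by simp
qed simp

lemma look_laws: "look_laws bs"
proof (induction bs)
  case (Cons b bs)
  then show ?case using look_suffixI[of "b # bs" "[]" "rev (b # bs)"] by simp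
qed simp

lemmas look_literal = look_laws[of "[b34, b33, b32, b31, b30, b29, b28, b27, b26, b25, b24, b23, b22, b21, b20, b19, b18, b17, b16, b15, b14, b13, b12, b11, b10, b9, b8, b7, b6, b5, b4, b3, b2, b1, b0]", simplified]
  for b34 b33 b32 b31 b30 b29 b28 b27 b26 b25 b24 b23 b22 b21 b20 b19 b18 b17 b16 b15 b14 b13 b12 b11 b10 b9 b8 b7 b6 b5 b4 b3 b2 b1 b0

text \<open>The finite lists that control the evaluation, written out.\<close>

lemma splits5_list: "splits5 =
    [[2,3,4,5,6,0,1], [1,3,4,5,6,0,2], [0,3,4,5,6,1,2], [1,2,4,5,6,0,3], [0,2,4,5,6,1,3],
    [0,1,4,5,6,2,3], [1,2,3,5,6,0,4], [0,2,3,5,6,1,4], [0,1,3,5,6,2,4], [0,1,2,5,6,3,4],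
    [1,2,3,4,6,0,5], [0,2,3,4,6,1,5], [0,1,3,4,6,2,5], [0,1,2,4,6,3,5], [0,1,2,3,6,4,5],
    [1,2,3,4,5,0,6], [0,2,3,4,5,1,6], [0,1,3,4,5,2,6], [0,1,2,4,5,3,6], [0,1,2,3,5,4,6],
    [0,1,2,3,4,5,6]]"
  by code_simp

lemma splits3_list: "splits3 =
    [[0,1,2,3,4,5,6], [0,1,2,3,5,4,6], [0,1,2,3,6,4,5], [0,1,3,2,4,5,6], [0,1,3,2,5,4,6],
    [0,1,3,2,6,4,5], [0,2,3,1,4,5,6], [0,2,3,1,5,4,6], [0,2,3,1,6,4,5], [1,2,3,0,4,5,6],
    [1,2,3,0,5,4,6], [1,2,3,0,6,4,5], [0,1,4,2,3,5,6], [0,1,4,2,5,3,6], [0,1,4,2,6,3,5],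
    [0,2,4,1,3,5,6], [0,2,4,1,5,3,6], [0,2,4,1,6,3,5], [1,2,4,0,3,5,6], [1,2,4,0,5,3,6],
    [1,2,4,0,6,3,5], [0,3,4,1,2,5,6], [0,3,4,1,5,2,6], [0,3,4,1,6,2,5], [1,3,4,0,2,5,6],
    [1,3,4,0,5,2,6], [1,3,4,0,6,2,5], [2,3,4,0,1,5,6], [2,3,4,0,5,1,6], [2,3,4,0,6,1,5],
    [0,1,5,2,3,4,6], [0,1,5,2,4,3,6], [0,1,5,2,6,3,4], [0,2,5,1,3,4,6], [0,2,5,1,4,3,6],
    [0,2,5,1,6,3,4], [1,2,5,0,3,4,6], [1,2,5,0,4,3,6], [1,2,5,0,6,3,4], [0,3,5,1,2,4,6],
    [0,3,5,1,4,2,6], [0,3,5,1,6,2,4], [1,3,5,0,2,4,6], [1,3,5,0,4,2,6], [1,3,5,0,6,2,4],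
    [2,3,5,0,1,4,6], [2,3,5,0,4,1,6], [2,3,5,0,6,1,4], [0,4,5,1,2,3,6], [0,4,5,1,3,2,6],
    [0,4,5,1,6,2,3], [1,4,5,0,2,3,6], [1,4,5,0,3,2,6], [1,4,5,0,6,2,3], [2,4,5,0,1,3,6],
    [2,4,5,0,3,1,6], [2,4,5,0,6,1,3], [3,4,5,0,1,2,6], [3,4,5,0,2,1,6], [3,4,5,0,6,1,2],
    [0,1,6,2,3,4,5], [0,1,6,2,4,3,5], [0,1,6,2,5,3,4], [0,2,6,1,3,4,5], [0,2,6,1,4,3,5],
    [0,2,6,1,5,3,4], [1,2,6,0,3,4,5], [1,2,6,0,4,3,5], [1,2,6,0,5,3,4], [0,3,6,1,2,4,5],
    [0,3,6,1,4,2,5], [0,3,6,1,5,2,4], [1,3,6,0,2,4,5], [1,3,6,0,4,2,5], [1,3,6,0,5,2,4],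
    [2,3,6,0,1,4,5], [2,3,6,0,4,1,5], [2,3,6,0,5,1,4], [0,4,6,1,2,3,5], [0,4,6,1,3,2,5],
    [0,4,6,1,5,2,3], [1,4,6,0,2,3,5], [1,4,6,0,3,2,5], [1,4,6,0,5,2,3], [2,4,6,0,1,3,5],
    [2,4,6,0,3,1,5], [2,4,6,0,5,1,3], [3,4,6,0,1,2,5], [3,4,6,0,2,1,5], [3,4,6,0,5,1,2],
    [0,5,6,1,2,3,4], [0,5,6,1,3,2,4], [0,5,6,1,4,2,3], [1,5,6,0,2,3,4], [1,5,6,0,3,2,4],
    [1,5,6,0,4,2,3], [2,5,6,0,1,3,4], [2,5,6,0,3,1,4], [2,5,6,0,4,1,3], [3,5,6,0,1,2,4],
    [3,5,6,0,2,1,4], [3,5,6,0,4,1,2], [4,5,6,0,1,2,3], [4,5,6,0,2,1,3], [4,5,6,0,3,1,2]]"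
  by code_simp

lemma embeddings1_list: "embeddings1 =
    [[3,0,1,2], [4,0,1,2], [5,0,1,2], [6,0,1,2], [2,0,1,3], [4,0,1,3], [5,0,1,3], [6,0,1,3],
    [2,0,1,4], [3,0,1,4], [5,0,1,4], [6,0,1,4], [2,0,1,5], [3,0,1,5], [4,0,1,5], [6,0,1,5],
    [2,0,1,6], [3,0,1,6], [4,0,1,6], [5,0,1,6], [1,0,2,3], [4,0,2,3], [5,0,2,3], [6,0,2,3],
    [1,0,2,4], [3,0,2,4], [5,0,2,4], [6,0,2,4], [1,0,2,5], [3,0,2,5], [4,0,2,5], [6,0,2,5],
    [1,0,2,6], [3,0,2,6], [4,0,2,6], [5,0,2,6], [1,0,3,4], [2,0,3,4], [5,0,3,4], [6,0,3,4],
    [1,0,3,5], [2,0,3,5], [4,0,3,5], [6,0,3,5], [1,0,3,6], [2,0,3,6], [4,0,3,6], [5,0,3,6],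
    [1,0,4,5], [2,0,4,5], [3,0,4,5], [6,0,4,5], [1,0,4,6], [2,0,4,6], [3,0,4,6], [5,0,4,6],
    [1,0,5,6], [2,0,5,6], [3,0,5,6], [4,0,5,6], [0,1,2,3], [4,1,2,3], [5,1,2,3], [6,1,2,3],
    [0,1,2,4], [3,1,2,4], [5,1,2,4], [6,1,2,4], [0,1,2,5], [3,1,2,5], [4,1,2,5], [6,1,2,5],
    [0,1,2,6], [3,1,2,6], [4,1,2,6], [5,1,2,6], [0,1,3,4], [2,1,3,4], [5,1,3,4], [6,1,3,4],
    [0,1,3,5], [2,1,3,5], [4,1,3,5], [6,1,3,5], [0,1,3,6], [2,1,3,6], [4,1,3,6], [5,1,3,6],
    [0,1,4,5], [2,1,4,5], [3,1,4,5], [6,1,4,5], [0,1,4,6], [2,1,4,6], [3,1,4,6], [5,1,4,6],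
    [0,1,5,6], [2,1,5,6], [3,1,5,6], [4,1,5,6], [0,2,3,4], [1,2,3,4], [5,2,3,4], [6,2,3,4],
    [0,2,3,5], [1,2,3,5], [4,2,3,5], [6,2,3,5], [0,2,3,6], [1,2,3,6], [4,2,3,6], [5,2,3,6],
    [0,2,4,5], [1,2,4,5], [3,2,4,5], [6,2,4,5], [0,2,4,6], [1,2,4,6], [3,2,4,6], [5,2,4,6],
    [0,2,5,6], [1,2,5,6], [3,2,5,6], [4,2,5,6], [0,3,4,5], [1,3,4,5], [2,3,4,5], [6,3,4,5],
    [0,3,4,6], [1,3,4,6], [2,3,4,6], [5,3,4,6], [0,3,5,6], [1,3,5,6], [2,3,5,6], [4,3,5,6],
    [0,4,5,6], [1,4,5,6], [2,4,5,6], [3,4,5,6]]"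
  by code_simp

lemma embeddings2_list: "embeddings2 =
    [[0,1,2,3,4], [0,1,2,3,5], [0,1,2,3,6], [0,1,2,4,5], [0,1,2,4,6], [0,1,2,5,6], [0,1,3,4,5],
    [0,1,3,4,6], [0,1,3,5,6], [0,1,4,5,6], [0,2,1,3,4], [0,2,1,3,5], [0,2,1,3,6], [0,2,1,4,5],
    [0,2,1,4,6], [0,2,1,5,6], [0,2,3,4,5], [0,2,3,4,6], [0,2,3,5,6], [0,2,4,5,6], [0,3,1,2,4],
    [0,3,1,2,5], [0,3,1,2,6], [0,3,1,4,5], [0,3,1,4,6], [0,3,1,5,6], [0,3,2,4,5], [0,3,2,4,6],
    [0,3,2,5,6], [0,3,4,5,6], [0,4,1,2,3], [0,4,1,2,5], [0,4,1,2,6], [0,4,1,3,5], [0,4,1,3,6],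
    [0,4,1,5,6], [0,4,2,3,5], [0,4,2,3,6], [0,4,2,5,6], [0,4,3,5,6], [0,5,1,2,3], [0,5,1,2,4],
    [0,5,1,2,6], [0,5,1,3,4], [0,5,1,3,6], [0,5,1,4,6], [0,5,2,3,4], [0,5,2,3,6], [0,5,2,4,6],
    [0,5,3,4,6], [0,6,1,2,3], [0,6,1,2,4], [0,6,1,2,5], [0,6,1,3,4], [0,6,1,3,5], [0,6,1,4,5],
    [0,6,2,3,4], [0,6,2,3,5], [0,6,2,4,5], [0,6,3,4,5], [1,2,0,3,4], [1,2,0,3,5], [1,2,0,3,6],
    [1,2,0,4,5], [1,2,0,4,6], [1,2,0,5,6], [1,2,3,4,5], [1,2,3,4,6], [1,2,3,5,6], [1,2,4,5,6],
    [1,3,0,2,4], [1,3,0,2,5], [1,3,0,2,6], [1,3,0,4,5], [1,3,0,4,6], [1,3,0,5,6], [1,3,2,4,5],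
    [1,3,2,4,6], [1,3,2,5,6], [1,3,4,5,6], [1,4,0,2,3], [1,4,0,2,5], [1,4,0,2,6], [1,4,0,3,5],
    [1,4,0,3,6], [1,4,0,5,6], [1,4,2,3,5], [1,4,2,3,6], [1,4,2,5,6], [1,4,3,5,6], [1,5,0,2,3],
    [1,5,0,2,4], [1,5,0,2,6], [1,5,0,3,4], [1,5,0,3,6], [1,5,0,4,6], [1,5,2,3,4], [1,5,2,3,6],
    [1,5,2,4,6], [1,5,3,4,6], [1,6,0,2,3], [1,6,0,2,4], [1,6,0,2,5], [1,6,0,3,4], [1,6,0,3,5],
    [1,6,0,4,5], [1,6,2,3,4], [1,6,2,3,5], [1,6,2,4,5], [1,6,3,4,5], [2,3,0,1,4], [2,3,0,1,5],
    [2,3,0,1,6], [2,3,0,4,5], [2,3,0,4,6], [2,3,0,5,6], [2,3,1,4,5], [2,3,1,4,6], [2,3,1,5,6],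
    [2,3,4,5,6], [2,4,0,1,3], [2,4,0,1,5], [2,4,0,1,6], [2,4,0,3,5], [2,4,0,3,6], [2,4,0,5,6],
    [2,4,1,3,5], [2,4,1,3,6], [2,4,1,5,6], [2,4,3,5,6], [2,5,0,1,3], [2,5,0,1,4], [2,5,0,1,6],
    [2,5,0,3,4], [2,5,0,3,6], [2,5,0,4,6], [2,5,1,3,4], [2,5,1,3,6], [2,5,1,4,6], [2,5,3,4,6],
    [2,6,0,1,3], [2,6,0,1,4], [2,6,0,1,5], [2,6,0,3,4], [2,6,0,3,5], [2,6,0,4,5], [2,6,1,3,4],
    [2,6,1,3,5], [2,6,1,4,5], [2,6,3,4,5], [3,4,0,1,2], [3,4,0,1,5], [3,4,0,1,6], [3,4,0,2,5],
    [3,4,0,2,6], [3,4,0,5,6], [3,4,1,2,5], [3,4,1,2,6], [3,4,1,5,6], [3,4,2,5,6], [3,5,0,1,2],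
    [3,5,0,1,4], [3,5,0,1,6], [3,5,0,2,4], [3,5,0,2,6], [3,5,0,4,6], [3,5,1,2,4], [3,5,1,2,6],
    [3,5,1,4,6], [3,5,2,4,6], [3,6,0,1,2], [3,6,0,1,4], [3,6,0,1,5], [3,6,0,2,4], [3,6,0,2,5],
    [3,6,0,4,5], [3,6,1,2,4], [3,6,1,2,5], [3,6,1,4,5], [3,6,2,4,5], [4,5,0,1,2], [4,5,0,1,3],
    [4,5,0,1,6], [4,5,0,2,3], [4,5,0,2,6], [4,5,0,3,6], [4,5,1,2,3], [4,5,1,2,6], [4,5,1,3,6],
    [4,5,2,3,6], [4,6,0,1,2], [4,6,0,1,3], [4,6,0,1,5], [4,6,0,2,3], [4,6,0,2,5], [4,6,0,3,5],
    [4,6,1,2,3], [4,6,1,2,5], [4,6,1,3,5], [4,6,2,3,5], [5,6,0,1,2], [5,6,0,1,3], [5,6,0,1,4],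
    [5,6,0,2,3], [5,6,0,2,4], [5,6,0,3,4], [5,6,1,2,3], [5,6,1,2,4], [5,6,1,3,4], [5,6,2,3,4]]"
  by code_simp

lemma embeddings3_list: "embeddings3 =
    [[0,1,3,2,4], [0,1,3,2,5], [0,1,3,2,6], [0,1,4,2,3], [0,1,4,2,5], [0,1,4,2,6], [0,1,5,2,3],
    [0,1,5,2,4], [0,1,5,2,6], [0,1,6,2,3], [0,1,6,2,4], [0,1,6,2,5], [0,1,2,3,4], [0,1,2,3,5],
    [0,1,2,3,6], [0,1,4,3,2], [0,1,4,3,5], [0,1,4,3,6], [0,1,5,3,2], [0,1,5,3,4], [0,1,5,3,6],
    [0,1,6,3,2], [0,1,6,3,4], [0,1,6,3,5], [0,1,2,4,3], [0,1,2,4,5], [0,1,2,4,6], [0,1,3,4,2],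
    [0,1,3,4,5], [0,1,3,4,6], [0,1,5,4,2], [0,1,5,4,3], [0,1,5,4,6], [0,1,6,4,2], [0,1,6,4,3],
    [0,1,6,4,5], [0,1,2,5,3], [0,1,2,5,4], [0,1,2,5,6], [0,1,3,5,2], [0,1,3,5,4], [0,1,3,5,6],
    [0,1,4,5,2], [0,1,4,5,3], [0,1,4,5,6], [0,1,6,5,2], [0,1,6,5,3], [0,1,6,5,4], [0,1,2,6,3],
    [0,1,2,6,4], [0,1,2,6,5], [0,1,3,6,2], [0,1,3,6,4], [0,1,3,6,5], [0,1,4,6,2], [0,1,4,6,3],
    [0,1,4,6,5], [0,1,5,6,2], [0,1,5,6,3], [0,1,5,6,4], [0,2,1,3,4], [0,2,1,3,5], [0,2,1,3,6],
    [0,2,4,3,1], [0,2,4,3,5], [0,2,4,3,6], [0,2,5,3,1], [0,2,5,3,4], [0,2,5,3,6], [0,2,6,3,1],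
    [0,2,6,3,4], [0,2,6,3,5], [0,2,1,4,3], [0,2,1,4,5], [0,2,1,4,6], [0,2,3,4,1], [0,2,3,4,5],
    [0,2,3,4,6], [0,2,5,4,1], [0,2,5,4,3], [0,2,5,4,6], [0,2,6,4,1], [0,2,6,4,3], [0,2,6,4,5],
    [0,2,1,5,3], [0,2,1,5,4], [0,2,1,5,6], [0,2,3,5,1], [0,2,3,5,4], [0,2,3,5,6], [0,2,4,5,1],
    [0,2,4,5,3], [0,2,4,5,6], [0,2,6,5,1], [0,2,6,5,3], [0,2,6,5,4], [0,2,1,6,3], [0,2,1,6,4],
    [0,2,1,6,5], [0,2,3,6,1], [0,2,3,6,4], [0,2,3,6,5], [0,2,4,6,1], [0,2,4,6,3], [0,2,4,6,5],
    [0,2,5,6,1], [0,2,5,6,3], [0,2,5,6,4], [0,3,1,4,2], [0,3,1,4,5], [0,3,1,4,6], [0,3,2,4,1],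
    [0,3,2,4,5], [0,3,2,4,6], [0,3,5,4,1], [0,3,5,4,2], [0,3,5,4,6], [0,3,6,4,1], [0,3,6,4,2],
    [0,3,6,4,5], [0,3,1,5,2], [0,3,1,5,4], [0,3,1,5,6], [0,3,2,5,1], [0,3,2,5,4], [0,3,2,5,6],
    [0,3,4,5,1], [0,3,4,5,2], [0,3,4,5,6], [0,3,6,5,1], [0,3,6,5,2], [0,3,6,5,4], [0,3,1,6,2],
    [0,3,1,6,4], [0,3,1,6,5], [0,3,2,6,1], [0,3,2,6,4], [0,3,2,6,5], [0,3,4,6,1], [0,3,4,6,2],
    [0,3,4,6,5], [0,3,5,6,1], [0,3,5,6,2], [0,3,5,6,4], [0,4,1,5,2], [0,4,1,5,3], [0,4,1,5,6],
    [0,4,2,5,1], [0,4,2,5,3], [0,4,2,5,6], [0,4,3,5,1], [0,4,3,5,2], [0,4,3,5,6], [0,4,6,5,1],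
    [0,4,6,5,2], [0,4,6,5,3], [0,4,1,6,2], [0,4,1,6,3], [0,4,1,6,5], [0,4,2,6,1], [0,4,2,6,3],
    [0,4,2,6,5], [0,4,3,6,1], [0,4,3,6,2], [0,4,3,6,5], [0,4,5,6,1], [0,4,5,6,2], [0,4,5,6,3],
    [0,5,1,6,2], [0,5,1,6,3], [0,5,1,6,4], [0,5,2,6,1], [0,5,2,6,3], [0,5,2,6,4], [0,5,3,6,1],
    [0,5,3,6,2], [0,5,3,6,4], [0,5,4,6,1], [0,5,4,6,2], [0,5,4,6,3], [1,2,4,3,5], [1,2,4,3,6],
    [1,2,5,3,4], [1,2,5,3,6], [1,2,6,3,4], [1,2,6,3,5], [1,2,3,4,5], [1,2,3,4,6], [1,2,5,4,3],
    [1,2,5,4,6], [1,2,6,4,3], [1,2,6,4,5], [1,2,3,5,4], [1,2,3,5,6], [1,2,4,5,3], [1,2,4,5,6],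
    [1,2,6,5,3], [1,2,6,5,4], [1,2,3,6,4], [1,2,3,6,5], [1,2,4,6,3], [1,2,4,6,5], [1,2,5,6,3],
    [1,2,5,6,4], [1,3,2,4,5], [1,3,2,4,6], [1,3,5,4,2], [1,3,5,4,6], [1,3,6,4,2], [1,3,6,4,5],
    [1,3,2,5,4], [1,3,2,5,6], [1,3,4,5,2], [1,3,4,5,6], [1,3,6,5,2], [1,3,6,5,4], [1,3,2,6,4],
    [1,3,2,6,5], [1,3,4,6,2], [1,3,4,6,5], [1,3,5,6,2], [1,3,5,6,4], [1,4,2,5,3], [1,4,2,5,6],
    [1,4,3,5,2], [1,4,3,5,6], [1,4,6,5,2], [1,4,6,5,3], [1,4,2,6,3], [1,4,2,6,5], [1,4,3,6,2],
    [1,4,3,6,5], [1,4,5,6,2], [1,4,5,6,3], [1,5,2,6,3], [1,5,2,6,4], [1,5,3,6,2], [1,5,3,6,4],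
    [1,5,4,6,2], [1,5,4,6,3], [2,3,5,4,6], [2,3,6,4,5], [2,3,4,5,6], [2,3,6,5,4], [2,3,4,6,5],
    [2,3,5,6,4], [2,4,3,5,6], [2,4,6,5,3], [2,4,3,6,5], [2,4,5,6,3], [2,5,3,6,4], [2,5,4,6,3]]"
  by code_simp

lemma involutions4_list: "involutions 4 =
    [[0,1,2,3,4,5,6], [0,1,3,2,4,5,6], [0,2,1,3,4,5,6], [0,3,2,1,4,5,6], [1,0,2,3,4,5,6],
    [1,0,3,2,4,5,6], [2,1,0,3,4,5,6], [2,3,0,1,4,5,6], [3,1,2,0,4,5,6], [3,2,1,0,4,5,6]]"
  by code_simp

lemma involutions5_list: "involutions 5 =
    [[0,1,2,3,4,5,6], [0,1,2,4,3,5,6], [0,1,3,2,4,5,6], [0,1,4,3,2,5,6], [0,2,1,3,4,5,6],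
    [0,2,1,4,3,5,6], [0,3,2,1,4,5,6], [0,3,4,1,2,5,6], [0,4,2,3,1,5,6], [0,4,3,2,1,5,6],
    [1,0,2,3,4,5,6], [1,0,2,4,3,5,6], [1,0,3,2,4,5,6], [1,0,4,3,2,5,6], [2,1,0,3,4,5,6],
    [2,1,0,4,3,5,6], [2,3,0,1,4,5,6], [2,4,0,3,1,5,6], [3,1,2,0,4,5,6], [3,1,4,0,2,5,6],
    [3,2,1,0,4,5,6], [3,4,2,0,1,5,6], [4,1,2,3,0,5,6], [4,1,3,2,0,5,6], [4,2,1,3,0,5,6],
    [4,3,2,1,0,5,6]]"
  by code_simp

lemma involutions6_list: "involutions 6 =
    [[0,1,2,3,4,5,6], [0,1,2,3,5,4,6], [0,1,2,4,3,5,6], [0,1,2,5,4,3,6], [0,1,3,2,4,5,6],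
    [0,1,3,2,5,4,6], [0,1,4,3,2,5,6], [0,1,4,5,2,3,6], [0,1,5,3,4,2,6], [0,1,5,4,3,2,6],
    [0,2,1,3,4,5,6], [0,2,1,3,5,4,6], [0,2,1,4,3,5,6], [0,2,1,5,4,3,6], [0,3,2,1,4,5,6],
    [0,3,2,1,5,4,6], [0,3,4,1,2,5,6], [0,3,5,1,4,2,6], [0,4,2,3,1,5,6], [0,4,2,5,1,3,6],
    [0,4,3,2,1,5,6], [0,4,5,3,1,2,6], [0,5,2,3,4,1,6], [0,5,2,4,3,1,6], [0,5,3,2,4,1,6],
    [0,5,4,3,2,1,6], [1,0,2,3,4,5,6], [1,0,2,3,5,4,6], [1,0,2,4,3,5,6], [1,0,2,5,4,3,6],
    [1,0,3,2,4,5,6], [1,0,3,2,5,4,6], [1,0,4,3,2,5,6], [1,0,4,5,2,3,6], [1,0,5,3,4,2,6],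
    [1,0,5,4,3,2,6], [2,1,0,3,4,5,6], [2,1,0,3,5,4,6], [2,1,0,4,3,5,6], [2,1,0,5,4,3,6],
    [2,3,0,1,4,5,6], [2,3,0,1,5,4,6], [2,4,0,3,1,5,6], [2,4,0,5,1,3,6], [2,5,0,3,4,1,6],
    [2,5,0,4,3,1,6], [3,1,2,0,4,5,6], [3,1,2,0,5,4,6], [3,1,4,0,2,5,6], [3,1,5,0,4,2,6],
    [3,2,1,0,4,5,6], [3,2,1,0,5,4,6], [3,4,2,0,1,5,6], [3,4,5,0,1,2,6], [3,5,2,0,4,1,6],
    [3,5,4,0,2,1,6], [4,1,2,3,0,5,6], [4,1,2,5,0,3,6], [4,1,3,2,0,5,6], [4,1,5,3,0,2,6],
    [4,2,1,3,0,5,6], [4,2,1,5,0,3,6], [4,3,2,1,0,5,6], [4,3,5,1,0,2,6], [4,5,2,3,0,1,6],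
    [4,5,3,2,0,1,6], [5,1,2,3,4,0,6], [5,1,2,4,3,0,6], [5,1,3,2,4,0,6], [5,1,4,3,2,0,6],
    [5,2,1,3,4,0,6], [5,2,1,4,3,0,6], [5,3,2,1,4,0,6], [5,3,4,1,2,0,6], [5,4,2,3,1,0,6],
    [5,4,3,2,1,0,6]]"
  by code_simp

lemma involutions7_list: "involutions 7 =
    [[0,1,2,3,4,5,6], [0,1,2,3,4,6,5], [0,1,2,3,5,4,6], [0,1,2,3,6,5,4], [0,1,2,4,3,5,6],
    [0,1,2,4,3,6,5], [0,1,2,5,4,3,6], [0,1,2,5,6,3,4], [0,1,2,6,4,5,3], [0,1,2,6,5,4,3],
    [0,1,3,2,4,5,6], [0,1,3,2,4,6,5], [0,1,3,2,5,4,6], [0,1,3,2,6,5,4], [0,1,4,3,2,5,6],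
    [0,1,4,3,2,6,5], [0,1,4,5,2,3,6], [0,1,4,6,2,5,3], [0,1,5,3,4,2,6], [0,1,5,3,6,2,4],
    [0,1,5,4,3,2,6], [0,1,5,6,4,2,3], [0,1,6,3,4,5,2], [0,1,6,3,5,4,2], [0,1,6,4,3,5,2],
    [0,1,6,5,4,3,2], [0,2,1,3,4,5,6], [0,2,1,3,4,6,5], [0,2,1,3,5,4,6], [0,2,1,3,6,5,4],
    [0,2,1,4,3,5,6], [0,2,1,4,3,6,5], [0,2,1,5,4,3,6], [0,2,1,5,6,3,4], [0,2,1,6,4,5,3],
    [0,2,1,6,5,4,3], [0,3,2,1,4,5,6], [0,3,2,1,4,6,5], [0,3,2,1,5,4,6], [0,3,2,1,6,5,4],
    [0,3,4,1,2,5,6], [0,3,4,1,2,6,5], [0,3,5,1,4,2,6], [0,3,5,1,6,2,4], [0,3,6,1,4,5,2],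
    [0,3,6,1,5,4,2], [0,4,2,3,1,5,6], [0,4,2,3,1,6,5], [0,4,2,5,1,3,6], [0,4,2,6,1,5,3],
    [0,4,3,2,1,5,6], [0,4,3,2,1,6,5], [0,4,5,3,1,2,6], [0,4,5,6,1,2,3], [0,4,6,3,1,5,2],
    [0,4,6,5,1,3,2], [0,5,2,3,4,1,6], [0,5,2,3,6,1,4], [0,5,2,4,3,1,6], [0,5,2,6,4,1,3],
    [0,5,3,2,4,1,6], [0,5,3,2,6,1,4], [0,5,4,3,2,1,6], [0,5,4,6,2,1,3], [0,5,6,3,4,1,2],
    [0,5,6,4,3,1,2], [0,6,2,3,4,5,1], [0,6,2,3,5,4,1], [0,6,2,4,3,5,1], [0,6,2,5,4,3,1],
    [0,6,3,2,4,5,1], [0,6,3,2,5,4,1], [0,6,4,3,2,5,1], [0,6,4,5,2,3,1], [0,6,5,3,4,2,1],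
    [0,6,5,4,3,2,1], [1,0,2,3,4,5,6], [1,0,2,3,4,6,5], [1,0,2,3,5,4,6], [1,0,2,3,6,5,4],
    [1,0,2,4,3,5,6], [1,0,2,4,3,6,5], [1,0,2,5,4,3,6], [1,0,2,5,6,3,4], [1,0,2,6,4,5,3],
    [1,0,2,6,5,4,3], [1,0,3,2,4,5,6], [1,0,3,2,4,6,5], [1,0,3,2,5,4,6], [1,0,3,2,6,5,4],
    [1,0,4,3,2,5,6], [1,0,4,3,2,6,5], [1,0,4,5,2,3,6], [1,0,4,6,2,5,3], [1,0,5,3,4,2,6],
    [1,0,5,3,6,2,4], [1,0,5,4,3,2,6], [1,0,5,6,4,2,3], [1,0,6,3,4,5,2], [1,0,6,3,5,4,2],
    [1,0,6,4,3,5,2], [1,0,6,5,4,3,2], [2,1,0,3,4,5,6], [2,1,0,3,4,6,5], [2,1,0,3,5,4,6],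
    [2,1,0,3,6,5,4], [2,1,0,4,3,5,6], [2,1,0,4,3,6,5], [2,1,0,5,4,3,6], [2,1,0,5,6,3,4],
    [2,1,0,6,4,5,3], [2,1,0,6,5,4,3], [2,3,0,1,4,5,6], [2,3,0,1,4,6,5], [2,3,0,1,5,4,6],
    [2,3,0,1,6,5,4], [2,4,0,3,1,5,6], [2,4,0,3,1,6,5], [2,4,0,5,1,3,6], [2,4,0,6,1,5,3],
    [2,5,0,3,4,1,6], [2,5,0,3,6,1,4], [2,5,0,4,3,1,6], [2,5,0,6,4,1,3], [2,6,0,3,4,5,1],
    [2,6,0,3,5,4,1], [2,6,0,4,3,5,1], [2,6,0,5,4,3,1], [3,1,2,0,4,5,6], [3,1,2,0,4,6,5],
    [3,1,2,0,5,4,6], [3,1,2,0,6,5,4], [3,1,4,0,2,5,6], [3,1,4,0,2,6,5], [3,1,5,0,4,2,6],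
    [3,1,5,0,6,2,4], [3,1,6,0,4,5,2], [3,1,6,0,5,4,2], [3,2,1,0,4,5,6], [3,2,1,0,4,6,5],
    [3,2,1,0,5,4,6], [3,2,1,0,6,5,4], [3,4,2,0,1,5,6], [3,4,2,0,1,6,5], [3,4,5,0,1,2,6],
    [3,4,6,0,1,5,2], [3,5,2,0,4,1,6], [3,5,2,0,6,1,4], [3,5,4,0,2,1,6], [3,5,6,0,4,1,2],
    [3,6,2,0,4,5,1], [3,6,2,0,5,4,1], [3,6,4,0,2,5,1], [3,6,5,0,4,2,1], [4,1,2,3,0,5,6],
    [4,1,2,3,0,6,5], [4,1,2,5,0,3,6], [4,1,2,6,0,5,3], [4,1,3,2,0,5,6], [4,1,3,2,0,6,5],
    [4,1,5,3,0,2,6], [4,1,5,6,0,2,3], [4,1,6,3,0,5,2], [4,1,6,5,0,3,2], [4,2,1,3,0,5,6],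
    [4,2,1,3,0,6,5], [4,2,1,5,0,3,6], [4,2,1,6,0,5,3], [4,3,2,1,0,5,6], [4,3,2,1,0,6,5],
    [4,3,5,1,0,2,6], [4,3,6,1,0,5,2], [4,5,2,3,0,1,6], [4,5,2,6,0,1,3], [4,5,3,2,0,1,6],
    [4,5,6,3,0,1,2], [4,6,2,3,0,5,1], [4,6,2,5,0,3,1], [4,6,3,2,0,5,1], [4,6,5,3,0,2,1],
    [5,1,2,3,4,0,6], [5,1,2,3,6,0,4], [5,1,2,4,3,0,6], [5,1,2,6,4,0,3], [5,1,3,2,4,0,6],
    [5,1,3,2,6,0,4], [5,1,4,3,2,0,6], [5,1,4,6,2,0,3], [5,1,6,3,4,0,2], [5,1,6,4,3,0,2],
    [5,2,1,3,4,0,6], [5,2,1,3,6,0,4], [5,2,1,4,3,0,6], [5,2,1,6,4,0,3], [5,3,2,1,4,0,6],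
    [5,3,2,1,6,0,4], [5,3,4,1,2,0,6], [5,3,6,1,4,0,2], [5,4,2,3,1,0,6], [5,4,2,6,1,0,3],
    [5,4,3,2,1,0,6], [5,4,6,3,1,0,2], [5,6,2,3,4,0,1], [5,6,2,4,3,0,1], [5,6,3,2,4,0,1],
    [5,6,4,3,2,0,1], [6,1,2,3,4,5,0], [6,1,2,3,5,4,0], [6,1,2,4,3,5,0], [6,1,2,5,4,3,0],
    [6,1,3,2,4,5,0], [6,1,3,2,5,4,0], [6,1,4,3,2,5,0], [6,1,4,5,2,3,0], [6,1,5,3,4,2,0],
    [6,1,5,4,3,2,0], [6,2,1,3,4,5,0], [6,2,1,3,5,4,0], [6,2,1,4,3,5,0], [6,2,1,5,4,3,0],
    [6,3,2,1,4,5,0], [6,3,2,1,5,4,0], [6,3,4,1,2,5,0], [6,3,5,1,4,2,0], [6,4,2,3,1,5,0],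
    [6,4,2,5,1,3,0], [6,4,3,2,1,5,0], [6,4,5,3,1,2,0], [6,5,2,3,4,1,0], [6,5,2,4,3,1,0],
    [6,5,3,2,4,1,0], [6,5,4,3,2,1,0]]"
  by code_simp

lemma fold_literal: "fold f [] s = s" "fold f (x # xs) s = fold f xs (f x s)"
  by simp_all

lemmas copies_list = copies_def[simplified placements_def embeddings1_list embeddings2_list embeddings3_list
  F1_triples_def F2_triples_def F3_triples_def list.map append_Nil append_Cons prod.case nth_literal pos3_literal]
lemmas tops_list = tops_def[simplified copies_list list.map fold_literal max_def rel_simps if_True if_False]

text \<open>A conditional that is strict in its last argument, so that filtering a literal list takes linear time.\<close>

definition keep_if :: "bool \<Rightarrow> 'a \<Rightarrow> 'a list \<Rightarrow> 'a list" where
  "keep_if b x ys = (if b then x # ys else ys)"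

lemma filter_literal: "filter P [] = []" "filter P (x # xs) = keep_if (P x) x (filter P xs)"
  "keep_if True x ys = x # ys" "keep_if False x ys = ys"
  by (simp_all add: keep_if_def)

fun closing_laws :: "nat list \<Rightarrow> bool" where
  "closing_laws [] = True"
| "closing_laws (n # ns) = (closing n = map (\<lambda>(x, cp). filter (\<lambda>t. t \<noteq> n) cp) (filter (\<lambda>(x, cp). x = n) tops) \<and> closing_laws ns)"

lemma closing_laws: "closing_laws ns"
  by (induction ns) (simp_all add: closing_def)

lemmas closing_list = closing_laws[of "[0, 1, 2, 3, 4, 5, 6, 7, 8, 9, 10, 11, 12, 13, 14, 15, 16, 17, 18, 19, 20, 21, 22, 23, 24, 25,
    26, 27, 28, 29, 30, 31, 32, 33, 34]", simplified closing_laws.simps tops_list filter_literal list.map prod.case rel_simps simp_thms]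

lemma pred_literal: "2 - 1 = (1 :: nat)" "1 - 1 = (0 :: nat)"
  by simp_all

fun closes_laws :: "nat \<Rightarrow> bool list \<Rightarrow> bool" where
  "closes_laws n [] = True"
| "closes_laws n (b # bs) = (closes n bs = ors (map (\<lambda>cp. ands (map (look bs) cp)) (closing n)) \<and> closes_laws (n - 1) bs)"

lemma closes_laws: "closes_laws n bs"
  by (induction n bs rule: closes_laws.induct) (simp_all add: closes_def)

lemmas closes_literal = closes_laws[of 34 "[b34, b33, b32, b31, b30, b29, b28, b27, b26, b25, b24, b23, b22, b21, b20, b19, b18, b17, b16, b15, b14, b13, b12, b11, b10, b9, b8, b7, b6, b5, b4, b3, b2, b1, b0]", simplified, simplified Suc_literal pred_literal closing_list list.map look_literal ors.simps ands.simps]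
  for b34 b33 b32 b31 b30 b29 b28 b27 b26 b25 b24 b23 b22 b21 b20 b19 b18 b17 b16 b15 b14 b13 b12 b11 b10 b9 b8 b7 b6 b5 b4 b3 b2 b1 b0

fun nth_laws :: "'a list \<Rightarrow> nat \<Rightarrow> 'a list \<Rightarrow> bool" where
  "nth_laws xs t [] = True"
| "nth_laws xs t (y # ys) = (xs ! t = y \<and> nth_laws xs (t + 1) ys)"

lemma nth_lawsI: "xs = us @ ys \<Longrightarrow> nth_laws xs (length us) ys"
proof (induction ys arbitrary: us)
  case (Cons y ys)
  then show ?case using Cons.IH[of "us @ [y]"] by (simp add: Suc_eq_plus1)
qed simp

lemma nth_laws_self: "xs = ys \<Longrightarrow> nth_laws xs 0 ys"
  using nth_lawsI[of xs "[]" ys] by simp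

lemmas triples_nth = nth_laws_self[OF triples_list, simplified]

text \<open>Each test is specialised to the list of bits, so that a comparison of two prefixes costs one step
  for each position up to the first difference.\<close>

fun improves_laws :: "nat \<Rightarrow> nat \<Rightarrow> (nat \<times> nat list) list \<Rightarrow> bool list \<Rightarrow> bool" where
  "improves_laws c i [] bs = conj_list []"
| "improves_laws c i ((m, s) # ts) bs =
     (improves c i bs = gtl (map (\<lambda>t. look bs (case triples ! t of (i, j, k) \<Rightarrow> pos3 (s ! i) (s ! j) (s ! k))) [0..<m]) (map (look bs) [0..<m])
      \<and> improves_laws c (i + 1) ts bs)"

lemma improves_lawsI: "tests c = us @ ts \<Longrightarrow> improves_laws c (length us) ts bs"
proof (induction ts arbitrary: us)
  case (Cons x ts)
  obtain m s where x: "x = (m, s)" by (cases x)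
  have "tests c ! length us = (m, s)" using Cons.prems x by simp
  then show ?case using Cons.IH[of "us @ [x]"] Cons.prems by (simp add: x improves_def moved_def Suc_eq_plus1)
qed (simp add: conj_list_Nil)

lemmas tests_list =
  tests_simps(1-4)[unfolded involutions4_list involutions5_list involutions6_list involutions7_list list.map]
  tests_simps(5-8)

lemmas improves_of_tests = improves_lawsI[where us = "[]", simplified append_Nil list.size]

lemma upt_lists:
  "[0..<1] = [0]"
  "[0..<4] = [0, 1, 2, 3]"
  "[0..<10] = [0, 1, 2, 3, 4, 5, 6, 7, 8, 9]"
  "[0..<20] = [0, 1, 2, 3, 4, 5, 6, 7, 8, 9, 10, 11, 12, 13, 14, 15, 16, 17, 18, 19]"
  "[0..<35] = [0, 1, 2, 3, 4, 5, 6, 7, 8, 9, 10, 11, 12, 13, 14, 15, 16, 17, 18, 19, 20, 21, 22, 23, 24, 25,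
    26, 27, 28, 29, 30, 31, 32, 33, 34]"
  by code_simp+

lemmas improves4 = improves_of_tests[OF tests_list(1), of "[b3, b2, b1, b0]", simplified improves_laws.simps list.size numeral_plus_one add_num_simps one_add_one add_0_left add_0_right conj_list_Cons,
  simplified upt_lists list.map triples_nth prod.case nth_literal pos3_literal look_literal, unfolded balance]
  for b3 b2 b1 b0
lemmas improves10 = improves_of_tests[OF tests_list(2), of "[b9, b8, b7, b6, b5, b4, b3, b2, b1, b0]", simplified improves_laws.simps list.size numeral_plus_one add_num_simps one_add_one add_0_left add_0_right conj_list_Cons,
  simplified upt_lists list.map triples_nth prod.case nth_literal pos3_literal look_literal, unfolded balance]
  for b9 b8 b7 b6 b5 b4 b3 b2 b1 b0
lemmas improves20 = improves_of_tests[OF tests_list(3), of "[b19, b18, b17, b16, b15, b14, b13, b12, b11, b10, b9, b8, b7, b6, b5, b4, b3, b2, b1, b0]", simplified improves_laws.simps list.size numeral_plus_one add_num_simps one_add_one add_0_left add_0_right conj_list_Cons,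
  simplified upt_lists list.map triples_nth prod.case nth_literal pos3_literal look_literal, unfolded balance]
  for b19 b18 b17 b16 b15 b14 b13 b12 b11 b10 b9 b8 b7 b6 b5 b4 b3 b2 b1 b0
lemmas improves35 = improves_of_tests[OF tests_list(4), of "[b34, b33, b32, b31, b30, b29, b28, b27, b26, b25, b24, b23, b22, b21, b20, b19, b18, b17, b16, b15, b14, b13, b12, b11, b10, b9, b8, b7, b6, b5, b4, b3, b2, b1, b0]", simplified improves_laws.simps list.size numeral_plus_one add_num_simps one_add_one add_0_left add_0_right conj_list_Cons,
  simplified upt_lists list.map triples_nth prod.case nth_literal pos3_literal look_literal, unfolded balance]
  for b34 b33 b32 b31 b30 b29 b28 b27 b26 b25 b24 b23 b22 b21 b20 b19 b18 b17 b16 b15 b14 b13 b12 b11 b10 b9 b8 b7 b6 b5 b4 b3 b2 b1 b0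
lemmas improves21 = improves_of_tests[OF tests_list(5), of "[b20, b19, b18, b17, b16, b15, b14, b13, b12, b11, b10, b9, b8, b7, b6, b5, b4, b3, b2, b1, b0]", simplified improves_laws.simps list.size numeral_plus_one add_num_simps one_add_one add_0_left add_0_right conj_list_Cons,
  simplified upt_lists list.map triples_nth prod.case nth_literal pos3_literal look_literal, unfolded balance]
  for b20 b19 b18 b17 b16 b15 b14 b13 b12 b11 b10 b9 b8 b7 b6 b5 b4 b3 b2 b1 b0
lemmas improves23 = improves_of_tests[OF tests_list(6), of "[b22, b21, b20, b19, b18, b17, b16, b15, b14, b13, b12, b11, b10, b9, b8, b7, b6, b5, b4, b3, b2, b1, b0]", simplified improves_laws.simps list.size numeral_plus_one add_num_simps one_add_one add_0_left add_0_right conj_list_Cons,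
  simplified upt_lists list.map triples_nth prod.case nth_literal pos3_literal look_literal, unfolded balance]
  for b22 b21 b20 b19 b18 b17 b16 b15 b14 b13 b12 b11 b10 b9 b8 b7 b6 b5 b4 b3 b2 b1 b0
lemmas improves26 = improves_of_tests[OF tests_list(7), of "[b25, b24, b23, b22, b21, b20, b19, b18, b17, b16, b15, b14, b13, b12, b11, b10, b9, b8, b7, b6, b5, b4, b3, b2, b1, b0]", simplified improves_laws.simps list.size numeral_plus_one add_num_simps one_add_one add_0_left add_0_right conj_list_Cons,
  simplified upt_lists list.map triples_nth prod.case nth_literal pos3_literal look_literal, unfolded balance]
  for b25 b24 b23 b22 b21 b20 b19 b18 b17 b16 b15 b14 b13 b12 b11 b10 b9 b8 b7 b6 b5 b4 b3 b2 b1 b0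
lemmas improves30 = improves_of_tests[OF tests_list(8), of "[b29, b28, b27, b26, b25, b24, b23, b22, b21, b20, b19, b18, b17, b16, b15, b14, b13, b12, b11, b10, b9, b8, b7, b6, b5, b4, b3, b2, b1, b0]", simplified improves_laws.simps list.size numeral_plus_one add_num_simps one_add_one add_0_left add_0_right conj_list_Cons,
  simplified upt_lists list.map triples_nth prod.case nth_literal pos3_literal look_literal, unfolded balance]
  for b29 b28 b27 b26 b25 b24 b23 b22 b21 b20 b19 b18 b17 b16 b15 b14 b13 b12 b11 b10 b9 b8 b7 b6 b5 b4 b3 b2 b1 b0

definition leaf :: "bool list \<Rightarrow> int" where
  "leaf bs = total (pattern_at bs)"

text \<open>The quantity to be bounded, as an explicit sum over 21 labelled five-element sets and 105 pairs of
  flags on three labelled vertices.\<close>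

lemmas leaf_literal = leaf_def[of "[b34, b33, b32, b31, b30, b29, b28, b27, b26, b25, b24, b23, b22, b21, b20, b19, b18, b17, b16, b15, b14, b13, b12, b11, b10, b9, b8, b7, b6, b5, b4, b3, b2, b1, b0]",
    simplified total_def part3_def splits5_list splits3_list list.map sum_list.Cons sum_list.Nil root5_def link5_def flag3_def
    form3_def relab_def nth_literal pattern_at_def pos3_literal look_literal]
  for b34 b33 b32 b31 b30 b29 b28 b27 b26 b25 b24 b23 b22 b21 b20 b19 b18 b17 b16 b15 b14 b13 b12 b11 b10 b9 b8 b7 b6 b5 b4 b3 b2 b1 b0

lemmas bad_literal = bad_def[of "[b34, b33, b32, b31, b30, b29, b28, b27, b26, b25, b24, b23, b22, b21, b20, b19, b18, b17, b16, b15, b14, b13, b12, b11, b10, b9, b8, b7, b6, b5, b4, b3, b2, b1, b0]",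
    simplified F4_triples_def F5_triples_def list.map prod.case nth_literal pattern_at_def pos3_literal look_literal ors.simps ands.simps]
  for b34 b33 b32 b31 b30 b29 b28 b27 b26 b25 b24 b23 b22 b21 b20 b19 b18 b17 b16 b15 b14 b13 b12 b11 b10 b9 b8 b7 b6 b5 b4 b3 b2 b1 b0

section \<open>The evaluation and the density bound\<close>

definition steps_a :: "step list" where
  "steps_a = map Bit [0..<4] @ map (Test 4) [0..<10] @ map Bit [4..<10] @ map (Test 10) [0..<26]"

definition steps_b :: "step list" where
  "steps_b = map Bit [10..<20] @ map (Test 20) [0..<76] @ [Bit 20, Test 21 0, Bit 21, Bit 22, Test 23 0,
     Bit 23, Bit 24, Bit 25, Test 26 0, Bit 26, Bit 27, Bit 28, Bit 29, Test 30 0]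
     @ map Bit [30..<35] @ map (Test 35) [0..<232]"

definition steps :: "step list" where
  "steps = steps_a @ Skip # steps_b"

lemma wf_steps: "wf_steps 0 steps"
  by code_simp

text \<open>The position in the list of steps is represented by a number; otherwise each rewriting step would
  have to traverse the remaining list.\<close>

definition srch :: "nat \<Rightarrow> bool list \<Rightarrow> bool" where
  "srch k bs = search (drop k steps) bs"

fun step_laws :: "nat \<Rightarrow> step list \<Rightarrow> bool list \<Rightarrow> bool" where
  "step_laws k [] bs = True"
| "step_laws k (Bit n # ss) bs = (srch k bs = sand (srch (k + 1) (False # bs)) (sor (closes n bs) (srch (k + 1) (True # bs)))
     \<and> step_laws (k + 1) ss bs)"
| "step_laws k (Test c i # ss) bs = (srch k bs = sor (improves c i bs) (srch (k + 1) bs) \<and> step_laws (k + 1) ss bs)"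
| "step_laws k (Skip # ss) bs = step_laws (k + 1) ss bs"

lemma step_lawsI: "drop k steps = ss @ rest \<Longrightarrow> step_laws k ss bs"
proof (induction ss arbitrary: k)
  case (Cons s ss)
  have tail: "drop (k + 1) steps = tl (drop k steps)"
    by (simp only: drop_Suc tl_drop Suc_eq_plus1[symmetric])
  then have "step_laws (k + 1) ss bs" using Cons by simp
  then show ?case using Cons.prems tail by (cases s) (simp_all add: srch_def)
qed simp

lemma drop_steps: "drop 0 steps = steps_a @ Skip # steps_b" "drop 47 steps = steps_b @ []" "drop 46 steps = Skip # drop 47 steps"
  "drop 384 steps = []"
proof -
  have a: "length steps_a = 46" by (simp add: steps_a_def)
  have b: "length steps_b = 337" by (simp add: steps_b_def)
  have "drop (Suc 46) steps = steps_b" "drop 46 steps = Skip # steps_b" by (simp_all add: steps_def a)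
  then show "drop 47 steps = steps_b @ []" "drop 46 steps = Skip # drop 47 steps" by simp_all
  show "drop 0 steps = steps_a @ Skip # steps_b" by (simp add: steps_def)
  show "drop 384 steps = []" by (simp add: steps_def a b)
qed

declare upt_literal [simp] Suc_literal [simp]

lemmas laws_a = step_lawsI[OF drop_steps(1), unfolded steps_a_def, simplified]
lemmas laws_b = step_lawsI[OF drop_steps(2), unfolded steps_b_def, simplified]

declare upt_literal [simp del] Suc_literal [simp del]

lemma laws_end: "srch 384 bs = sor (bad bs) (leaf bs \<le> 87988477)"
  by (simp add: srch_def drop_steps leaf_def)

lemma laws_skip: "srch 46 bs = srch 47 bs"
  by (simp add: srch_def drop_steps)

lemma conj_True: "(True \<and> P) = P"
  by simp

text \<open>These trivial congruence rules keep the rewriting away from arguments that are already in normal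
  form.\<close>

lemma opaque_congs:
  "srch k bs = srch k bs" "closes n bs = closes n bs" "improves c i bs = improves c i bs" "bad bs = bad bs"
  "leaf bs = leaf bs" "total5 r l m = total5 r l m" "key b l = key b l" "gtl u v = gtl u v"
  by (rule refl)+

lemmas prune_literal = closes_literal improves4 improves10 improves20 improves21 improves23 improves26
  improves30 improves35 gtl_rules sor_rules

lemmas leaf_rules = laws_end bad_literal leaf_literal total5_literal
  keys0 keys1 keys2 keys3 keys4 keys5 keys6 keys7 keys8 keys9 keys10 keys11
  grams0 grams1 grams2 grams3 grams4 grams5 grams6 grams7 grams8 grams9 grams10 grams11
  gram_minus of_bool_eq arith_simps arith_special Num.inc.simps rel_simps mult_literal add_literal numeral_plus_one one_plus_numeral one_add_one

text \<open>The search is cut into parts below the hypergraphs on the first five vertices. Up to relabelling nine hypergraphs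
  on five vertices survive the first ten triples.\<close>

lemma search_19: "srch 47 [False, False, False, False, False, True, False, False, True, True]"
  by (simp only: laws_b prune_literal leaf_rules conj_True cong: sor_cong sand_cong opaque_congs)

lemma search_291: "srch 47 [False, True, False, False, True, False, False, False, True, True]"
  by (simp only: laws_b prune_literal leaf_rules conj_True cong: sor_cong sand_cong opaque_congs)

lemma search_35: "srch 47 [False, False, False, False, True, False, False, False, True, True]
    \<and> srch 47 [False, False, True, False, True, False, False, False, True, True]
    \<and> srch 47 [True, False, False, False, False, False, False, False, True, True]
    \<and> srch 47 [False, False, False, False, False, False, False, False, True, True]
    \<and> srch 47 [False, False, True, False, False, False, False, False, False, True]
    \<and> srch 47 [False, False, False, False, False, False, False, False, False, True]
    \<and> srch 47 [False, False, False, False, False, False, False, False, False, False]"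
  by (simp only: laws_b prune_literal leaf_rules conj_True cong: sor_cong sand_cong opaque_congs)

lemma search_steps: "search steps []"
proof -
  have "srch 0 []"
    by (simp only: laws_a laws_skip prune_literal search_19 search_291 search_35 cong: sor_cong sand_cong opaque_congs)
  then show ?thesis by (simp add: srch_def)
qed

declare Suc_1 [simp] Suc_numeral [simp]
declare One_nat_def [simp]

lemma hom_free_relab:
  assumes "hom_free p"
  shows "hom_free (relab p xs)"
  unfolding hom_free_def relab_def
proof (intro ballI allI)
  fix F and \<phi> :: "nat \<Rightarrow> nat"
  assume F: "F \<in> {F1_triples, F2_triples, F3_triples, F4_triples, F5_triples}"
  show "\<exists>(i, j, k)\<in>set F. \<not> p (xs ! \<phi> i) (xs ! \<phi> j) (xs ! \<phi> k)"
    using bspec[OF assms[unfolded hom_free_def] F, THEN spec, of "\<lambda>i. xs ! \<phi> i"] .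
qed

text \<open>The constant is 48 times 87988477, and 0.2299 times 5040 times 3645000 is slightly larger than it.\<close>

lemma symmetrised_le:
  assumes "symmetric p" "hom_free p"
  shows "symmetrised p \<le> 4223446896"
proof -
  obtain xs where xs: "xs \<in> perms7" "leading (relab p xs)" using ex_leading by blast
  have "search steps (rbits (relab p xs) 0)" using search_steps by (simp add: rbits_def)
  then have "total (relab p xs) \<le> 87988477"
    by (rule search_sound[OF _ wf_steps symmetric_relab[OF assms(1)] hom_free_relab[OF assms(2)] xs(2)])
  moreover have "symmetrised p = 48 * total (relab p xs)"
    using symmetrised_relab[OF xs(1), of p] symmetrised_eq_total[OF symmetric_relab[OF assms(1), of xs]] by simp
  ultimately show ?thesis by simp
qed

lemma covers_pairs_F_family: "F \<in> F_family \<Longrightarrow> covers_pairs F"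
proof -
  have s: "{1..4} = {1, 2, 3, 4 :: nat}" "{1..5} = {1, 2, 3, 4, 5 :: nat}" "{1..7} = {1, 2, 3, 4, 5, 6, 7 :: nat}"
    unfolding set_eq_iff atLeastAtMost_iff insert_iff empty_iff by presburger+
  have "covers_pairs F1" "covers_pairs F2" "covers_pairs F3" "covers_pairs F4" "covers_pairs F5"
    unfolding covers_pairs_def F1_def F2_def F3_def F4_def F5_def fst_conv snd_conv s by simp_all
  then show "F \<in> F_family \<Longrightarrow> covers_pairs F" by (auto simp: F_family_def)
qed

text \<open>Any two vertices of a member of the family lie in a common edge, so the absence of copies excludes
  homomorphic images as well.\<close>

lemma hom_free_pattern:
  assumes "three_graph H" "free F_family H"
  shows "hom_free (pattern_of (edges H) x)"
  unfolding hom_free_def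
proof (intro ballI allI)
  fix F and \<phi> :: "nat \<Rightarrow> nat"
  assume F: "F \<in> {F1_triples, F2_triples, F3_triples, F4_triples, F5_triples}"
  have ex: "\<exists>e\<in>edges G. (\<lambda>v. x ! \<phi> (v - 1)) ` e \<notin> edges H" if "G \<in> F_family" for G
    by (rule free_no_homomorphism[OF assms(2,1) that three_graph_F_family[OF that] covers_pairs_F_family[OF that]])
  have "F1 \<in> F_family" "F2 \<in> F_family" "F3 \<in> F_family" "F4 \<in> F_family" "F5 \<in> F_family"
    by (simp_all add: F_family_def)
  note e = this[THEN ex]
  from F consider "F = F1_triples" | "F = F2_triples" | "F = F3_triples" | "F = F4_triples" | "F = F5_triples"
    by blast
  then show "\<exists>(i, j, k)\<in>set F. \<not> pattern_of (edges H) x (\<phi> i) (\<phi> j) (\<phi> k)"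
  proof cases
    case 1 then show ?thesis using e(1) by (simp add: F1_def F1_triples_def pattern_of_def)
  next
    case 2 then show ?thesis using e(2) by (simp add: F2_def F2_triples_def pattern_of_def)
  next
    case 3 then show ?thesis using e(3) by (simp add: F3_def F3_triples_def pattern_of_def)
  next
    case 4 then show ?thesis using e(4) by (simp add: F4_def F4_triples_def pattern_of_def)
  next
    case 5 then show ?thesis using e(5) by (simp add: F5_def F5_triples_def pattern_of_def)
  qed
qed

text \<open>The average over all seven-tuples of vertices compares the number of edges with the largest total
  of a pattern.\<close>

lemma edges_bound:
  assumes H: "three_graph H" "free F_family H"
  shows "6 * real (card (edges H)) \<le> 0.2299 * real (card (verts H)) ^ 3"
proof (cases "card (verts H) = 0")
  case True
  have "finite (verts H)" "\<And>e. e \<in> edges H \<Longrightarrow> e \<subseteq> verts H \<and> card e = 3"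
    using H(1) by (simp_all add: three_graph_def)
  with True have "edges H = {}" by fastforce
  then show ?thesis by simp
next
  case False
  let ?n = "card (verts H)" and ?e = "card (edges H)"
  have fin: "finite (verts H)" and E: "\<And>e. e \<in> edges H \<Longrightarrow> e \<subseteq> verts H \<and> card e = 3"
    using H(1) by (simp_all add: three_graph_def)
  have "symmetric (pattern_of (edges H) x)" for x
    by (simp add: symmetric_def pattern_of_def insert_commute)
  then have "symmetrised (pattern_of (edges H) x) \<le> 4223446896" for x
    using symmetrised_le hom_free_pattern[OF H] by blast
  then have "(\<Sum>x\<in>tuples 7 (verts H). symmetrised (pattern_of (edges H) x)) \<le> (\<Sum>x\<in>tuples 7 (verts H). 4223446896)"
    by (rule sum_mono)
  also have "\<dots> = int ?n ^ 7 * 4223446896" by (simp add: card_tuples[OF fin])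
  finally have le: "(\<Sum>x\<in>tuples 7 (verts H). symmetrised (pattern_of (edges H) x)) \<le> int ?n ^ 7 * 4223446896" .
  have "int (5040 * (3645000 * (6 * ?e * ?n ^ 4))) \<le> (\<Sum>x\<in>tuples 7 (verts H). symmetrised (pattern_of (edges H) x))"
    by (rule sum_symmetrised_ge[OF fin E])
  from order_trans[OF this le]
  have "5040 * (3645000 * (6 * int ?e * int ?n ^ 4)) \<le> int ?n ^ 7 * 4223446896" by simp
  then have "real_of_int (5040 * (3645000 * (6 * int ?e * int ?n ^ 4))) \<le> real_of_int (int ?n ^ 7 * 4223446896)"
    by (simp only: of_int_le_iff)
  then have "real ?n ^ 4 * (18370800000 * (6 * real ?e)) \<le> real ?n ^ 4 * (4223446896 * real ?n ^ 3)"
    by (simp add: power_add[symmetric] mult_ac)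
  moreover have "0 < real ?n ^ 4" using False by simp
  ultimately have "18370800000 * (6 * real ?e) \<le> 4223446896 * real ?n ^ 3"
    by (rule mult_left_le_imp_le)
  moreover have "0 \<le> real ?n ^ 3" by simp
  ultimately have bound: "6 * real ?e \<le> 2299 / 10000 * real ?n ^ 3" by linarith
  have decimal: "(0.2299 :: real) = 2299 / 10000" by simp
  show ?thesis unfolding decimal by (rule bound)
qed

theorem lemma1p3: "turan_density F_family \<le> 0.2299"
proof (rule turan_density_le)
  show "edges F \<noteq> {}" if "F \<in> F_family" for F
    using that by (auto simp: F_family_def F1_def F2_def F3_def F4_def F5_def)
qed (rule edges_bound)

end
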